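(* Let $\alpha,\beta>0$ and let $(W(i,i+1))_{i\ge0}$, $(W(i+1,i))_{i\ge0}$ be independent random variables with $W(i,i+1)\sim\Gamma(\alpha,1)$ and $W(i+1,i)\sim\Gamma(\beta,1)$. For $n\ge1$ let $\omega_n$ be the associated environment on $\{0,\dots,n\}$, and set $$\Gamma_n=\sqrt{W(0,1)\,W(n,n-1)\,\mathsf P^{\omega_n}_0(H_n<H_0^+)\,\mathsf P^{\omega_n}_n(H_0<H_n^+)},\qquad e^{S_n}=\sqrt{\frac{W(0,1)\,\mathsf P^{\omega_n}_0(H_n<H_0^+)}{W(n,n-1)\,\mathsf P^{\omega_n}_n(H_0<H_n^+)}}.$$ Let $\mathcal F=(\mathcal F_n)_{n\ge1}$, $\mathcal F_n=\sigma(\Gamma_1,\dots,\Gamma_n)$, be the natural filtration of $(\Gamma_n)_{n\ge1}$. Then, in the filtration $\mathcal F$, $(\Gamma_n)_{n\ge1}$ is a Markov process with known explicit transition kernel. Moreover, for every $n\ge1$, conditionally on $\mathcal F_n$, $e^{S_n}$ has the generalized inverse Gaussian law with parameters $(\alpha-\beta,2\Gamma_n,2\Gamma_n)$.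
   Context: $\mathcal G_n=(V_n,E_n)$ with $V_n=\{0,\dots,n\}$ and $E_n=\{(i,i+1),(i+1,i):0\le i\le n-1\}$. The environment is $\omega_n(i,j)=W(i,j)\big/\sum_{k:(i,k)\in E_n}W(i,k)$ for $(i,j)\in E_n$. $\mathsf P_x^{\omega_n}$ is the law of the Markov chain $(X_k)_{k\ge0}$ on $V_n$ started at $x$ with transition probabilities $\omega_n$. $H_x=\inf\{k\ge0:X_k=x\}$, $H_x^+=\inf\{k\ge1:X_{k-1}\neq x,\ X_k=x\}$. $\Gamma(a,1)$ is the Gamma law with density $x^{a-1}e^{-x}/\Gamma(a)$ on $(0,\infty)$. The generalized inverse Gaussian law with parameters $(p,a,b)$ has density on $(0,\infty)$ proportional to $x^{p-1}\exp(-\tfrac12(ax+b/x))$. *)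

theory Defs
  imports "HOL-Probability.Probability"
begin

section \<open>Markov chains on the natural numbers\<close>

text \<open>The law, on the space of trajectories, of the Markov chain with transition kernel K started
  at x. It is characterised by \<open>sets_chain_law\<close> and \<open>emeasure_chain_law_cylinder\<close> below.\<close>

definition chain_step :: "(nat \<Rightarrow> nat pmf) \<Rightarrow> nat \<Rightarrow> nat \<Rightarrow> (nat \<Rightarrow> nat) \<Rightarrow> nat measure" where
  "chain_step K x k X = measure_pmf (if k = 0 then return_pmf x else K (X (k - 1)))"

definition chain_law :: "(nat \<Rightarrow> nat pmf) \<Rightarrow> nat \<Rightarrow> (nat \<Rightarrow> nat) measure" where
  "chain_law K x =
     projective_family.lim UNIV
       (Ionescu_Tulcea.CI (chain_step K x) (\<lambda>_. count_space UNIV)) (\<lambda>_. count_space UNIV)"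

text \<open>Hitting and return times; the infimum of the empty set is \<open>\<infinity>\<close>.\<close>

definition hit_time :: "nat \<Rightarrow> (nat \<Rightarrow> nat) \<Rightarrow> enat" where
  "hit_time x X = Inf {enat k |k. X k = x}"

definition return_time :: "nat \<Rightarrow> (nat \<Rightarrow> nat) \<Rightarrow> enat" where
  "return_time x X = Inf {enat k |k. 1 \<le> k \<and> X (k - 1) \<noteq> x \<and> X k = x}"


section \<open>The environment on the segment\<close>

definition verts :: "nat \<Rightarrow> nat set" where
  "verts n = {0..n}"

definition edges :: "nat \<Rightarrow> (nat \<times> nat) set" where
  "edges n = {(i, Suc i) |i. i < n} \<union> {(Suc i, i) |i. i < n}"

definition env :: "nat \<Rightarrow> (nat \<Rightarrow> nat \<Rightarrow> real) \<Rightarrow> nat \<Rightarrow> nat \<Rightarrow> real" where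
  "env n w i j = (if (i, j) \<in> edges n then w i j / (\<Sum>k | (i, k) \<in> edges n. w i k) else 0)"

text \<open>Transition probabilities need positive weights, which gamma variables provide almost surely.
  On the null event where some weight is not positive, the chain is made to stay put; the same holds
  at integers outside the vertex set, which are never visited. See \<open>pmf_env_step\<close> below.\<close>

definition env_step :: "nat \<Rightarrow> (nat \<Rightarrow> nat \<Rightarrow> real) \<Rightarrow> nat \<Rightarrow> nat pmf" where
  "env_step n w i =
     (if i \<in> verts n \<and> (\<forall>(j, k)\<in>edges n. 0 < w j k) then embed_pmf (env n w i) else return_pmf i)"

text \<open>Probability, starting from x, that y is hit before the return to x.\<close>

definition escape_prob :: "nat \<Rightarrow> (nat \<Rightarrow> nat \<Rightarrow> real) \<Rightarrow> nat \<Rightarrow> nat \<Rightarrow> real" where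
  "escape_prob n w x y = \<P>(X in chain_law (env_step n w) x. hit_time y X < return_time x X)"

definition Gam :: "nat \<Rightarrow> (nat \<Rightarrow> nat \<Rightarrow> real) \<Rightarrow> real" where
  "Gam n w = sqrt (w 0 1 * w n (n - 1) * escape_prob n w 0 n * escape_prob n w n 0)"

definition expS :: "nat \<Rightarrow> (nat \<Rightarrow> nat \<Rightarrow> real) \<Rightarrow> real" where
  "expS n w = sqrt ((w 0 1 * escape_prob n w 0 n) / (w n (n - 1) * escape_prob n w n 0))"


section \<open>Laws\<close>

definition gamma_density :: "real \<Rightarrow> real \<Rightarrow> real" where
  "gamma_density a x = (if 0 < x then x powr (a - 1) * exp (- x) / Gamma a else 0)"

definition gig_weight :: "real \<Rightarrow> real \<Rightarrow> real \<Rightarrow> real \<Rightarrow> real" where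
  "gig_weight p a b x = (if 0 < x then x powr (p - 1) * exp (- (a * x + b / x) / 2) else 0)"

definition gig_law :: "real \<Rightarrow> real \<Rightarrow> real \<Rightarrow> real measure" where
  "gig_law p a b =
     density lborel (\<lambda>x. ennreal (gig_weight p a b x / (\<integral>y. gig_weight p a b y \<partial>lborel)))"

text \<open>The modified Bessel function of the second kind, for \<open>z > 0\<close>.\<close>

definition besselK :: "real \<Rightarrow> real \<Rightarrow> real" where
  "besselK \<nu> z = (\<integral>u. (if 0 < u then u powr (\<nu> - 1) * exp (- (z / 2) * (u + 1 / u)) else 0) \<partial>lborel) / 2"

text \<open>
  The transition kernel on \<open>(0, \<infinity>)\<close>. With \<open>A = W(0,1) P\<^sub>0(H\<^sub>n < H\<^sub>0\<^sup>+)\<close> and \<open>B = W(n,n-1) P\<^sub>n(H\<^sub>0 < H\<^sub>n\<^sup>+)\<close>, so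
  that \<open>A = x u\<close> and \<open>B = x / u\<close> for \<open>x\<close> the current value and \<open>u = e\<^sup>S\<close>, adding the vertex \<open>n + 1\<close> with
  weights \<open>a = W(n,n+1)\<close> and \<open>b = W(n+1,n)\<close> gives \<open>A' = A a / (a + B)\<close> and \<open>B' = B b / (a + B)\<close>.
  The density below is that of \<open>y = sqrt (A' B')\<close> when \<open>a\<close>, \<open>b\<close> are independent gamma variables and
  \<open>u\<close> is an independent generalized inverse Gaussian variable with parameters \<open>(\<alpha> - \<beta>, 2 x, 2 x)\<close>.\<close>

definition trans_density :: "real \<Rightarrow> real \<Rightarrow> real \<Rightarrow> real \<Rightarrow> real" where
  "trans_density \<alpha> \<beta> x y =
     (if 0 < y then
        4 / (Gamma \<alpha> * Gamma \<beta>) * ((x * y) powr (\<alpha> + \<beta>) / y)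
        * (besselK (\<alpha> + \<beta>) (2 * sqrt (x\<^sup>2 + y\<^sup>2)) / (x\<^sup>2 + y\<^sup>2) powr ((\<alpha> + \<beta>) / 2))
        * (besselK (\<alpha> - \<beta>) (2 * y) / besselK (\<alpha> - \<beta>) (2 * x))
      else 0)"

definition trans_kernel :: "real \<Rightarrow> real \<Rightarrow> real \<Rightarrow> real measure" where
  "trans_kernel \<alpha> \<beta> x = density lborel (\<lambda>y. ennreal (trans_density \<alpha> \<beta> x y))"


section \<open>Conditional laws and Markov processes\<close>

text \<open>\<open>has_cond_law M G Y \<kappa>\<close>: conditionally on the sub-sigma-algebra \<open>G\<close>, \<open>Y\<close> has law \<open>\<kappa> \<omega>\<close>.\<close>

definition has_cond_law ::
  "'a measure \<Rightarrow> 'a measure \<Rightarrow> ('a \<Rightarrow> real) \<Rightarrow> ('a \<Rightarrow> real measure) \<Rightarrow> bool" where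
  "has_cond_law M G Y \<kappa> \<longleftrightarrow>
     subalgebra M G \<and> Y \<in> borel_measurable M \<and>
     (\<forall>A\<in>sets borel. AE \<omega> in M.
        real_cond_exp M G (\<lambda>\<omega>. indicator A (Y \<omega>)) \<omega> = measure (\<kappa> \<omega>) A)"

text \<open>Processes are indexed by the positive integers; the value at index 0 is irrelevant.\<close>

definition natural_filtration :: "'a measure \<Rightarrow> (nat \<Rightarrow> 'a \<Rightarrow> real) \<Rightarrow> nat \<Rightarrow> 'a measure" where
  "natural_filtration M X n =
     sigma (space M) {X k -` A \<inter> space M |k A. k \<in> {1..n} \<and> A \<in> sets borel}"

definition markov_kernel_on :: "real set \<Rightarrow> (real \<Rightarrow> real measure) \<Rightarrow> bool" where
  "markov_kernel_on S K \<longleftrightarrow>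
     K \<in> restrict_space borel S \<rightarrow>\<^sub>M prob_algebra borel \<and> (\<forall>x\<in>S. AE y in K x. y \<in> S)"

definition markov_process ::
  "'a measure \<Rightarrow> (nat \<Rightarrow> 'a measure) \<Rightarrow> real set \<Rightarrow> (real \<Rightarrow> real measure) \<Rightarrow> (nat \<Rightarrow> 'a \<Rightarrow> real) \<Rightarrow> bool" where
  "markov_process M F S K X \<longleftrightarrow>
     filtration (space M) F \<and> markov_kernel_on S K \<and>
     (\<forall>n\<ge>1. X n \<in> borel_measurable (F n) \<and> (AE \<omega> in M. X n \<omega> \<in> S) \<and>
        has_cond_law M (F n) (X (Suc n)) (\<lambda>\<omega>. K (X n \<omega>)))"


section \<open>Consistency of the definitions\<close>

lemma finite_edges_from: "finite {k. (i, k) \<in> edges n}"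
  by (rule finite_subset[of _ "{..n}"]) (auto simp: edges_def)

lemma pmf_env_step:
  assumes "1 \<le> n" "i \<in> verts n" and pos: "\<And>j k. (j, k) \<in> edges n \<Longrightarrow> 0 < w j k"
  shows "pmf (env_step n w i) j = env n w i j"
proof -
  let ?N = "{k. (i, k) \<in> edges n}"
  have "(if i = n then i - 1 else Suc i) \<in> ?N"
    using assms(1,2) by (cases i) (auto simp: edges_def verts_def)
  then have "?N \<noteq> {}"
    by blast
  then have s: "0 < (\<Sum>k\<in>?N. w i k)"
    using pos finite_edges_from by (intro sum_pos) auto
  have nn: "0 \<le> env n w i k" for k
    using less_imp_le[OF s] pos[of i k] by (simp add: env_def less_imp_le)
  have "(\<integral>\<^sup>+k. ennreal (env n w i k) \<partial>count_space UNIV) = (\<Sum>k\<in>?N. ennreal (env n w i k))"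
    by (intro nn_integral_count_space' finite_edges_from) (auto simp: env_def)
  also have "\<dots> = ennreal (\<Sum>k\<in>?N. env n w i k)"
    by (simp add: nn sum_ennreal)
  also have "(\<Sum>k\<in>?N. env n w i k) = (\<Sum>k\<in>?N. w i k / (\<Sum>k\<in>?N. w i k))"
    by (simp add: env_def)
  also have "\<dots> = 1"
    using s by (simp flip: sum_divide_distrib)
  finally have "pmf (embed_pmf (env n w i)) j = env n w i j"
    using nn by (intro pmf_embed_pmf) (simp_all only: ennreal_1)
  moreover have "env_step n w i = embed_pmf (env n w i)"
    using assms(2) pos unfolding env_step_def by (intro if_P conjI ballI) auto
  ultimately show ?thesis
    by simp
qed

lemma Ionescu_Tulcea_chain_step: "Ionescu_Tulcea (chain_step K x) (\<lambda>_. count_space UNIV)"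
proof (rule Ionescu_Tulcea.intro)
  fix i
  show "chain_step K x i \<in>
    (\<Pi>\<^sub>M j\<in>{0..<i}. count_space UNIV) \<rightarrow>\<^sub>M subprob_algebra (count_space UNIV)"
  proof (cases "i = 0")
    case True
    then have "chain_step K x i = (\<lambda>_. measure_pmf (return_pmf x))"
      by (simp add: chain_step_def fun_eq_iff)
    then show ?thesis
      by (simp add: space_subprob_algebra measure_pmf.subprob_space_axioms)
  next
    case False
    have "(\<lambda>X. X (i - 1)) \<in> (\<Pi>\<^sub>M j\<in>{0..<i}. count_space (UNIV :: nat set)) \<rightarrow>\<^sub>M count_space UNIV"
      using False by (intro measurable_component_singleton) auto
    moreover have "(\<lambda>j. measure_pmf (K j)) \<in> count_space UNIV \<rightarrow>\<^sub>M subprob_algebra (count_space UNIV)"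
      by (auto simp: space_subprob_algebra measure_pmf.subprob_space_axioms)
    ultimately have "(\<lambda>X. measure_pmf (K (X (i - 1)))) \<in>
        (\<Pi>\<^sub>M j\<in>{0..<i}. count_space UNIV) \<rightarrow>\<^sub>M subprob_algebra (count_space UNIV)"
      by (rule measurable_compose)
    moreover have "chain_step K x i = (\<lambda>X. measure_pmf (K (X (i - 1))))"
      using False by (simp add: chain_step_def fun_eq_iff)
    ultimately show ?thesis
      by simp
  qed
next
  show "prob_space (chain_step K x i X)" if "X \<in> space (\<Pi>\<^sub>M j\<in>{0..<i}. count_space UNIV)" for i X
    unfolding chain_step_def by (rule measure_pmf.prob_space_axioms)
qed

lemma sets_chain_law: "sets (chain_law K x) = sets (\<Pi>\<^sub>M k\<in>UNIV. count_space UNIV)"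
proof -
  interpret Ionescu_Tulcea "chain_step K x" "\<lambda>_. count_space UNIV"
    by (rule Ionescu_Tulcea_chain_step)
  show ?thesis
    by (simp add: chain_law_def)
qed

lemma prob_space_chain_law: "prob_space (chain_law K x)"
proof -
  interpret Ionescu_Tulcea "chain_step K x" "\<lambda>_. count_space UNIV"
    by (rule Ionescu_Tulcea_chain_step)
  have "prob_space (distr PF.lim (PiM {} (\<lambda>_. count_space UNIV)) (\<lambda>X. restrict X {}))"
    unfolding distr_lim[OF finite.emptyI] by (rule PF.prob_space_P) auto
  moreover have "(\<lambda>X. restrict X {}) \<in> PF.lim \<rightarrow>\<^sub>M PiM {} (\<lambda>_. count_space UNIV)"
    unfolding measurable_cong_sets[OF PF.sets_lim refl] by (rule measurable_restrict_subset) simp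
  ultimately show ?thesis
    unfolding chain_law_def by (rule prob_space_distrD[rotated])
qed

lemma emeasure_chain_law_cylinder:
  "emeasure (chain_law K x) {X. \<forall>k\<le>m. X k = y k} =
     (if y 0 = x then (\<Prod>k<m. ennreal (pmf (K (y k)) (y (Suc k)))) else 0)"
proof -
  interpret Ionescu_Tulcea "chain_step K x" "\<lambda>_. count_space UNIV"
    by (rule Ionescu_Tulcea_chain_step)
  let ?P = "\<lambda>m. \<Pi>\<^sub>M k\<in>{0..<m}. count_space (UNIV :: nat set)"
  let ?y = "\<lambda>m. restrict y {0..<m}"
  let ?u = "\<lambda>_. undefined :: nat"
  have single: "{?y m} = PiE {0..<m} (\<lambda>k. {y k})" for m
    by (auto simp: PiE_iff extensional_def fun_eq_iff)
  have meas: "{?y m} \<in> sets (?P m)" for m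
    unfolding single by (intro sets_PiM_I_finite) auto
  have u: "?u \<in> space (?P 0)"
    by (simp add: space_PiM PiE_iff extensional_def)
  have step: "emeasure (C 0 (Suc m) ?u) {?y (Suc m)} =
      emeasure (C 0 m ?u) {?y m} * emeasure (chain_step K x m (?y m)) {y m}" for m
  proof -
    have "emeasure (C 0 (Suc m) ?u) {?y (Suc m)} =
        (\<integral>\<^sup>+X. emeasure (eP m X) {?y (Suc m)} \<partial>C 0 m ?u)"
      using emeasure_bind[of "C 0 m ?u" "eP m" "?P (Suc m)" "{?y (Suc m)}"] meas[of "Suc m"]
        measurable_eP[of m] prob_space_C[OF u, THEN prob_space.not_empty, of m]
      by (simp add: measurable_cong_sets[OF sets_C[OF u]])
    also have "\<dots> = (\<integral>\<^sup>+X. emeasure (chain_step K x m (?y m)) {y m} * indicator {?y m} X \<partial>C 0 m ?u)"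
    proof (intro nn_integral_cong)
      fix X assume "X \<in> space (C 0 m ?u)"
      then have X: "X \<in> space (?P m)"
        using space_C[OF u, of m] by simp
      then have e: "X k = undefined" if "m \<le> k" for k
        using that by (auto simp: space_PiM PiE_def extensional_def)
      have iff: "X(m := j) = ?y (Suc m) \<longleftrightarrow> X = ?y m \<and> j = y m" for j
      proof
        assume eq: "X(m := j) = ?y (Suc m)"
        have "X k = ?y m k" for k
          using fun_cong[OF eq, of k] e[of k] by (cases "k < m") auto
        then show "X = ?y m \<and> j = y m"
          using fun_cong[OF eq, of m] by (simp add: fun_eq_iff)
      next
        assume "X = ?y m \<and> j = y m"
        then show "X(m := j) = ?y (Suc m)"
          by (simp add: fun_eq_iff less_Suc_eq)
      qed
      have "(\<lambda>j. X(m := j)) -` {?y (Suc m)} = {j. X = ?y m \<and> j = y m}"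
        by (simp only: vimage_def singleton_iff iff)
      then have *: "emeasure (eP m X) {?y (Suc m)} = emeasure (chain_step K x m X) {j. X = ?y m \<and> j = y m}"
        using emeasure_eP[OF X meas[of "Suc m"]] by (simp only: space_count_space Int_UNIV_right)
      show "emeasure (eP m X) {?y (Suc m)} =
          emeasure (chain_step K x m (?y m)) {y m} * indicator {?y m} X"
      proof (cases "X = ?y m")
        case True
        then have "{j. X = ?y m \<and> j = y m} = {y m}" "indicator {?y m} X = (1 :: ennreal)"
          by (simp_all only: simp_thms singleton_conv indicator_simps singletonI)
        with True show ?thesis
          unfolding * by (simp only: mult_1_right)
      next
        case False
        then have "{j. X = ?y m \<and> j = y m} = {}" "indicator {?y m} X = (0 :: ennreal)"
          by (simp_all only: simp_thms Collect_empty_eq indicator_simps singleton_iff if_False)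
        then show ?thesis
          unfolding * by (simp only: mult_zero_right emeasure_empty)
      qed
    qed
    also have "\<dots> = emeasure (C 0 m ?u) {?y m} * emeasure (chain_step K x m (?y m)) {y m}"
    proof -
      have "{?y m} \<in> sets (C 0 m ?u)"
        using meas[of m] sets_C[OF u, of m] by simp
      then show ?thesis
        by (subst nn_integral_cmult_indicator) (simp_all add: mult.commute)
    qed
    finally show ?thesis .
  qed
  have C: "emeasure (C 0 (Suc m) ?u) {?y (Suc m)} =
      (if y 0 = x then (\<Prod>k<m. ennreal (pmf (K (y k)) (y (Suc k)))) else 0)" for m
  proof (induction m)
    case 0
    have "emeasure (C 0 0 ?u) {?y 0} = 1"
      using meas[of 0] by (simp add: restrict_def)
    then show ?case
      unfolding step[of 0] by (simp add: chain_step_def emeasure_pmf_single)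
  next
    case (Suc m)
    show ?case
      unfolding step[of "Suc m"] Suc by (simp add: chain_step_def emeasure_pmf_single)
  qed
  have "{X. \<forall>k\<le>m. X k = y k} = PF.emb UNIV {0..<Suc m} {?y (Suc m)}"
    unfolding single by (auto simp: prod_emb_def space_PiM less_Suc_eq_le PiE_iff)
  also have "emeasure PF.lim \<dots> = emeasure (CI {0..<Suc m}) {?y (Suc m)}"
    by (rule lim) (auto intro: meas)
  also have "\<dots> = emeasure (C 0 (Suc m) ?u) {?y (Suc m)}"
    unfolding emeasure_CI[OF subset_refl meas]
    by (subst prod_emb_id) (use sets.sets_into_space[OF meas[of "Suc m"]] in \<open>simp_all add: space_PiM\<close>)
  finally show ?thesis
    using C[of m] by (simp add: chain_law_def)
qed

end

theory Submission
  imports Defs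
begin

text \<open>
  On a segment, the hitting probabilities are harmonic, so \<open>A\<^sub>n = W(0,1) P\<^sub>0(H\<^sub>n < H\<^sub>0\<^sup>+)\<close> and
  \<open>B\<^sub>n = W(n,n-1) P\<^sub>n(H\<^sub>0 < H\<^sub>n\<^sup>+)\<close> are explicit and satisfy \<open>A\<^sub>n\<^sub>+\<^sub>1 = A\<^sub>n a / (a + B\<^sub>n)\<close> and
  \<open>B\<^sub>n\<^sub>+\<^sub>1 = B\<^sub>n b / (a + B\<^sub>n)\<close> with the new weights \<open>a\<close> and \<open>b\<close>. Hence \<open>(\<Gamma>\<^sub>n, e\<^sup>S)\<close> is a Markov chain. Its
  kernel is intertwined with the generalized inverse Gaussian law: if \<open>e\<^sup>S\<close> has that law given
  \<open>\<Gamma>\<^sub>n = x\<close>, then after one step the joint density of the new pair factors into the density of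
  \<open>\<Gamma>\<^sub>n\<^sub>+\<^sub>1\<close> given \<open>x\<close> and the generalized inverse Gaussian density attached to \<open>\<Gamma>\<^sub>n\<^sub>+\<^sub>1\<close> alone. Induction on
  \<open>n\<close> gives the conditional law of \<open>e\<^sup>S\<close>, and averaging over it gives the Markov property of \<open>\<Gamma>\<close>.
\<close>

section \<open>First-step analysis\<close>

text \<open>The value \<Gamma>_{n+1} depends on e^S as well as on \<Gamma>_n, so \<Gamma> is not
  visibly Markov. What saves it is that its past reveals about e^S only what \<Gamma>_n does. Hence
  the conditional law is carried for the whole history: \<open>cond_gig\<close> is a disintegration
  tested against all nonnegative functions of (\<Gamma>_1, ..., \<Gamma>_n, e^S), and the past rides
  along as a parameter while one step is taken. The source of the factorisation is visible at n = 1: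
  with a = x u and b = x / u the exponent a + b is x (u + 1 / u), whence the two parameters 2 x, and
  the powers together with the Jacobian leave u^(\<alpha> - \<beta> - 1). In later steps the old u
  is traded for z = A - A'. The integral over z gives the Bessel function of order \<alpha> +
  \<beta>; the ratio of those of order \<alpha> - \<beta> in the kernel comes from normalising the
  old and the new law. Everything is computed with nonnegative integrals, where Tonelli and
  substitution hold with infinite values; real conditional expectations enter only in
  \<open>has_cond_lawI\<close>.\<close>

abbreviation path_space :: "(nat \<Rightarrow> nat) measure" where
  "path_space \<equiv> \<Pi>\<^sub>M k\<in>UNIV. count_space UNIV"

definition cylinder :: "nat \<Rightarrow> (nat \<Rightarrow> nat) \<Rightarrow> (nat \<Rightarrow> nat) set" where
  "cylinder m y = {X. \<forall>k\<le>m. X k = y k}"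

lemma space_path_space: "space path_space = UNIV"
  by (simp add: space_PiM)

lemma sets_coordinate: "{X. X i \<in> A} \<in> sets path_space"
proof -
  have "(\<lambda>X. X i) -` A \<inter> space path_space \<in> sets path_space"
    by (intro measurable_sets[OF measurable_component_singleton]) auto
  then show ?thesis
    by (simp add: space_path_space vimage_def)
qed

lemma sets_cylinder: "cylinder m y \<in> sets path_space"
proof -
  have "cylinder m y = (\<Inter>k\<in>{..m}. {X. X k \<in> {y k}})"
    by (auto simp: cylinder_def)
  also have "\<dots> \<in> sets path_space"
    by (intro sets.finite_INT sets_coordinate) auto
  finally show ?thesis .
qed

text \<open>Two cylinders are nested if they agree up to the shorter length and disjoint otherwise,
  which is why the empty set is added.\<close>

lemma Int_stable_cylinders: "Int_stable (insert {} {cylinder m y |m y. True})"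
proof (rule Int_stableI)
  have *: "cylinder m y \<inter> cylinder m' y' \<in> insert {} {cylinder m y |m y. True}" if "m \<le> m'" for m m' y y'
  proof (cases "\<forall>k\<le>m. y k = y' k")
    case True
    then have "cylinder m y \<inter> cylinder m' y' = cylinder m' y'"
      using that by (auto simp: cylinder_def)
    then show ?thesis by blast
  next
    case False
    then have "cylinder m y \<inter> cylinder m' y' = {}"
      using that by (auto simp: cylinder_def)
    then show ?thesis by blast
  qed
  fix A B assume "A \<in> insert {} {cylinder m y |m y. True}" "B \<in> insert {} {cylinder m y |m y. True}"
  then show "A \<inter> B \<in> insert {} {cylinder m y |m y. True}"
    using * nat_le_linear by (smt (verit) Int_commute Int_empty_left insert_iff mem_Collect_eq)
qed

lemma sets_path_space_cylinders:
  "sets path_space = sigma_sets UNIV (insert {} {cylinder m y |m y. True})" (is "_ = sigma_sets _ ?C")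
proof
  interpret C: sigma_algebra UNIV "sigma_sets UNIV ?C"
    by (rule sigma_algebra_sigma_sets) auto
  show "sigma_sets UNIV ?C \<subseteq> sets path_space"
    using sets.sigma_sets_subset[of ?C path_space] sets_cylinder by (auto simp: space_path_space)
  have coord: "{X. X i \<in> A} \<in> sigma_sets UNIV ?C" for i A
  proof -
    \<comment> \<open>Only the first i + 1 values matter, and there are countably many lists of
      naturals, so a coordinate event is a countable union of cylinders.\<close>
    have "{X. X i \<in> A} = (\<Union>l\<in>{l. length l = Suc i \<and> l ! i \<in> A}. cylinder i (\<lambda>k. l ! k))"
    proof (intro set_eqI iffI)
      fix X assume "X \<in> {X. X i \<in> A}"
      then show "X \<in> (\<Union>l\<in>{l. length l = Suc i \<and> l ! i \<in> A}. cylinder i (\<lambda>k. l ! k))"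
        by (intro UN_I[where a = "map X [0..<Suc i]"])
           (auto simp: cylinder_def nth_append simp del: upt_Suc)
    qed (auto simp: cylinder_def)
    also have "\<dots> \<in> sigma_sets UNIV ?C"
      by (intro C.countable_UN'') auto
    finally show ?thesis .
  qed
  show "sets path_space \<subseteq> sigma_sets UNIV ?C"
    unfolding sets_PiM_single space_count_space PiE_UNIV_domain Pi_UNIV
    by (intro C.sigma_sets_subset) (use coord in auto)
qed

lemma measurable_case_nat_path: "case_nat x \<in> path_space \<rightarrow>\<^sub>M path_space"
proof (rule measurable_PiM_single')
  fix i :: nat
  show "(\<lambda>X. case_nat x X i) \<in> path_space \<rightarrow>\<^sub>M count_space UNIV"
    by (cases i) auto
qed auto

lemma measurable_shifted_chain_law:
  "(\<lambda>y. distr (chain_law K y) path_space (case_nat x)) \<in> measure_pmf p \<rightarrow>\<^sub>M subprob_algebra path_space"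
proof -
  have "prob_space (distr (chain_law K y) path_space (case_nat x))" for y
    by (intro prob_space.prob_space_distr prob_space_chain_law)
       (simp add: measurable_cong_sets[OF sets_chain_law refl] measurable_case_nat_path)
  then show ?thesis
    by (auto simp: space_subprob_algebra prob_space_imp_subprob_space)
qed

text \<open>The Markov property at time one. The law is known through its values on cylinders, so
  the two measures are compared on that generator; \<open>case_nat x\<close> puts the starting point
  back in front of the shifted path.\<close>

lemma chain_law_first_step:
  "chain_law K x = measure_pmf (K x) \<bind> (\<lambda>y. distr (chain_law K y) path_space (case_nat x))"
    (is "_ = ?N")
proof (rule measure_eqI_generator_eq[OF Int_stable_cylinders])
  have N: "emeasure ?N A = (\<integral>\<^sup>+y. emeasure (chain_law K y) {X. case_nat x X \<in> A} \<partial>K x)"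
    if "A \<in> sets path_space" for A
    using that
    by (subst emeasure_bind[OF _ measurable_shifted_chain_law])
       (auto intro!: nn_integral_cong simp: emeasure_distr measurable_cong_sets[OF sets_chain_law refl]
          measurable_case_nat_path vimage_def sets_eq_imp_space_eq[OF sets_chain_law] space_path_space)
  have setsN: "sets ?N = sets path_space"
    by (subst sets_bind[of _ _ path_space]) auto
  show "insert {} {cylinder m y |m y. True} \<subseteq> Pow UNIV"
    by simp
  show "sets (chain_law K x) = sigma_sets UNIV (insert {} {cylinder m y |m y. True})"
    "sets ?N = sigma_sets UNIV (insert {} {cylinder m y |m y. True})"
    by (simp_all only: sets_path_space_cylinders sets_chain_law setsN)
  have cyl: "emeasure (chain_law K x) (cylinder m y) = emeasure ?N (cylinder m y)" for m y
  proof (cases m)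
    case 0
    have "emeasure ?N (cylinder 0 y) = (\<integral>\<^sup>+y'. indicator {x} (y 0) \<partial>K x)"
      unfolding N[OF sets_cylinder]
    proof (intro nn_integral_cong)
      fix y'
      interpret prob_space "chain_law K y'" by (rule prob_space_chain_law)
      have "emeasure (chain_law K y') UNIV = 1"
        using emeasure_space_1 by (simp add: sets_eq_imp_space_eq[OF sets_chain_law] space_path_space)
      then show "emeasure (chain_law K y') {X. case_nat x X \<in> cylinder 0 y} = indicator {x} (y 0)"
        by (cases "y 0 = x") (auto simp: cylinder_def)
    qed
    then show ?thesis
      using emeasure_chain_law_cylinder[of K x 0 y] 0 by (auto simp: cylinder_def)
  next
    case (Suc m')
    have "emeasure ?N (cylinder (Suc m') y) = (\<integral>\<^sup>+y'. (if y 0 = x \<and> y 1 = y' then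
        (\<Prod>k<m'. ennreal (pmf (K (y (Suc k))) (y (Suc (Suc k))))) else 0) \<partial>K x)"
      unfolding N[OF sets_cylinder]
    proof (intro nn_integral_cong)
      fix y'
      have "{X. case_nat x X \<in> cylinder (Suc m') y} =
          (if y 0 = x then {X. \<forall>k\<le>m'. X k = y (Suc k)} else {})"
        using All_less_Suc2[of "Suc m'"] by (auto simp: cylinder_def simp flip: less_Suc_eq_le)
      then show "emeasure (chain_law K y') {X. case_nat x X \<in> cylinder (Suc m') y} =
          (if y 0 = x \<and> y 1 = y' then
        (\<Prod>k<m'. ennreal (pmf (K (y (Suc k))) (y (Suc (Suc k))))) else 0)"
        using emeasure_chain_law_cylinder[of K y' m' "\<lambda>k. y (Suc k)"] by auto
    qed
    also have "\<dots> = (if y 0 = x then (\<Prod>k<m'. ennreal (pmf (K (y (Suc k))) (y (Suc (Suc k)))))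
        * pmf (K x) (y 1) else 0)"
      by (subst nn_integral_measure_pmf_support[of "{y 1}"]) auto
    also have "\<dots> = emeasure (chain_law K x) (cylinder (Suc m') y)"
      using emeasure_chain_law_cylinder[of K x "Suc m'" y]
      by (simp add: cylinder_def prod.lessThan_Suc_shift mult.commute del: prod.lessThan_Suc)
    finally show ?thesis using Suc by simp
  qed
  then show "emeasure (chain_law K x) A = emeasure ?N A"
    if "A \<in> insert {} {cylinder m y |m y. True}" for A
    using that by auto
  interpret prob_space "chain_law K x" by (rule prob_space_chain_law)
  show "range (\<lambda>i. cylinder 0 (\<lambda>_. i)) \<subseteq> insert {} {cylinder m y |m y. True}"
    by auto
  show "(\<Union>i. cylinder 0 (\<lambda>_. i)) = UNIV"
    by (auto simp: cylinder_def)
  show "emeasure (chain_law K x) (cylinder 0 (\<lambda>_. i)) \<noteq> \<infinity>" for i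
    by simp
qed

lemma emeasure_chain_law_first_step:
  assumes "A \<in> sets path_space"
  shows "emeasure (chain_law K x) A = (\<integral>\<^sup>+y. emeasure (chain_law K y) {X. case_nat x X \<in> A} \<partial>K x)"
  using assms unfolding chain_law_first_step[of K x]
  by (subst emeasure_bind[OF _ measurable_shifted_chain_law])
       (auto intro!: nn_integral_cong simp: emeasure_distr measurable_cong_sets[OF sets_chain_law refl]
          measurable_case_nat_path vimage_def sets_eq_imp_space_eq[OF sets_chain_law] space_path_space)

lemma measure_chain_law_first_step:
  assumes "A \<in> sets path_space"
  shows "measure (chain_law K x) A = (\<integral>y. measure (chain_law K y) {X. case_nat x X \<in> A} \<partial>K x)"
proof -
  have fin: "finite_measure (chain_law K y)" for y
    using prob_space_chain_law by (rule prob_space.finite_measure)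
  have "ennreal (measure (chain_law K x) A) =
      (\<integral>\<^sup>+y. ennreal (measure (chain_law K y) {X. case_nat x X \<in> A}) \<partial>K x)"
    using emeasure_chain_law_first_step[OF assms, of K x]
    by (simp add: finite_measure.emeasure_eq_measure[OF fin])
  also have "\<dots> = ennreal (\<integral>y. measure (chain_law K y) {X. case_nat x X \<in> A} \<partial>K x)"
    by (intro nn_integral_eq_integral measure_pmf.integrable_const_bound[where B = 1])
       (auto simp: prob_space.prob_le_1[OF prob_space_chain_law])
  finally show ?thesis
    by (subst (asm) ennreal_inj) auto
qed

lemma AE_chain_law_start: "AE X in chain_law K x. X 0 = x"
proof -
  interpret prob_space "chain_law K x" by (rule prob_space_chain_law)
  have "prob {X. X 0 = x} = 1"
    using emeasure_chain_law_cylinder[of K x 0 "\<lambda>_. x"] by (simp add: emeasure_eq_measure)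
  then show ?thesis
    using AE_prob_1[of "{X. X 0 = x}"] by simp
qed

section \<open>Hitting and escape events in path space\<close>

definition hits_before :: "nat \<Rightarrow> nat \<Rightarrow> (nat \<Rightarrow> nat) set" where
  "hits_before y z = {X. \<exists>k. X k = y \<and> (\<forall>j<k. X j \<noteq> z)}"

lemma sets_INT_lessThan:
  assumes "\<And>j. E j \<in> sets path_space"
  shows "(\<Inter>j\<in>{..<k::nat}. E j) \<in> sets path_space"
proof (cases "k = 0")
  case True
  then show ?thesis
    using sets.top[of path_space] by (simp only: space_path_space lessThan_0 INT_empty)
next
  case False
  then show ?thesis
    by (intro sets.finite_INT assms) auto
qed

lemma sets_hits_before: "hits_before y z \<in> sets path_space"
proof -
  have "(\<Inter>j\<in>{..<k}. {X. X j \<in> - {z}}) \<in> sets path_space" for k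
    by (rule sets_INT_lessThan) (rule sets_coordinate)
  then have "(\<Union>k. {X. X k \<in> {y}} \<inter> (\<Inter>j\<in>{..<k}. {X. X j \<in> - {z}})) \<in> sets path_space"
    by (intro sets.countable_nat_UN image_subsetI sets.Int sets_coordinate)
  also have "(\<Union>k. {X. X k \<in> {y}} \<inter> (\<Inter>j\<in>{..<k}. {X. X j \<in> - {z}})) = hits_before y z"
    by (auto simp: hits_before_def)
  finally show ?thesis .
qed

lemma case_nat_hits_before:
  "{X. case_nat x X \<in> hits_before y z} = (if x = y then UNIV else if x = z then {} else hits_before y z)"
proof -
  have "case_nat x X \<in> hits_before y z \<longleftrightarrow> x = y \<or> x \<noteq> z \<and> X \<in> hits_before y z" for X
  proof
    assume "case_nat x X \<in> hits_before y z"
    then obtain k where k: "case_nat x X k = y" "\<And>j. j < k \<Longrightarrow> case_nat x X j \<noteq> z"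
      by (auto simp: hits_before_def)
    show "x = y \<or> x \<noteq> z \<and> X \<in> hits_before y z"
    proof (cases k)
      case (Suc k')
      have "X j \<noteq> z" if "j < k'" for j
        using k(2)[of "Suc j"] Suc that by simp
      then show ?thesis
        using k(1) k(2)[of 0] Suc by (auto simp: hits_before_def)
    qed (use k in simp)
  next
    assume "x = y \<or> x \<noteq> z \<and> X \<in> hits_before y z"
    then show "case_nat x X \<in> hits_before y z"
    proof
      assume "x = y"
      then show ?thesis by (auto simp: hits_before_def intro!: exI[of _ 0])
    next
      assume *: "x \<noteq> z \<and> X \<in> hits_before y z"
      then obtain k where "X k = y" "\<forall>j<k. X j \<noteq> z"
        unfolding hits_before_def by blast
      then show ?thesis
        using * unfolding hits_before_def mem_Collect_eq
        by (intro exI[of _ "Suc k"]) (auto simp: less_Suc_eq_0_disj)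
    qed
  qed
  then show ?thesis by auto
qed

text \<open>Eliminates the infima, infinite ones included: \<open>enat k\<close> lies strictly below
  the second infimum exactly when Q fails at every time up to and including k.\<close>

lemma Inf_enat_less_Inf_enat:
  "Inf {enat k |k. P k} < Inf {enat k |k. Q k} \<longleftrightarrow> (\<exists>k. P k \<and> (\<forall>j\<le>k. \<not> Q j))"
proof -
  have "enat k < Inf {enat k |k. Q k} \<longleftrightarrow> (\<forall>j\<le>k. \<not> Q j)" for k
  proof -
    have "enat k < Inf {enat k |k. Q k} \<longleftrightarrow> \<not> Inf {enat k |k. Q k} < enat (Suc k)"
      by (simp add: not_less Suc_ile_eq)
    also have "\<dots> \<longleftrightarrow> (\<forall>j\<le>k. \<not> Q j)"
      by (auto simp: Inf_less_iff less_Suc_eq_le)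
    finally show ?thesis .
  qed
  then show ?thesis
    by (auto simp: Inf_less_iff)
qed

definition escapes :: "nat \<Rightarrow> nat \<Rightarrow> (nat \<Rightarrow> nat) set" where
  "escapes x y = {X. hit_time y X < return_time x X}"

lemma escapes_iff:
  "X \<in> escapes x y \<longleftrightarrow> (\<exists>k. X k = y \<and> (\<forall>j<k. X j \<noteq> x \<longrightarrow> X (Suc j) \<noteq> x))"
proof -
  have "(\<forall>j\<le>k. \<not> (1 \<le> j \<and> X (j - 1) \<noteq> x \<and> X j = x)) \<longleftrightarrow> (\<forall>j<k. X j \<noteq> x \<longrightarrow> X (Suc j) \<noteq> x)" for k
  proof (intro iffI allI impI)
    fix j assume "\<forall>j<k. X j \<noteq> x \<longrightarrow> X (Suc j) \<noteq> x" "j \<le> k"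
    then show "\<not> (1 \<le> j \<and> X (j - 1) \<noteq> x \<and> X j = x)"
      by (cases j) (auto dest: spec[of _ "j - 1"])
  next
    fix j assume "\<forall>j\<le>k. \<not> (1 \<le> j \<and> X (j - 1) \<noteq> x \<and> X j = x)" "j < k" "X j \<noteq> x"
    then show "X (Suc j) \<noteq> x"
      by (auto dest: spec[of _ "Suc j"])
  qed
  then show ?thesis
    by (simp add: escapes_def hit_time_def return_time_def Inf_enat_less_Inf_enat)
qed

lemma sets_escapes: "escapes x y \<in> sets path_space"
proof -
  let ?E = "\<lambda>k. \<Inter>j\<in>{..<k}. {X. X j \<in> {x}} \<union> {X. X (Suc j) \<in> - {x}}"
  have "?E k \<in> sets path_space" for k
    by (rule sets_INT_lessThan) (intro sets.Un sets_coordinate)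
  then have "(\<Union>k. {X. X k \<in> {y}} \<inter> ?E k) \<in> sets path_space"
    by (intro sets.countable_nat_UN image_subsetI sets.Int sets_coordinate)
  also have "(\<Union>k. {X. X k \<in> {y}} \<inter> ?E k) = escapes x y"
  proof (rule set_eqI)
    fix X
    show "X \<in> (\<Union>k. {X. X k \<in> {y}} \<inter> ?E k) \<longleftrightarrow> X \<in> escapes x y"
      unfolding escapes_iff by (auto simp: Ball_def)
  qed
  finally show ?thesis .
qed

text \<open>The escape event forbids entering x from elsewhere. Once the first step has left x,
  induction along the path turns this into never being at x, so a return time becomes an ordinary
  hitting time.\<close>

lemma case_nat_escapes:
  assumes "x \<noteq> y" "X 0 \<noteq> x"
  shows "case_nat x X \<in> escapes x y \<longleftrightarrow> X \<in> hits_before y x"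
proof
  assume "case_nat x X \<in> escapes x y"
  then obtain k where k: "case_nat x X k = y"
      "\<And>j. j < k \<Longrightarrow> case_nat x X j \<noteq> x \<Longrightarrow> case_nat x X (Suc j) \<noteq> x"
    by (auto simp: escapes_iff)
  then obtain k' where k': "k = Suc k'"
    using \<open>x \<noteq> y\<close> by (cases k) auto
  have "X j \<noteq> x" if "j \<le> k'" for j
    using that
  proof (induction j)
    case (Suc j)
    then show ?case using k(2)[of "Suc j"] k' by simp
  qed (use assms in simp)
  then show "X \<in> hits_before y x"
    using k(1) k' unfolding hits_before_def mem_Collect_eq by (intro exI[of _ k']) auto
next
  assume "X \<in> hits_before y x"
  then obtain k where k: "X k = y" "\<And>j. j < k \<Longrightarrow> X j \<noteq> x"
    by (auto simp: hits_before_def)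
  then have "X j \<noteq> x" if "j \<le> k" for j
    using that \<open>x \<noteq> y\<close> by (cases "j = k") auto
  then show "case_nat x X \<in> escapes x y"
    using k(1) unfolding escapes_iff by (intro exI[of _ "Suc k"]) (simp add: less_Suc_eq_le)
qed

text \<open>As the chain cannot stay at x, the first step lands off x with probability one, which is
  what \<open>case_nat_escapes\<close> asks of the shifted path. Its condition on \<open>X 0\<close>
  holds almost surely, hence the comparison of measures through
  \<open>measure_eq_AE\<close>.\<close>

lemma measure_escapes:
  assumes "x \<noteq> y" "pmf (K x) x = 0"
  shows "measure (chain_law K x) (escapes x y) =
    (\<integral>v. measure (chain_law K v) (hits_before y x) \<partial>K x)"
  unfolding measure_chain_law_first_step[OF sets_escapes]
proof (intro integral_cong_AE)
  have "measure (chain_law K v) {X. case_nat x X \<in> escapes x y} = measure (chain_law K v) (hits_before y x)"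
    if "v \<in> set_pmf (K x)" for v
  proof -
    have "v \<noteq> x"
      using that assms(2) by (auto simp: set_pmf_iff)
    then have "AE X in chain_law K v. X \<in> {X. case_nat x X \<in> escapes x y} \<longleftrightarrow> X \<in> hits_before y x"
      using AE_chain_law_start[where K = K and x = v] case_nat_escapes[OF assms(1)] by auto
    moreover have "case_nat x -` escapes x y \<inter> space path_space \<in> sets path_space"
      by (rule measurable_sets[OF measurable_case_nat_path sets_escapes])
    ultimately show ?thesis
      by (intro measure_eq_AE) (auto simp: sets_chain_law sets_hits_before vimage_def space_path_space)
  qed
  then show "AE v in K x. measure (chain_law K v) {X. case_nat x X \<in> escapes x y} =
      measure (chain_law K v) (hits_before y x)"
    by (simp add: AE_measure_pmf_iff)
qed auto

lemma escape_prob_eq_measure: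
  "escape_prob n w x y = measure (chain_law (env_step n w) x) (escapes x y)"
  by (simp add: escape_prob_def escapes_def sets_eq_imp_space_eq[OF sets_chain_law] space_path_space)

section \<open>Escape probabilities on the segment\<close>

lemma edges_from_0: "1 \<le> n \<Longrightarrow> {k. (0, k) \<in> edges n} = {1}"
  and edges_from_last: "1 \<le> n \<Longrightarrow> {k. (n, k) \<in> edges n} = {n - 1}"
  and edges_from_interior: "0 < i \<Longrightarrow> i < n \<Longrightarrow> {k. (i, k) \<in> edges n} = {i - 1, Suc i}"
  by (auto simp: edges_def)

context
  fixes n :: nat and w :: "nat \<Rightarrow> nat \<Rightarrow> real"
  assumes n: "1 \<le> n" and pos: "\<And>j k. (j, k) \<in> edges n \<Longrightarrow> 0 < w j k"
begin

lemma integral_env_step: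
  assumes "i \<in> verts n"
  shows "(\<integral>v. h v \<partial>env_step n w i) = (\<Sum>v | (i, v) \<in> edges n. w i v * h v) / (\<Sum>v | (i, v) \<in> edges n. w i v)"
proof -
  have "(\<integral>v. h v \<partial>env_step n w i) = (\<Sum>v | (i, v) \<in> edges n. env n w i v * h v)"
    using finite_edges_from[of i n]
    by (subst integral_measure_pmf[of "{v. (i, v) \<in> edges n}"])
       (auto simp: set_pmf_iff pmf_env_step[where w = w, OF n assms pos] env_def split: if_splits)
  also have "\<dots> = (\<Sum>v | (i, v) \<in> edges n. w i v * h v / (\<Sum>v | (i, v) \<in> edges n. w i v))"
    by (intro sum.cong) (auto simp: env_def)
  finally show ?thesis
    by (simp add: sum_divide_distrib)
qed

lemma pmf_env_step_same: "i \<in> verts n \<Longrightarrow> pmf (env_step n w i) i = 0"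
  by (subst pmf_env_step[OF n _ pos]) (auto simp: env_def edges_def)

lemma harmonic_hits_before:
  assumes "0 < i" "i < n" "i \<noteq> y" "i \<noteq> z"
  defines "h \<equiv> \<lambda>i. measure (chain_law (env_step n w) i) (hits_before y z)"
  shows "(w i (Suc i) + w i (i - 1)) * h i = w i (Suc i) * h (Suc i) + w i (i - 1) * h (i - 1)"
proof -
  have "0 < w i (Suc i)"
    using assms by (intro pos) (auto simp: edges_def)
  moreover have "0 < w i (i - 1)"
    using assms by (intro pos) (auto simp: edges_def intro!: exI[of _ "i - 1"])
  moreover have "h i = (\<integral>v. h v \<partial>env_step n w i)"
    using assms measure_chain_law_first_step[OF sets_hits_before, of "env_step n w" i y z]
    unfolding case_nat_hits_before h_def by simp
  ultimately show ?thesis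
    using assms(1,2) integral_env_step[of i h] by (simp add: edges_from_interior verts_def field_simps)
qed

end

text \<open>Time 0 counts in \<open>hits_before\<close>, unlike in \<open>return_time\<close>, and
  this produces the boundary values of the harmonic problem: a first entry y or z decides the event
  whatever follows.\<close>

lemma measure_hits_before_start:
  "measure (chain_law K y) (hits_before y z) = 1"
  "y \<noteq> z \<Longrightarrow> measure (chain_law K z) (hits_before y z) = 0"
proof -
  have "measure (chain_law K v) UNIV = 1" for v
    using prob_space.prob_space[OF prob_space_chain_law[of K v]]
    by (simp add: sets_eq_imp_space_eq[OF sets_chain_law] space_path_space)
  then show "measure (chain_law K y) (hits_before y z) = 1"
    unfolding measure_chain_law_first_step[OF sets_hits_before] case_nat_hits_before by simp
  show "measure (chain_law K z) (hits_before y z) = 0" if "y \<noteq> z"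
    unfolding measure_chain_law_first_step[OF sets_hits_before] case_nat_hits_before using that by simp
qed

text \<open>In terms of electrical networks, \<open>rho w k\<close> is the resistance of the edge
  {k, k+1} when that of {0, 1} is the unit, because the conductances on the two sides of i are in
  the ratio W(i,i-1) : W(i,i+1). Then \<open>resist n w\<close> is the resistance between 0 and n of
  these edges in series.\<close>

definition rho :: "(nat \<Rightarrow> nat \<Rightarrow> real) \<Rightarrow> nat \<Rightarrow> real" where
  "rho w k = (\<Prod>i=1..k. w i (i - 1) / w i (Suc i))"

definition resist :: "nat \<Rightarrow> (nat \<Rightarrow> nat \<Rightarrow> real) \<Rightarrow> real" where
  "resist n w = (\<Sum>k<n. rho w k)"

text \<open>Rearranged, the harmonic equation at i multiplies the increment of h by W(i,i-1) /
  W(i,i+1): the same current flows through all edges.\<close>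

lemma harmonic_increments:
  fixes h :: "nat \<Rightarrow> real"
  assumes "\<And>i. 0 < i \<Longrightarrow> i < n \<Longrightarrow> w i (Suc i) \<noteq> 0"
    and "\<And>i. 0 < i \<Longrightarrow> i < n \<Longrightarrow>
      (w i (Suc i) + w i (i - 1)) * h i = w i (Suc i) * h (Suc i) + w i (i - 1) * h (i - 1)"
    and "k < n"
  shows "h (Suc k) - h k = rho w k * (h 1 - h 0)"
  using \<open>k < n\<close>
proof (induction k)
  case (Suc k)
  have "h (Suc (Suc k)) - h (Suc k) = w (Suc k) k / w (Suc k) (Suc (Suc k)) * (h (Suc k) - h k)"
    using assms(1)[of "Suc k"] assms(2)[of "Suc k"] Suc.prems by (simp add: field_simps)
  then show ?case
    using Suc by (simp add: rho_def)
qed (simp add: rho_def)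

lemma harmonic_total:
  fixes h :: "nat \<Rightarrow> real"
  assumes "\<And>i. 0 < i \<Longrightarrow> i < n \<Longrightarrow> w i (Suc i) \<noteq> 0"
    and "\<And>i. 0 < i \<Longrightarrow> i < n \<Longrightarrow>
      (w i (Suc i) + w i (i - 1)) * h i = w i (Suc i) * h (Suc i) + w i (i - 1) * h (i - 1)"
  shows "h n - h 0 = resist n w * (h 1 - h 0)"
proof -
  have "h n - h 0 = (\<Sum>k<n. h (Suc k) - h k)"
    by (rule sum_lessThan_telescope[symmetric])
  also have "\<dots> = (\<Sum>k<n. rho w k * (h 1 - h 0))"
    by (intro sum.cong harmonic_increments assms) auto
  finally show ?thesis
    by (simp add: resist_def sum_distrib_right)
qed

section \<open>Explicit escape probabilities and their recursion\<close>

definition pos_env :: "nat \<Rightarrow> (nat \<Rightarrow> nat \<Rightarrow> real) \<Rightarrow> bool" where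
  "pos_env n w \<longleftrightarrow> (\<forall>i<n. 0 < w i (Suc i) \<and> 0 < w (Suc i) i)"

lemma pos_env_edges: "pos_env n w \<longleftrightarrow> (\<forall>(j, k)\<in>edges n. 0 < w j k)"
  by (auto simp: pos_env_def edges_def)

lemma rho_pos:
  assumes "pos_env n w" "k < n"
  shows "0 < rho w k"
  unfolding rho_def
proof (intro prod_pos divide_pos_pos)
  fix i assume i: "i \<in> {1..k}"
  then obtain j where "i = Suc j" by (cases i) auto
  then show "0 < w i (i - 1)" "0 < w i (Suc i)"
    using assms i by (auto simp: pos_env_def)
qed

lemma resist_pos: "pos_env n w \<Longrightarrow> 1 \<le> n \<Longrightarrow> 0 < resist n w"
  unfolding resist_def by (intro sum_pos rho_pos[of n w]) (auto simp: lessThan_empty_iff)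

text \<open>The hitting probabilities solve the harmonic equations with boundary values 0 and 1, and these
  determine them; recurrence of the chain plays no role.\<close>

lemma escape_prob_forward:
  assumes "1 \<le> n" "pos_env n w"
  shows "escape_prob n w 0 n = 1 / resist n w"
proof -
  have pos: "0 < w j k" if "(j, k) \<in> edges n" for j k
    using assms(2) that by (auto simp: pos_env_edges)
  define h where "h i = measure (chain_law (env_step n w) i) (hits_before n 0)" for i
  have "h n - h 0 = resist n w * (h 1 - h 0)"
    unfolding h_def by (intro harmonic_total harmonic_hits_before assms pos) 
      (use assms(2) in \<open>auto simp: pos_env_def\<close>)
  moreover have "h n = 1" "h 0 = 0"
    unfolding h_def using assms by (simp_all add: measure_hits_before_start)
  ultimately have "h 1 = 1 / resist n w"
    using resist_pos[of n w] assms by (simp add: field_simps)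
  moreover have "escape_prob n w 0 n = (\<integral>v. h v \<partial>env_step n w 0)"
    unfolding escape_prob_eq_measure h_def using assms
    by (intro measure_escapes pmf_env_step_same pos) (simp_all add: verts_def)
  moreover have "0 < w 0 1"
    using assms by (auto simp: pos_env_def)
  then have "(\<integral>v. h v \<partial>env_step n w 0) = h 1"
    using assms edges_from_0[of n]
    by (subst integral_env_step[OF assms(1) pos]) (auto simp: verts_def)
  ultimately show ?thesis by simp
qed

text \<open>From n the chain must step to n - 1, so the last increment of h is needed instead of the
  first; it is larger by the factor \<open>rho w (n - 1)\<close>.\<close>

lemma escape_prob_backward:
  assumes "1 \<le> n" "pos_env n w"
  shows "escape_prob n w n 0 = rho w (n - 1) / resist n w"
proof -
  have pos: "0 < w j k" if "(j, k) \<in> edges n" for j k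
    using assms(2) that by (auto simp: pos_env_edges)
  define h where "h i = measure (chain_law (env_step n w) i) (hits_before 0 n)" for i
  have "h n - h 0 = resist n w * (h 1 - h 0)"
    unfolding h_def by (intro harmonic_total harmonic_hits_before assms pos) 
      (use assms(2) in \<open>auto simp: pos_env_def\<close>)
  moreover have "h (Suc (n - 1)) - h (n - 1) = rho w (n - 1) * (h 1 - h 0)"
    unfolding h_def by (intro harmonic_increments[where n = n] harmonic_hits_before assms pos) 
      (use assms in \<open>auto simp: pos_env_def\<close>)
  moreover have "h n = 0" "h 0 = 1"
    unfolding h_def using assms by (simp_all add: measure_hits_before_start)
  ultimately have "resist n w * (h 1 - 1) = - 1" "h (n - 1) = - (rho w (n - 1) * (h 1 - 1))"
    using assms(1) by (simp_all add: algebra_simps)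
  then have "h (n - 1) * resist n w = rho w (n - 1)"
    by algebra
  then have "h (n - 1) = rho w (n - 1) / resist n w"
    using resist_pos[of n w] assms by (simp add: field_simps)
  moreover have "escape_prob n w n 0 = (\<integral>v. h v \<partial>env_step n w n)"
    unfolding escape_prob_eq_measure h_def using assms
    by (intro measure_escapes pmf_env_step_same pos) (simp_all add: verts_def)
  moreover have "0 < w n (n - 1)"
    using assms by (cases n) (auto simp: pos_env_def)
  then have "(\<integral>v. h v \<partial>env_step n w n) = h (n - 1)"
    using assms edges_from_last[of n]
    by (subst integral_env_step[OF assms(1) pos]) (auto simp: verts_def)
  ultimately show ?thesis by simp
qed

text \<open>This makes \<open>Gam\<close> and \<open>expS\<close> explicit, hence measurable, everywhere and not only where all weights
  are positive.\<close>

lemma escape_prob_degenerate: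
  assumes "\<not> pos_env n w" "x \<noteq> y"
  shows "escape_prob n w x y = 0"
proof -
  let ?M = "chain_law (env_step n w) x"
  interpret prob_space ?M by (rule prob_space_chain_law)
  have step: "env_step n w i = return_pmf i" for i
    using assms(1) unfolding env_step_def pos_env_edges by (intro if_not_P) blast
  have "AE X in ?M. \<forall>k\<le>m. X k = x" for m
  proof -
    have "prob {X. \<forall>k\<le>m. X k = x} = 1"
      using emeasure_chain_law_cylinder[of "env_step n w" x m "\<lambda>_. x"]
      by (simp add: emeasure_eq_measure step)
    then show ?thesis
      using AE_prob_1[of "{X. \<forall>k\<le>m. X k = x}"] by simp
  qed
  then have "AE X in ?M. \<forall>m. \<forall>k\<le>m. X k = x"
    by (rule AE_all_countable[THEN iffD2, OF allI])
  then have "AE X in ?M. X \<notin> escapes x y"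
    by eventually_elim (use assms(2) in \<open>auto simp: escapes_iff\<close>)
  then show ?thesis
    unfolding escape_prob_eq_measure by (subst prob_eq_0) (simp_all add: sets_chain_law sets_escapes)
qed

text \<open>The quantities \<open>A\<close> and \<open>B\<close> in the remark on the transition kernel.\<close>

definition condL :: "nat \<Rightarrow> (nat \<Rightarrow> nat \<Rightarrow> real) \<Rightarrow> real" where
  "condL n w = w 0 1 / resist n w"

definition condR :: "nat \<Rightarrow> (nat \<Rightarrow> nat \<Rightarrow> real) \<Rightarrow> real" where
  "condR n w = w n (n - 1) * rho w (n - 1) / resist n w"

lemma Gam_eq: "1 \<le> n \<Longrightarrow> Gam n w = (if pos_env n w then sqrt (condL n w * condR n w) else 0)"
  by (auto simp: Gam_def condL_def condR_def escape_prob_forward escape_prob_backward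
      escape_prob_degenerate mult_ac)

lemma expS_eq: "1 \<le> n \<Longrightarrow> expS n w = (if pos_env n w then sqrt (condL n w / condR n w) else 0)"
  by (auto simp: expS_def condL_def condR_def escape_prob_forward escape_prob_backward
      escape_prob_degenerate mult_ac)

lemma condL_pos: "1 \<le> n \<Longrightarrow> pos_env n w \<Longrightarrow> 0 < condL n w"
  unfolding condL_def by (intro divide_pos_pos resist_pos) (auto simp: pos_env_def)

lemma condR_pos:
  assumes "1 \<le> n" "pos_env n w"
  shows "0 < condR n w"
proof -
  obtain m where "n = Suc m" using assms(1) by (cases n) auto
  then show ?thesis
    unfolding condR_def using assms
    by (intro divide_pos_pos mult_pos_pos resist_pos rho_pos[of n]) (auto simp: pos_env_def)
qed

text \<open>The series law: by the definition of \<open>condR\<close>, the new edge has resistance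
  \<open>rho w n\<close> = R B / a with R the old total and B = \<open>condR n w\<close>, so the
  total is multiplied by (a + B) / a.\<close>

lemma cond_Suc:
  assumes "1 \<le> n" "pos_env (Suc n) w"
  defines "a \<equiv> w n (Suc n)" and "b \<equiv> w (Suc n) n"
  shows "condL (Suc n) w = condL n w * a / (a + condR n w)"
    and "condR (Suc n) w = condR n w * b / (a + condR n w)"
proof -
  obtain m where m: "n = Suc m" using assms(1) by (cases n) auto
  have pos: "pos_env n w" and a: "0 < a"
    using assms(2) by (auto simp: pos_env_def a_def)
  have R: "0 < resist n w" using pos assms(1) by (rule resist_pos[rotated 0])
  have r: "rho w n = w n (n - 1) * rho w (n - 1) / a"
    by (simp add: rho_def m a_def mult_ac)
  then have r': "rho w n = condR n w * resist n w / a"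
    using R by (simp add: condR_def)
  have R': "a * resist (Suc n) w = resist n w * (a + condR n w)"
    using R a by (simp add: resist_def[of "Suc n"] flip: resist_def) (simp add: r condR_def field_simps)
  have pR: "0 < a + condR n w"
    using a condR_pos[OF assms(1) pos] by simp
  have R'': "resist (Suc n) w = resist n w * (a + condR n w) / a"
    using R' a by (simp add: field_simps)
  show "condL (Suc n) w = condL n w * a / (a + condR n w)"
    using R a pR by (simp add: condL_def R'')
  show "condR (Suc n) w = condR n w * b / (a + condR n w)"
  proof -
    have "b * (B * R / a) / (R * S / a) = B * b / S" if "R \<noteq> 0" "S \<noteq> 0" for B R S :: real
      using that a by (simp add: field_simps)
    from this[of "resist n w" "a + condR n w" "condR n w"] show ?thesis
      using R pR by (simp add: condR_def[of "Suc n"] R'' r' b_def)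
  qed
qed

section \<open>Generalized inverse Gaussian and gamma laws\<close>

text \<open>The formula \<open>has_absolute_integral_change_of_variables_1'\<close> concerns
  absolutely integrable functions. Indicators of bounded sets are of this kind on the target side;
  exhausting by balls then identifies Lebesgue measure on T with the image under g of the measure on
  S with density |g'|, and equal measures integrate every nonnegative f alike.\<close>

lemma nn_integral_substitution_inj:
  fixes f :: "real \<Rightarrow> ennreal" and g g' :: "real \<Rightarrow> real"
  assumes S: "S \<in> sets borel" and T: "T \<in> sets borel" and T_eq: "g ` S = T"
    and deriv: "\<And>x. x \<in> S \<Longrightarrow> (g has_field_derivative g' x) (at x)"
    and inj: "inj_on g S"
    and [measurable]: "g \<in> borel_measurable borel" "g' \<in> borel_measurable borel"
    and f [measurable]: "f \<in> borel_measurable borel"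
  shows "(\<integral>\<^sup>+y. f y * indicator T y \<partial>lborel) = (\<integral>\<^sup>+x. ennreal \<bar>g' x\<bar> * f (g x) * indicator S x \<partial>lborel)"
proof -
  note [measurable] = S T
  let ?N = "distr (density lborel (\<lambda>x. ennreal \<bar>g' x\<bar> * indicator S x)) borel g"
  have N: "emeasure ?N A = (\<integral>\<^sup>+x. ennreal \<bar>g' x\<bar> * indicator A (g x) * indicator S x \<partial>lborel)"
    if [measurable]: "A \<in> sets borel" for A
  proof -
    have "emeasure ?N A = emeasure (density lborel (\<lambda>x. ennreal \<bar>g' x\<bar> * indicator S x)) (g -` A)"
      by (subst emeasure_distr) simp_all
    also have "\<dots> = (\<integral>\<^sup>+x. ennreal \<bar>g' x\<bar> * indicator S x * indicator (g -` A) x \<partial>lborel)"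
      using measurable_sets[of g borel borel A] by (intro emeasure_density) simp_all
    also have "\<dots> = (\<integral>\<^sup>+x. ennreal \<bar>g' x\<bar> * indicator A (g x) * indicator S x \<partial>lborel)"
      by (intro nn_integral_cong) (simp split: split_indicator)
    finally show ?thesis .
  qed
  have bounded: "emeasure (density lborel (indicator T)) A = emeasure ?N A"
    if [measurable]: "A \<in> sets borel" and bd: "bounded A" for A
  proof -
    have fin: "emeasure lborel (A \<inter> T) \<noteq> \<infinity>"
      using emeasure_bounded_finite[of "A \<inter> T"] bd by (auto simp: bounded_Int)
    then have "integrable lborel (indicat_real (A \<inter> T))"
      by (intro integrable_real_indicator) (auto simp: top.not_eq_extremum)
    moreover have "indicat_real (A \<inter> T) = (\<lambda>x. indicator T x *\<^sub>R indicator A x)"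
      by (auto split: split_indicator)
    ultimately have iT: "set_integrable lborel T (indicat_real A)"
      by (simp add: set_integrable_def)
    then have "(indicat_real A) absolutely_integrable_on T"
      by (simp add: set_integrable_def integrable_completion)
    moreover have "S \<in> sets lebesgue"
      using S by simp
    ultimately have "(\<lambda>x. \<bar>g' x\<bar> * indicat_real A (g x)) absolutely_integrable_on S \<and>
        integral S (\<lambda>x. \<bar>g' x\<bar> * indicat_real A (g x)) = integral T (indicat_real A)"
      using has_absolute_integral_change_of_variables_1'[of S g g' "indicat_real A" "integral T (indicat_real A)",
          OF _ has_field_derivative_at_within[OF deriv] inj]
      unfolding T_eq by blast
    then have ai: "(\<lambda>x. \<bar>g' x\<bar> * indicat_real A (g x)) absolutely_integrable_on S"
      and eq: "integral S (\<lambda>x. \<bar>g' x\<bar> * indicat_real A (g x)) = integral T (indicat_real A)"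
      by blast+
    have iS: "set_integrable lborel S (\<lambda>x. \<bar>g' x\<bar> * indicat_real A (g x))"
      using ai by (simp add: set_integrable_def integrable_completion)
    have "emeasure ?N A = (\<integral>\<^sup>+x. ennreal (indicator S x * (\<bar>g' x\<bar> * indicat_real A (g x))) \<partial>lborel)"
      unfolding N[OF that(1)] by (intro nn_integral_cong) (auto split: split_indicator)
    also have "\<dots> = ennreal (LINT x:S|lborel. \<bar>g' x\<bar> * indicat_real A (g x))"
      using iS unfolding set_integrable_def set_lebesgue_integral_def
      by (subst nn_integral_eq_integral) auto
    also have "(LINT x:S|lborel. \<bar>g' x\<bar> * indicat_real A (g x)) = integral S (\<lambda>x. \<bar>g' x\<bar> * indicat_real A (g x))"
      using iS by (rule set_borel_integral_eq_integral)
    also have "\<dots> = (LINT x:T|lborel. indicat_real A x)"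
      unfolding eq using iT by (rule set_borel_integral_eq_integral(2)[symmetric])
    also have "ennreal \<dots> = (\<integral>\<^sup>+x. ennreal (indicator T x * indicat_real A x) \<partial>lborel)"
      using iT unfolding set_integrable_def set_lebesgue_integral_def
      by (subst nn_integral_eq_integral) auto
    also have "\<dots> = emeasure (density lborel (indicator T)) A"
      by (subst emeasure_density) (auto intro!: nn_integral_cong split: split_indicator)
    finally show ?thesis by simp
  qed
  have "density lborel (indicator T) = ?N"
  proof (rule measure_eqI)
    fix A assume "A \<in> sets (density lborel (indicator T))"
    then have A [measurable]: "A \<in> sets borel" by simp
    have *: "emeasure M A = (SUP n::nat. emeasure M (A \<inter> cball 0 (real n)))"
      if "sets M = sets borel" for M :: "real measure"
    proof -
      have "(\<Union>n::nat. A \<inter> cball 0 (real n)) = A"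
      proof (intro set_eqI iffI)
        fix x assume "x \<in> A"
        moreover obtain n :: nat where "\<bar>x\<bar> \<le> real n"
          using real_arch_simple by blast
        ultimately show "x \<in> (\<Union>n::nat. A \<inter> cball 0 (real n))"
          by auto
      qed auto
      moreover have "(SUP n::nat. emeasure M (A \<inter> cball 0 (real n))) = emeasure M (\<Union>n::nat. A \<inter> cball 0 (real n))"
      proof (rule SUP_emeasure_incseq)
        show "range (\<lambda>n. A \<inter> cball 0 (real n)) \<subseteq> sets M"
          unfolding that by (intro image_subsetI sets.Int A borel_closed closed_cball)
        show "incseq (\<lambda>n. A \<inter> cball 0 (real n))"
          by (intro incseq_SucI Int_mono subset_cball order_refl) simp
      qed
      ultimately show ?thesis by simp
    qed
    have "emeasure (density lborel (indicator T)) (A \<inter> cball 0 (real n)) = emeasure ?N (A \<inter> cball 0 (real n))" for n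
      by (rule bounded) (simp_all add: bounded_Int)
    moreover have "emeasure (density lborel (indicator T)) A =
        (SUP n::nat. emeasure (density lborel (indicator T)) (A \<inter> cball 0 (real n)))"
      by (rule *) simp
    moreover have "emeasure ?N A = (SUP n::nat. emeasure ?N (A \<inter> cball 0 (real n)))"
      by (rule *) simp
    ultimately show "emeasure (density lborel (indicator T)) A = emeasure ?N A"
      by (simp only:)
  qed simp
  then have "(\<integral>\<^sup>+y. f y \<partial>density lborel (indicator T)) = (\<integral>\<^sup>+y. f y \<partial>?N)"
    by (rule arg_cong)
  moreover have "(\<integral>\<^sup>+y. f y \<partial>?N) = (\<integral>\<^sup>+x. ennreal \<bar>g' x\<bar> * indicator S x * f (g x) \<partial>lborel)"
    by (subst nn_integral_distr) (simp_all add: nn_integral_density)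
  moreover have "(\<integral>\<^sup>+y. f y \<partial>density lborel (indicator T)) = (\<integral>\<^sup>+y. f y * indicator T y \<partial>lborel)"
    by (subst nn_integral_density) (simp_all add: mult.commute)
  ultimately show ?thesis
    by (simp add: mult_ac)
qed

section \<open>Integrability of the weights and Bessel functions\<close>

lemma power_div_fact_le_exp: "0 \<le> (t::real) \<Longrightarrow> t ^ k / fact k \<le> exp t"
proof -
  assume t: "0 \<le> t"
  have "(\<Sum>n\<in>{k}. inverse (fact n) *\<^sub>R t ^ n) \<le> (\<Sum>n. inverse (fact n) *\<^sub>R t ^ n)"
    using t summable_exp_generic[of t] by (intro sum_le_suminf) auto
  then show ?thesis
    by (simp add: exp_def field_simps)
qed

lemma gig_weight_diag:
  "gig_weight p (2 * c) (2 * c) u = indicator {0<..} u * (u powr (p - 1) * exp (- (c * (u + 1 / u))))"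
proof -
  have "- ((2 * c * u + 2 * c / u) / 2) = - (c * (u + 1 / u))"
    by (simp add: field_simps add_divide_distrib)
  then show ?thesis
    by (simp add: gig_weight_def)
qed

lemma gig_weight_nonneg: "0 \<le> gig_weight p a b u"
  by (simp add: gig_weight_def)

lemma borel_measurable_gig_weight [measurable]:
  assumes [measurable]: "f \<in> borel_measurable M" "g \<in> borel_measurable M" "h \<in> borel_measurable M"
  shows "(\<lambda>x. gig_weight p (f x) (g x) (h x)) \<in> borel_measurable M"
  unfolding gig_weight_def by measurable

lemma nn_integral_powr_exp_finite:
  assumes "0 < s" "0 < c"
  shows "(\<integral>\<^sup>+u. ennreal (indicator {0..} u * (u powr (s - 1) * exp (- (c * u)))) \<partial>lborel) < \<infinity>"
proof -
  let ?g = "\<lambda>t. ennreal (indicator {0..} t * t powr (s - 1) / exp t)"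
  have "(\<integral>\<^sup>+t. ?g t \<partial>lborel) = ennreal c * (\<integral>\<^sup>+u. ?g (0 + c * u) \<partial>lborel)"
    using assms(2) by (subst nn_integral_real_affine[where c = c and t = 0]) auto
  then have "ennreal c * (\<integral>\<^sup>+u. ?g (c * u) \<partial>lborel) < \<infinity>"
    unfolding Gamma_conv_nn_integral_real[OF assms(1), symmetric] add_0 by (metis ennreal_less_top infinity_ennreal_def)
  then have fin: "(\<integral>\<^sup>+u. ?g (c * u) \<partial>lborel) < \<infinity>"
    using assms(2) by (auto simp: ennreal_mult_less_top)
  have "ennreal (indicator {0..} u * (u powr (s - 1) * exp (- (c * u)))) = ennreal (c powr (1 - s)) * ?g (c * u)" for u
  proof -
    have "c powr (1 - s) * c powr (s - 1) = 1"
      using assms(2) by (simp add: powr_add[symmetric])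
    then show ?thesis
      using assms(2)
      by (auto simp: ennreal_mult'[symmetric] powr_mult exp_minus divide_inverse zero_le_mult_iff mult.assoc[symmetric] split: split_indicator)
  qed
  then have "(\<integral>\<^sup>+u. ennreal (indicator {0..} u * (u powr (s - 1) * exp (- (c * u)))) \<partial>lborel) =
      ennreal (c powr (1 - s)) * (\<integral>\<^sup>+u. ?g (c * u) \<partial>lborel)"
    by (simp add: nn_integral_cmult)
  with fin show ?thesis
    by (simp add: ennreal_mult_less_top)
qed

text \<open>The factor exp(- c u) takes care of infinity. Near 0 the power of u may be too negative;
  since exp(- c / u) \<le> k! (u / c)^k, any k with p + k > 0 leaves a Gamma integrand.\<close>

lemma integrable_gig_weight:
  assumes "0 < c"
  shows "integrable lborel (gig_weight p (2 * c) (2 * c))"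
proof (rule integrableI_nonneg)
  obtain k :: nat where k: "- p < real k"
    using reals_Archimedean2 by blast
  let ?C = "fact k / c ^ k"
  let ?h = "\<lambda>u. ennreal (indicator {0..} u * (u powr ((p + k) - 1) * exp (- (c * u))))"
  have "gig_weight p (2 * c) (2 * c) u \<le> ?C * (indicator {0..} u * (u powr ((p + k) - 1) * exp (- (c * u))))" for u
  proof (cases "0 < u")
    case True
    have "(c / u) ^ k / fact k \<le> exp (c / u)"
      using True assms by (intro power_div_fact_le_exp) simp
    then have "exp (- (c / u)) \<le> ?C * u ^ k"
      using True assms by (simp add: exp_minus field_simps power_divide)
    then have "u powr (p - 1) * exp (- (c * u)) * exp (- (c / u)) \<le> u powr (p - 1) * exp (- (c * u)) * (?C * u ^ k)"
      by (intro mult_left_mono) auto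
    moreover have "u powr ((p + k) - 1) = u powr (p - 1) * u ^ k"
      using True by (simp add: powr_realpow[symmetric] powr_add[symmetric] algebra_simps)
    moreover have "exp (- (c * (u + 1 / u))) = exp (- (c * u)) * exp (- (c / u))"
      by (simp add: exp_add[symmetric] algebra_simps)
    ultimately show ?thesis
      unfolding gig_weight_diag using True by (simp add: mult_ac)
  qed (simp add: gig_weight_diag assms indicator_def)
  then have "(\<integral>\<^sup>+u. ennreal (gig_weight p (2 * c) (2 * c) u) \<partial>lborel) \<le>
      (\<integral>\<^sup>+u. ennreal ?C * ?h u \<partial>lborel)"
    using assms by (intro nn_integral_mono) (simp add: ennreal_mult'[symmetric] ennreal_leI)
  also have "\<dots> = ennreal ?C * (\<integral>\<^sup>+u. ?h u \<partial>lborel)"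
    by (intro nn_integral_cmult) auto
  also have "\<dots> < \<infinity>"
    using nn_integral_powr_exp_finite[of "p + k" c] k assms by (simp add: ennreal_mult_less_top)
  finally show "(\<integral>\<^sup>+u. ennreal (gig_weight p (2 * c) (2 * c) u) \<partial>lborel) < \<infinity>" .
qed (auto simp: gig_weight_nonneg)

lemma integral_gig_weight: "(\<integral>u. gig_weight p (2 * c) (2 * c) u \<partial>lborel) = 2 * besselK p (2 * c)"
  unfolding besselK_def gig_weight_diag by (auto intro!: Bochner_Integration.integral_cong simp: indicator_def)

lemma nn_integral_gig_weight:
  assumes "0 < c"
  shows "(\<integral>\<^sup>+u. ennreal (gig_weight p (2 * c) (2 * c) u) \<partial>lborel) = ennreal (2 * besselK p (2 * c))"
  unfolding integral_gig_weight[symmetric]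
  by (intro nn_integral_eq_integral integrable_gig_weight assms) (simp add: gig_weight_nonneg)

lemma besselK_pos:
  assumes "0 < c"
  shows "0 < besselK p (2 * c)"
proof -
  have "0 \<le> (\<integral>u. gig_weight p (2 * c) (2 * c) u \<partial>lborel)"
    by (simp add: gig_weight_nonneg)
  moreover have "(\<integral>u. gig_weight p (2 * c) (2 * c) u \<partial>lborel) \<noteq> 0"
  proof
    assume "(\<integral>u. gig_weight p (2 * c) (2 * c) u \<partial>lborel) = 0"
    then have "AE u in lborel. gig_weight p (2 * c) (2 * c) u = 0"
      by (subst (asm) integral_nonneg_eq_0_iff_AE) (auto simp: gig_weight_nonneg integrable_gig_weight assms)
    then have "AE u in lborel. u \<notin> {0<..<1::real}"
      by eventually_elim (auto simp: gig_weight_diag)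
    then have "emeasure lborel {0<..<1::real} = 0"
      by (subst (asm) AE_iff_measurable[where N = "{0<..<1}"]) auto
    then show False by simp
  qed
  ultimately show ?thesis
    unfolding integral_gig_weight by simp
qed

text \<open>The substitution z = c / w turns z + c^2 / z into c (w + 1 / w) and the power of z, with
  the Jacobian, into c^(-s) w^(s-1). This integral, with c^2 = x^2 + y^2, is the origin of the
  Bessel function of order \<alpha> + \<beta> in the kernel.\<close>

lemma nn_integral_inverse_gamma_bessel:
  assumes "0 < c"
  shows "(\<integral>\<^sup>+z. ennreal (z powr (- s - 1) * exp (- (z + c\<^sup>2 / z))) * indicator {0<..} z \<partial>lborel) =
    ennreal (2 * besselK s (2 * c) / c powr s)"
proof -
  have "(\<integral>\<^sup>+z. ennreal (z powr (- s - 1) * exp (- (z + c\<^sup>2 / z))) * indicator {0<..} z \<partial>lborel) =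
     (\<integral>\<^sup>+w. ennreal \<bar>- (c / w\<^sup>2)\<bar> * ennreal ((c / w) powr (- s - 1) * exp (- (c / w + c\<^sup>2 / (c / w)))) * indicator {0<..} w \<partial>lborel)"
  proof (rule nn_integral_substitution_inj)
    show "(\<lambda>w. c / w) ` {0<..} = {0<..}"
    proof (intro set_eqI iffI)
      fix y :: real assume "y \<in> {0<..}"
      then show "y \<in> (\<lambda>w. c / w) ` {0<..}"
        using assms by (intro image_eqI[of _ _ "c / y"]) auto
    qed (use assms in auto)
    show "((\<lambda>w. c / w) has_field_derivative - (c / w\<^sup>2)) (at w)" if "w \<in> {0<..}" for w
      using that by (auto intro!: derivative_eq_intros simp: power2_eq_square)
  qed (use assms in \<open>auto simp: inj_on_def\<close>)
  also have "\<dots> = (\<integral>\<^sup>+w. ennreal (c powr (- s)) * ennreal (gig_weight s (2 * c) (2 * c) w) \<partial>lborel)"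
  proof (intro nn_integral_cong)
    fix w :: real
    show "ennreal \<bar>- (c / w\<^sup>2)\<bar> * ennreal ((c / w) powr (- s - 1) * exp (- (c / w + c\<^sup>2 / (c / w)))) * indicator {0<..} w =
      ennreal (c powr (- s)) * ennreal (gig_weight s (2 * c) (2 * c) w)"
    proof (cases "0 < w")
      case True
      \<comment> \<open>In logarithmic coordinates an identity between products of real powers is
        one between linear exponents.\<close>
      obtain C V where CV: "c = exp C" "w = exp V"
        using assms True by (metis exp_ln)
      have 1: "c / w\<^sup>2 * (c / w) powr (- s - 1) = c powr (- s) * w powr (s - 1)"
        unfolding CV by (simp add: powr_def exp_add[symmetric] exp_diff[symmetric] power2_eq_square algebra_simps flip: exp_add exp_diff)
      have 2: "c / w + c\<^sup>2 / (c / w) = c * (w + 1 / w)"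
        using True assms by (simp add: field_simps power2_eq_square)
      have "c / w\<^sup>2 * ((c / w) powr (- s - 1) * exp (- (c / w + c\<^sup>2 / (c / w)))) =
          c powr (- s) * (w powr (s - 1) * exp (- (c * (w + 1 / w))))"
        unfolding 2 mult.assoc[symmetric] 1 ..
      then show ?thesis
        using True assms by (simp add: gig_weight_diag ennreal_mult'[symmetric])
    qed (simp add: gig_weight_diag)
  qed
  also have "\<dots> = ennreal (c powr (- s)) * ennreal (2 * besselK s (2 * c))"
    by (subst nn_integral_cmult) (simp_all only: nn_integral_gig_weight assms, measurable)
  also have "\<dots> = ennreal (2 * besselK s (2 * c) / c powr s)"
    using besselK_pos[OF assms] by (simp add: ennreal_mult'[symmetric] powr_minus divide_inverse mult.commute)
  finally show ?thesis .
qed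

text \<open>The coordinate integrated out is \<open>z = A - A' = x u - y v\<close>. In terms of it, the exponents
  \<open>a + b + x (u + 1 / u)\<close> become \<open>z + (x\<^sup>2 + y\<^sup>2) / z + y (v + 1 / v)\<close>, which separates \<open>z\<close> from \<open>v\<close>.\<close>

lemma weight_substitution:
  fixes x y u v z \<alpha> \<beta> :: real
  assumes "0 < x" "0 < y" "0 < u" "0 < v" "0 < z" "x * u = z + y * v"
  defines "a \<equiv> x * y * v / (u * z)"
  shows "gamma_density \<beta> (a * u\<^sup>2 / v\<^sup>2) * gamma_density \<alpha> a * gig_weight (\<alpha> - \<beta>) (2 * x) (2 * x) u
      * (2 * a * u\<^sup>2 / v ^ 3) * (x\<^sup>2 * v / z\<^sup>2) =
    2 * x\<^sup>2 / (Gamma \<alpha> * Gamma \<beta>) * (x * y) powr (\<alpha> + \<beta> - 1) * gig_weight (\<alpha> - \<beta>) (2 * y) (2 * y) v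
      * (z powr (- (\<alpha> + \<beta>) - 1) * exp (- (z + (x\<^sup>2 + y\<^sup>2) / z)))"
proof -
  define b where "b = a * u\<^sup>2 / v\<^sup>2"
  have a: "0 < a" and b: "0 < b"
    using assms by (auto simp: a_def b_def)
  \<comment> \<open>The relation x u = z + y v gives a + x / u = x^2 / z and b = y / v + y^2 / z;
    the remaining term x u is itself z + y v.\<close>
  have e: "b + a + x * (u + 1 / u) = y * (v + 1 / v) + (z + (x\<^sup>2 + y\<^sup>2) / z)"
  proof -
    have "a + x / u = x * (y * v + z) / (u * z)"
      using assms(3,5) by (simp add: a_def field_simps)
    also have "y * v + z = x * u"
      using assms(6) by simp
    also have "x * (x * u) / (u * z) = x\<^sup>2 / z"
      using assms(3) by (simp add: power2_eq_square)
    finally have "a + x / u = x\<^sup>2 / z" .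
    moreover have "b = y * (x * u) / (v * z)"
      using assms(3,4) by (simp add: b_def a_def power2_eq_square mult_ac)
    then have "b = y / v + y\<^sup>2 / z"
      unfolding assms(6) using assms(4,5) by (simp add: field_simps power2_eq_square)
    ultimately show ?thesis
      using assms(6) by (simp add: add_divide_distrib algebra_simps)
  qed
  define X Y U V Z where "X = ln x" and "Y = ln y" and "U = ln u" and "V = ln v" and "Z = ln z"
  then have ln: "x = exp X" "y = exp Y" "u = exp U" "v = exp V" "z = exp Z"
    using assms(1-5) by simp_all
  have a': "a = exp (X + Y + V - U - Z)"
    by (simp add: a_def ln exp_add exp_diff)
  have b': "b = exp (X + Y + U - V - Z)"
    by (simp add: b_def a_def ln exp_add exp_diff power2_eq_square mult_ac)
  \<comment> \<open>The factor 2 a u^2 / v^3 is the Jacobian of b = a u^2 / v^2 in v, and x^2 v /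
    z^2 is that of a in y, where z = x u - y v.\<close>
  have w: "b powr (\<beta> - 1) * a powr (\<alpha> - 1) * u powr (\<alpha> - \<beta> - 1) * (2 * a * u\<^sup>2 / v ^ 3) * (x\<^sup>2 * v / z\<^sup>2) =
      2 * x\<^sup>2 * (x * y) powr (\<alpha> + \<beta> - 1) * v powr (\<alpha> - \<beta> - 1) * z powr (- (\<alpha> + \<beta>) - 1)"
  proof -
    have "a * u\<^sup>2 / v ^ 3 = exp (X + Y + U - 2 * V - Z)" "x\<^sup>2 * v / z\<^sup>2 = exp (2 * X + V - 2 * Z)"
      by (simp_all add: a' ln power2_eq_square power3_eq_cube flip: exp_add exp_diff)
    then have *: "2 * a * u\<^sup>2 / v ^ 3 = 2 * exp (X + Y + U - 2 * V - Z)" "x\<^sup>2 * v / z\<^sup>2 = exp (2 * X + V - 2 * Z)"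
      by simp_all
    show ?thesis
      unfolding * unfolding a' b' ln
    by (simp add: powr_def power2_eq_square power3_eq_cube algebra_simps flip: exp_add exp_diff)
  qed
  have "exp (- b) * exp (- a) * exp (- (x * (u + 1 / u))) = exp (- (y * (v + 1 / v))) * exp (- (z + (x\<^sup>2 + y\<^sup>2) / z))"
    unfolding exp_add[symmetric] using e by simp
  note ex = this
  have "gamma_density \<beta> b * gamma_density \<alpha> a * gig_weight (\<alpha> - \<beta>) (2 * x) (2 * x) u
      * (2 * a * u\<^sup>2 / v ^ 3) * (x\<^sup>2 * v / z\<^sup>2) =
    (b powr (\<beta> - 1) * a powr (\<alpha> - 1) * u powr (\<alpha> - \<beta> - 1) * (2 * a * u\<^sup>2 / v ^ 3) * (x\<^sup>2 * v / z\<^sup>2)) *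
      (exp (- b) * exp (- a) * exp (- (x * (u + 1 / u)))) / (Gamma \<alpha> * Gamma \<beta>)"
    unfolding gig_weight_diag using a b assms(3) by (simp add: gamma_density_def mult_ac)
  also have "\<dots> = 2 * x\<^sup>2 / (Gamma \<alpha> * Gamma \<beta>) * (x * y) powr (\<alpha> + \<beta> - 1)
      * gig_weight (\<alpha> - \<beta>) (2 * y) (2 * y) v
      * (z powr (- (\<alpha> + \<beta>) - 1) * exp (- (z + (x\<^sup>2 + y\<^sup>2) / z)))"
    unfolding w ex gig_weight_diag using assms(4) by (simp add: mult_ac)
  finally show ?thesis
    unfolding b_def .
qed

lemma gamma_density_nonneg: "0 < a \<Longrightarrow> 0 \<le> gamma_density a x"
  by (simp add: gamma_density_def Gamma_real_nonneg)

lemma borel_measurable_gamma_density [measurable]: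
  assumes [measurable]: "f \<in> borel_measurable M"
  shows "(\<lambda>x. gamma_density a (f x)) \<in> borel_measurable M"
  unfolding gamma_density_def by measurable

text \<open>With k = a u^2, the new variable v = sqrt(k / b) is u sqrt(a / b), the updated value of
  e^S.\<close>

lemma nn_integral_substitution_inverse_square:
  fixes f :: "real \<Rightarrow> ennreal"
  assumes "0 < k" and [measurable]: "f \<in> borel_measurable borel"
  shows "(\<integral>\<^sup>+b. f b * indicator {0<..} b \<partial>lborel) =
    (\<integral>\<^sup>+v. ennreal (2 * k / v ^ 3) * f (k / v\<^sup>2) * indicator {0<..} v \<partial>lborel)"
proof -
  have "(\<integral>\<^sup>+b. f b * indicator {0<..} b \<partial>lborel) =
    (\<integral>\<^sup>+v. ennreal \<bar>- (2 * k / v ^ 3)\<bar> * f (k / v\<^sup>2) * indicator {0<..} v \<partial>lborel)"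
  proof (rule nn_integral_substitution_inj)
    show "(\<lambda>v. k / v\<^sup>2) ` {0<..} = {0<..}"
    proof (intro set_eqI iffI)
      fix b :: real assume "b \<in> {0<..}"
      then show "b \<in> (\<lambda>v. k / v\<^sup>2) ` {0<..}"
        using assms by (intro image_eqI[of _ _ "sqrt (k / b)"]) auto
    qed (use assms in auto)
    show "((\<lambda>v. k / v\<^sup>2) has_field_derivative - (2 * k / v ^ 3)) (at v)" if "v \<in> {0<..}" for v
      using that by (auto intro!: derivative_eq_intros simp: power2_eq_square power3_eq_cube field_simps)
    show "inj_on (\<lambda>v. k / v\<^sup>2) {0<..}"
      using assms by (auto simp: inj_on_def)
  qed simp_all
  also have "\<dots> = (\<integral>\<^sup>+v. ennreal (2 * k / v ^ 3) * f (k / v\<^sup>2) * indicator {0<..} v \<partial>lborel)"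
    using assms by (intro nn_integral_cong) (auto split: split_indicator)
  finally show ?thesis .
qed

text \<open>The new value of \<Gamma>, y = x (a u / v) / (a + x / u), is solved for a. It increases
  with a from 0 towards x u / v, which gives the range of y.\<close>

lemma nn_integral_substitution_moebius:
  fixes f :: "real \<Rightarrow> ennreal"
  assumes "0 < x" "0 < u" "0 < v" and [measurable]: "f \<in> borel_measurable borel"
  shows "(\<integral>\<^sup>+a. f a * indicator {0<..} a \<partial>lborel) =
    (\<integral>\<^sup>+y. ennreal (x\<^sup>2 * v / (x * u - y * v)\<^sup>2) * f (x * y * v / (u * (x * u - y * v)))
      * indicator {0<..<x * u / v} y \<partial>lborel)"
proof -
  have pos: "y * v < x * u \<longleftrightarrow> y < x * u / v" for y
    using assms by (simp add: field_simps)
  have "(\<integral>\<^sup>+a. f a * indicator {0<..} a \<partial>lborel) =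
    (\<integral>\<^sup>+y. ennreal \<bar>x\<^sup>2 * v / (x * u - y * v)\<^sup>2\<bar> * f (x * y * v / (u * (x * u - y * v)))
      * indicator {0<..<x * u / v} y \<partial>lborel)"
  proof (rule nn_integral_substitution_inj)
    show "(\<lambda>y. x * y * v / (u * (x * u - y * v))) ` {0<..<x * u / v} = {0<..}"
    proof (intro set_eqI iffI)
      fix a :: real assume a: "a \<in> {0<..}"
      \<comment> \<open>The witness is the forward map x (a u / v) / (a + x / u) with its inner
        fractions cleared.\<close>
      define y where "y = x * a * u\<^sup>2 / (v * (a * u + x))"
      have au: "0 < a * u + x" using a assms by (simp add: add_pos_pos)
      have z: "x * u - y * v = x\<^sup>2 * u / (a * u + x)"
      proof -
        have "x * u - y * v = (x * u * (a * u + x) - x * a * u\<^sup>2) / (a * u + x)"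
          using au assms by (simp add: y_def diff_divide_distrib)
        also have "x * u * (a * u + x) - x * a * u\<^sup>2 = x\<^sup>2 * u"
          by (simp add: algebra_simps power2_eq_square)
        finally show ?thesis .
      qed
      have "0 < x * u - y * v"
        unfolding z using au assms by simp
      moreover have "0 < y"
        using a au assms by (simp add: y_def)
      moreover have "a = x * y * v / (u * (x * u - y * v))"
      proof -
        have "x * y * v = a * (u * (x\<^sup>2 * u / (a * u + x)))"
          using assms by (simp add: y_def power2_eq_square mult_ac)
        moreover have "u * (x\<^sup>2 * u / (a * u + x)) \<noteq> 0"
          using au assms by simp
        ultimately show ?thesis
          unfolding z by (metis nonzero_mult_div_cancel_right)
      qed
      ultimately show "a \<in> (\<lambda>y. x * y * v / (u * (x * u - y * v))) ` {0<..<x * u / v}"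
        by (intro image_eqI[of _ _ y]) (auto simp: pos)
    qed (use assms in \<open>auto simp: pos intro!: divide_pos_pos mult_pos_pos\<close>)
    show "((\<lambda>y. x * y * v / (u * (x * u - y * v))) has_field_derivative x\<^sup>2 * v / (x * u - y * v)\<^sup>2) (at y)"
      if "y \<in> {0<..<x * u / v}" for y
    proof -
      have "0 < x * u - y * v" using that by (simp add: pos)
      then show ?thesis
        using assms by (auto intro!: derivative_eq_intros simp: power2_eq_square divide_simps) (simp add: algebra_simps)
    qed
    show "inj_on (\<lambda>y. x * y * v / (u * (x * u - y * v))) {0<..<x * u / v}"
    proof (rule inj_onI)
      fix y y' assume "y \<in> {0<..<x * u / v}" "y' \<in> {0<..<x * u / v}"
        and eq: "x * y * v / (u * (x * u - y * v)) = x * y' * v / (u * (x * u - y' * v))"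
      then have z: "0 < x * u - y * v" "0 < x * u - y' * v"
        by (auto simp: pos)
      have "x * v * (y * (x * u - y' * v)) = x * v * (y' * (x * u - y * v))"
      proof -
        have "u * (x * u - y * v) \<noteq> 0" "u * (x * u - y' * v) \<noteq> 0"
          using z assms(2) by simp_all
        from frac_eq_eq[OF this] eq
        have "x * y * v * (u * (x * u - y' * v)) = x * y' * v * (u * (x * u - y * v))"
          by blast
        then have "u * (x * v * (y * (x * u - y' * v))) = u * (x * v * (y' * (x * u - y * v)))"
          by (simp only: mult_ac)
        then show ?thesis using assms by simp
      qed
      then have "y * (x * u - y' * v) = y' * (x * u - y * v)"
        using assms by (simp only: mult_left_cancel mult_eq_0_iff less_imp_neq[symmetric] simp_thms)
      then have "x * u * (y - y') = 0"
        by (simp add: algebra_simps)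
      then show "y = y'"
        using assms by simp
    qed
  qed simp_all
  also have "\<dots> = (\<integral>\<^sup>+y. ennreal (x\<^sup>2 * v / (x * u - y * v)\<^sup>2) * f (x * y * v / (u * (x * u - y * v)))
      * indicator {0<..<x * u / v} y \<partial>lborel)"
    using assms by (intro nn_integral_cong) (auto split: split_indicator)
  finally show ?thesis .
qed

lemma nn_integral_substitution_affine:
  fixes f :: "real \<Rightarrow> ennreal"
  assumes "0 < x" and [measurable]: "f \<in> borel_measurable borel"
  shows "(\<integral>\<^sup>+u. f (x * u - t) * indicator {0<..} (x * u - t) \<partial>lborel) =
    ennreal (1 / x) * (\<integral>\<^sup>+z. f z * indicator {0<..} z \<partial>lborel)"
proof -
  have "(\<integral>\<^sup>+z. f z * indicator {0<..} z \<partial>lborel) =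
      ennreal x * (\<integral>\<^sup>+u. f (- t + x * u) * indicator {0<..} (- t + x * u) \<partial>lborel)"
    using assms by (subst nn_integral_real_affine[where c = x and t = "- t"]) auto
  then have "ennreal (1 / x) * (\<integral>\<^sup>+z. f z * indicator {0<..} z \<partial>lborel) =
      ennreal (1 / x) * ennreal x * (\<integral>\<^sup>+u. f (x * u - t) * indicator {0<..} (x * u - t) \<partial>lborel)"
    by (simp add: mult.assoc)
  also have "ennreal (1 / x) * ennreal x = 1"
    using assms by (simp add: ennreal_mult'[symmetric])
  finally show ?thesis by simp
qed

section \<open>The intertwining relation\<close>

lemma borel_measurable_besselK [measurable]:
  assumes [measurable]: "f \<in> borel_measurable M"
  shows "(\<lambda>x. besselK \<nu> (f x)) \<in> borel_measurable M"
  unfolding besselK_def by measurable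

lemma borel_measurable_trans_density [measurable]:
  assumes [measurable]: "f \<in> borel_measurable M" "g \<in> borel_measurable M"
  shows "(\<lambda>x. trans_density \<alpha> \<beta> (f x) (g x)) \<in> borel_measurable M"
  unfolding trans_density_def by measurable

lemma nn_integral_swap_lborel:
  fixes f :: "real \<Rightarrow> real \<Rightarrow> ennreal"
  assumes "case_prod f \<in> borel_measurable (lborel \<Otimes>\<^sub>M lborel)"
  shows "(\<integral>\<^sup>+x. \<integral>\<^sup>+y. f x y \<partial>lborel \<partial>lborel) = (\<integral>\<^sup>+y. \<integral>\<^sup>+x. f x y \<partial>lborel \<partial>lborel)"
  using lborel_pair.Fubini'[OF assms] by simp

context
  fixes \<alpha> \<beta> x :: real
begin

text \<open>The factor in y of the unnormalised joint density of (y, v), once the weight of v is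
  split off and z is integrated out. It becomes \<open>trans_density\<close> on multiplying by the
  mass of the weight of v and dividing by that of u.\<close>

definition marginal_weight :: "real \<Rightarrow> real" where
  "marginal_weight y = indicator {0<..} y * (2 * x / (Gamma \<alpha> * Gamma \<beta>) * (x * y) powr (\<alpha> + \<beta> - 1)
     * (2 * besselK (\<alpha> + \<beta>) (2 * sqrt (x\<^sup>2 + y\<^sup>2)) / sqrt (x\<^sup>2 + y\<^sup>2) powr (\<alpha> + \<beta>)))"

text \<open>After b is exchanged for v, the density is \<open>source_weight\<close>. Exchanging a
  for y turns it into \<open>target_weight\<close> times \<open>cut_weight\<close>, and u survives
  only in the latter, through z = A - A', the amount cut off from A.\<close>

definition source_weight :: "real \<Rightarrow> real \<Rightarrow> real \<Rightarrow> real" where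
  "source_weight u a v = gamma_density \<beta> (a * u\<^sup>2 / v\<^sup>2) * gamma_density \<alpha> a * gig_weight (\<alpha> - \<beta>) (2 * x) (2 * x) u
      * (2 * a * u\<^sup>2 / v ^ 3)"

definition target_weight :: "real \<Rightarrow> real \<Rightarrow> real" where
  "target_weight y v = indicator {0<..} y * (2 * x\<^sup>2 / (Gamma \<alpha> * Gamma \<beta>) * (x * y) powr (\<alpha> + \<beta> - 1)
    * gig_weight (\<alpha> - \<beta>) (2 * y) (2 * y) v)"

definition cut_weight :: "real \<Rightarrow> real \<Rightarrow> real" where
  "cut_weight y z = z powr (- (\<alpha> + \<beta>) - 1) * exp (- (z + (x\<^sup>2 + y\<^sup>2) / z))"

lemma measurable_weights [measurable]:
  assumes [measurable]: "f \<in> borel_measurable M" "g \<in> borel_measurable M" "h \<in> borel_measurable M"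
  shows "(\<lambda>w. source_weight (f w) (g w) (h w)) \<in> borel_measurable M"
    "(\<lambda>w. target_weight (f w) (g w)) \<in> borel_measurable M"
    "(\<lambda>w. cut_weight (f w) (g w)) \<in> borel_measurable M"
    "(\<lambda>w. marginal_weight (f w)) \<in> borel_measurable M"
  unfolding source_weight_def target_weight_def cut_weight_def marginal_weight_def by measurable

context
  fixes \<phi> :: "real \<times> real \<Rightarrow> ennreal"
  assumes x: "0 < x" and ab: "0 < \<alpha>" "0 < \<beta>"
    and \<phi> [measurable]: "\<phi> \<in> borel_measurable (borel \<Otimes>\<^sub>M borel)"
begin

lemma weights_nonneg: "0 \<le> target_weight y v" "0 \<le> cut_weight y z"
  using ab by (auto simp: target_weight_def cut_weight_def gig_weight_nonneg Gamma_real_nonneg)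

text \<open>For fixed u and a, the variable v takes the place of b because it is the second argument
  of \<phi>; the first follows from sqrt(a b) = a u / v. If u or a is not positive, both weights
  vanish.\<close>

lemma integrate_b:
  "(\<integral>\<^sup>+b. \<phi> (x * sqrt (a * b) / (a + x / u), u * sqrt (a / b))
      * ennreal (gamma_density \<beta> b * gamma_density \<alpha> a * gig_weight (\<alpha> - \<beta>) (2 * x) (2 * x) u) \<partial>lborel) =
   (\<integral>\<^sup>+v. \<phi> (x * (a * u / v) / (a + x / u), v) * ennreal (source_weight u a v) * indicator {0<..} v \<partial>lborel)"
proof (cases "0 < u \<and> 0 < a")
  case True
  let ?f = "\<lambda>b. \<phi> (x * sqrt (a * b) / (a + x / u), u * sqrt (a / b))
      * ennreal (gamma_density \<beta> b * gamma_density \<alpha> a * gig_weight (\<alpha> - \<beta>) (2 * x) (2 * x) u)"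
  have k: "0 < a * u\<^sup>2" using True by simp
  have "(\<integral>\<^sup>+b. ?f b \<partial>lborel) = (\<integral>\<^sup>+b. ?f b * indicator {0<..} b \<partial>lborel)"
    by (intro nn_integral_cong) (auto simp: gamma_density_def split: split_indicator)
  also have "\<dots> = (\<integral>\<^sup>+v. ennreal (2 * (a * u\<^sup>2) / v ^ 3) * ?f (a * u\<^sup>2 / v\<^sup>2) * indicator {0<..} v \<partial>lborel)"
    by (rule nn_integral_substitution_inverse_square[OF k]) measurable
  also have "\<dots> = (\<integral>\<^sup>+v. \<phi> (x * (a * u / v) / (a + x / u), v) * ennreal (source_weight u a v) * indicator {0<..} v \<partial>lborel)"
  proof (intro nn_integral_cong)
    fix v :: real
    have "sqrt (a * (a * u\<^sup>2 / v\<^sup>2)) = a * u / v" "u * sqrt (a / (a * u\<^sup>2 / v\<^sup>2)) = v" if "0 < v"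
    proof -
      have "a * (a * u\<^sup>2 / v\<^sup>2) = (a * u / v)\<^sup>2"
        by (simp add: power2_eq_square)
      then show "sqrt (a * (a * u\<^sup>2 / v\<^sup>2)) = a * u / v"
        using True that by simp
      have "a / (a * u\<^sup>2 / v\<^sup>2) = (v / u)\<^sup>2"
        using True by (simp add: power2_eq_square)
      then show "u * sqrt (a / (a * u\<^sup>2 / v\<^sup>2)) = v"
        using True that by simp
    qed
    moreover have "ennreal (2 * (a * u\<^sup>2) / v ^ 3) * ennreal (gamma_density \<beta> (a * u\<^sup>2 / v\<^sup>2) * gamma_density \<alpha> a * gig_weight (\<alpha> - \<beta>) (2 * x) (2 * x) u) =
        ennreal (source_weight u a v)" if "0 < v"
      using True that by (simp add: source_weight_def ennreal_mult'[symmetric] mult_ac)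
    ultimately show "ennreal (2 * (a * u\<^sup>2) / v ^ 3) * ?f (a * u\<^sup>2 / v\<^sup>2) * indicator {0<..} v =
        \<phi> (x * (a * u / v) / (a + x / u), v) * ennreal (source_weight u a v) * indicator {0<..} v"
      by (cases "0 < v") (simp_all add: mult_ac)
  qed
  finally show ?thesis .
next
  case False
  then have "gamma_density \<alpha> a * gig_weight (\<alpha> - \<beta>) (2 * x) (2 * x) u = 0"
    by (auto simp: gamma_density_def gig_weight_def)
  then have "gamma_density \<beta> b * gamma_density \<alpha> a * gig_weight (\<alpha> - \<beta>) (2 * x) (2 * x) u = 0" "source_weight u a v = 0" for b v
    unfolding source_weight_def by auto
  then show ?thesis by (simp only: ennreal_0 mult_zero_right mult_zero_left nn_integral_const)
qed

text \<open>For fixed u and v, the range y < x u / v is the condition z > 0. It is kept as an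
  indicator of z so that the later integral over u needs no adjustment of its range.\<close>

lemma integrate_a:
  "(\<integral>\<^sup>+a. \<phi> (x * (a * u / v) / (a + x / u), v) * ennreal (source_weight u a v) * indicator {0<..} v \<partial>lborel) =
   (\<integral>\<^sup>+y. \<phi> (y, v) * ennreal (target_weight y v) * (ennreal (cut_weight y (x * u - y * v)) * indicator {0<..} (x * u - y * v)) \<partial>lborel)"
proof (cases "0 < u \<and> 0 < v")
  case True
  then have u: "0 < u" and v: "0 < v" by auto
  let ?f = "\<lambda>a. \<phi> (x * (a * u / v) / (a + x / u), v) * ennreal (source_weight u a v)"
  have "(\<integral>\<^sup>+a. ?f a * indicator {0<..} v \<partial>lborel) = (\<integral>\<^sup>+a. ?f a * indicator {0<..} a \<partial>lborel)"
    using v by (intro nn_integral_cong) (auto simp: source_weight_def gamma_density_def split: split_indicator)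
  also have "\<dots> = (\<integral>\<^sup>+y. ennreal (x\<^sup>2 * v / (x * u - y * v)\<^sup>2) * ?f (x * y * v / (u * (x * u - y * v)))
      * indicator {0<..<x * u / v} y \<partial>lborel)"
    by (rule nn_integral_substitution_moebius[OF x u v]) measurable
  also have "\<dots> = (\<integral>\<^sup>+y. \<phi> (y, v) * ennreal (target_weight y v) * (ennreal (cut_weight y (x * u - y * v)) * indicator {0<..} (x * u - y * v)) \<partial>lborel)"
  proof (intro nn_integral_cong)
    fix y :: real
    show "ennreal (x\<^sup>2 * v / (x * u - y * v)\<^sup>2) * ?f (x * y * v / (u * (x * u - y * v))) * indicator {0<..<x * u / v} y =
        \<phi> (y, v) * ennreal (target_weight y v) * (ennreal (cut_weight y (x * u - y * v)) * indicator {0<..} (x * u - y * v))"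
    proof (cases "0 < y \<and> 0 < x * u - y * v")
      case True
      define z where "z = x * u - y * v"
      define a where "a = x * y * v / (u * z)"
      have y: "0 < y" and z: "0 < z" using True by (auto simp: z_def)
      have rel: "x * u = z + y * v" by (simp add: z_def)
      have "a + x / u = x * (z + y * v) / (u * z)"
        using u z by (simp add: a_def field_simps)
      also have "\<dots> = x\<^sup>2 / z"
        unfolding rel[symmetric] using u by (simp add: power2_eq_square)
      finally have "x * (a * u / v) / (a + x / u) = y"
        using x u v z by (simp add: a_def power2_eq_square)
      moreover have "source_weight u a v * (x\<^sup>2 * v / z\<^sup>2) = target_weight y v * cut_weight y z"
        unfolding source_weight_def target_weight_def cut_weight_def a_def
        using weight_substitution[OF x y u v z rel, of \<beta> \<alpha>] y by simp
      then have "ennreal (x\<^sup>2 * v / z\<^sup>2 * source_weight u a v) = ennreal (target_weight y v * cut_weight y z)"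
        by (simp only: mult.commute)
      then have "ennreal (x\<^sup>2 * v / z\<^sup>2) * ennreal (source_weight u a v) = ennreal (target_weight y v) * ennreal (cut_weight y z)"
        using v by (subst (asm) (1 2) ennreal_mult') (simp_all add: weights_nonneg)
      moreover have "y < x * u / v"
        using True v by (simp add: field_simps)
      ultimately show ?thesis
        using y z unfolding z_def[symmetric] a_def[symmetric]
        by simp (simp add: mult_ac)
    next
      case False
      then have "\<not> (0 < y \<and> y < x * u / v)"
        using v by (auto simp: field_simps)
      with False show ?thesis
        by (auto simp: target_weight_def split: split_indicator)
    qed
  qed
  finally show ?thesis .
next
  case False
  \<comment> \<open>When y and v are positive, u \<le> 0 forces z < 0; otherwise the target weight
    is itself zero.\<close>
  have "target_weight y v * indicator {0<..} (x * u - y * v) = 0" for y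
  proof (cases "0 < v \<and> 0 < y")
    case True
    then have "u \<le> 0" using False by auto
    then have "x * u \<le> 0" using x by (simp add: mult_le_0_iff)
    moreover have "0 < y * v" using True by simp
    ultimately show ?thesis by simp
  qed (auto simp: target_weight_def gig_weight_def)
  then have *: "ennreal (target_weight y v) * indicator {0<..} (x * u - y * v) = 0" for y
    by (metis ennreal_0 indicator_eq_0_iff mult_eq_0_iff)
  have "\<phi> (y, v) * ennreal (target_weight y v) * (ennreal (cut_weight y (x * u - y * v)) * indicator {0<..} (x * u - y * v)) = 0" for y
    using *[of y] by auto
  moreover have "\<phi> (x * (a * u / v) / (a + x / u), v) * ennreal (source_weight u a v) * indicator {0<..} v = 0" for a
    using False by (auto simp: source_weight_def gig_weight_def)
  ultimately show ?thesis
    by (simp only: nn_integral_const mult_zero_left)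
qed

text \<open>For fixed y and v, z is affine in u with slope x. The integral over z > 0 therefore does
  not depend on v, and the factor 1 / x reduces the x^2 of \<open>target_weight\<close> to the x of
  \<open>marginal_weight\<close>.\<close>

lemma integrate_u:
  "(\<integral>\<^sup>+u. \<phi> (y, v) * ennreal (target_weight y v) * (ennreal (cut_weight y (x * u - y * v)) * indicator {0<..} (x * u - y * v)) \<partial>lborel) =
   \<phi> (y, v) * ennreal (marginal_weight y * gig_weight (\<alpha> - \<beta>) (2 * y) (2 * y) v)"
proof -
  let ?c = "sqrt (x\<^sup>2 + y\<^sup>2)"
  have c: "0 < ?c" "?c\<^sup>2 = x\<^sup>2 + y\<^sup>2"
    using x by (auto simp: add_pos_nonneg)
  have "(\<integral>\<^sup>+u. ennreal (cut_weight y (x * u - y * v)) * indicator {0<..} (x * u - y * v) \<partial>lborel) =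
      ennreal (1 / x) * (\<integral>\<^sup>+z. ennreal (cut_weight y z) * indicator {0<..} z \<partial>lborel)"
    by (rule nn_integral_substitution_affine[OF x]) measurable
  also have "(\<integral>\<^sup>+z. ennreal (cut_weight y z) * indicator {0<..} z \<partial>lborel) =
      ennreal (2 * besselK (\<alpha> + \<beta>) (2 * ?c) / ?c powr (\<alpha> + \<beta>))"
    using nn_integral_inverse_gamma_bessel[OF c(1), of "\<alpha> + \<beta>"] unfolding c(2) cut_weight_def .
  finally have *: "(\<integral>\<^sup>+u. ennreal (cut_weight y (x * u - y * v)) * indicator {0<..} (x * u - y * v) \<partial>lborel) =
      ennreal (1 / x) * ennreal (2 * besselK (\<alpha> + \<beta>) (2 * ?c) / ?c powr (\<alpha> + \<beta>))" .
  have "target_weight y v * (1 / x * (2 * besselK (\<alpha> + \<beta>) (2 * ?c) / ?c powr (\<alpha> + \<beta>))) =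
      marginal_weight y * gig_weight (\<alpha> - \<beta>) (2 * y) (2 * y) v"
    using x unfolding target_weight_def marginal_weight_def by (simp add: power2_eq_square mult_ac)
  then have "ennreal (target_weight y v) * (ennreal (1 / x) * ennreal (2 * besselK (\<alpha> + \<beta>) (2 * ?c) / ?c powr (\<alpha> + \<beta>))) =
      ennreal (marginal_weight y * gig_weight (\<alpha> - \<beta>) (2 * y) (2 * y) v)"
    using x weights_nonneg(1)[of y v] by (simp only: ennreal_mult'[symmetric] zero_le_divide_1_iff less_imp_le)
  with * show ?thesis
    by (subst nn_integral_cmult) (simp_all add: mult.assoc)
qed

text \<open>The substitutions are \<open>b = a u\<^sup>2 / v\<^sup>2\<close>, then \<open>a = x y v / (u (x u - y v))\<close>, then \<open>z = x u - y v\<close>.\<close>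

lemma gig_gamma_unnormalised:
  "(\<integral>\<^sup>+u. \<integral>\<^sup>+a. \<integral>\<^sup>+b. \<phi> (x * sqrt (a * b) / (a + x / u), u * sqrt (a / b))
      * ennreal (gamma_density \<beta> b * gamma_density \<alpha> a * gig_weight (\<alpha> - \<beta>) (2 * x) (2 * x) u)
      \<partial>lborel \<partial>lborel \<partial>lborel) =
   (\<integral>\<^sup>+y. \<integral>\<^sup>+v. \<phi> (y, v) * ennreal (marginal_weight y * gig_weight (\<alpha> - \<beta>) (2 * y) (2 * y) v) \<partial>lborel \<partial>lborel)"
    (is "?lhs = ?rhs")
proof -
  let ?H1 = "\<lambda>u a v. \<phi> (x * (a * u / v) / (a + x / u), v) * ennreal (source_weight u a v) * indicator {0<..} v"
  let ?H2 = "\<lambda>u v y. \<phi> (y, v) * ennreal (target_weight y v) *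
    (ennreal (cut_weight y (x * u - y * v)) * indicator {0<..} (x * u - y * v))"
  have "?lhs = (\<integral>\<^sup>+u. \<integral>\<^sup>+a. \<integral>\<^sup>+v. ?H1 u a v \<partial>lborel \<partial>lborel \<partial>lborel)"
    unfolding integrate_b ..
  also have "\<dots> = (\<integral>\<^sup>+u. \<integral>\<^sup>+v. \<integral>\<^sup>+a. ?H1 u a v \<partial>lborel \<partial>lborel \<partial>lborel)"
    by (intro nn_integral_cong nn_integral_swap_lborel) measurable
  also have "\<dots> = (\<integral>\<^sup>+u. \<integral>\<^sup>+v. \<integral>\<^sup>+y. ?H2 u v y \<partial>lborel \<partial>lborel \<partial>lborel)"
    unfolding integrate_a ..
  also have "\<dots> = (\<integral>\<^sup>+v. \<integral>\<^sup>+u. \<integral>\<^sup>+y. ?H2 u v y \<partial>lborel \<partial>lborel \<partial>lborel)"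
    by (intro nn_integral_swap_lborel) measurable
  also have "\<dots> = (\<integral>\<^sup>+v. \<integral>\<^sup>+y. \<integral>\<^sup>+u. ?H2 u v y \<partial>lborel \<partial>lborel \<partial>lborel)"
    by (intro nn_integral_cong nn_integral_swap_lborel) measurable
  also have "\<dots> = (\<integral>\<^sup>+v. \<integral>\<^sup>+y. \<phi> (y, v) * ennreal (marginal_weight y * gig_weight (\<alpha> - \<beta>) (2 * y) (2 * y) v) \<partial>lborel \<partial>lborel)"
    unfolding integrate_u ..
  also have "\<dots> = ?rhs"
    by (intro nn_integral_swap_lborel) measurable
  finally show ?thesis .
qed

end

end

section \<open>Normalised laws, the initial law and the transition kernel\<close>

definition gamma_law :: "real \<Rightarrow> real measure" where
  "gamma_law a = density lborel (\<lambda>x. ennreal (gamma_density a x))"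

lemma nn_integral_gig_law:
  assumes "0 < x" and [measurable]: "f \<in> borel_measurable borel"
  shows "(\<integral>\<^sup>+u. f u \<partial>gig_law p (2 * x) (2 * x)) =
    (\<integral>\<^sup>+u. f u * ennreal (gig_weight p (2 * x) (2 * x) u) \<partial>lborel) / ennreal (2 * besselK p (2 * x))"
proof -
  have K: "0 < 2 * besselK p (2 * x)" using besselK_pos[OF assms(1)] by simp
  have "(\<integral>\<^sup>+u. f u \<partial>gig_law p (2 * x) (2 * x)) =
     (\<integral>\<^sup>+u. ennreal (gig_weight p (2 * x) (2 * x) u / (2 * besselK p (2 * x))) * f u \<partial>lborel)"
    unfolding gig_law_def integral_gig_weight by (subst nn_integral_density) simp_all
  also have "\<dots> = (\<integral>\<^sup>+u. f u * ennreal (gig_weight p (2 * x) (2 * x) u) / ennreal (2 * besselK p (2 * x)) \<partial>lborel)"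
    using K by (intro nn_integral_cong) (simp add: divide_ennreal[symmetric] gig_weight_nonneg ennreal_times_divide mult.commute)
  also have "\<dots> = (\<integral>\<^sup>+u. f u * ennreal (gig_weight p (2 * x) (2 * x) u) \<partial>lborel) / ennreal (2 * besselK p (2 * x))"
    by (rule nn_integral_divide) measurable
  finally show ?thesis .
qed

lemma prob_space_gig_law:
  assumes "0 < x"
  shows "prob_space (gig_law p (2 * x) (2 * x))"
proof (rule prob_spaceI)
  have K: "0 < 2 * besselK p (2 * x)" using besselK_pos[OF assms(1)] by simp
  have "emeasure (gig_law p (2 * x) (2 * x)) UNIV = (\<integral>\<^sup>+u. 1 \<partial>gig_law p (2 * x) (2 * x))"
    by (simp add: gig_law_def)
  also have "\<dots> = 1"
    using K by (subst nn_integral_gig_law[OF assms]) (simp_all add: nn_integral_gig_weight assms)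
  finally show "emeasure (gig_law p (2 * x) (2 * x)) (space (gig_law p (2 * x) (2 * x))) = 1"
    by (simp add: gig_law_def)
qed

lemma nn_integral_gamma_law:
  assumes "f \<in> borel_measurable borel"
  shows "(\<integral>\<^sup>+a. f a \<partial>gamma_law s) = (\<integral>\<^sup>+a. f a * ennreal (gamma_density s a) \<partial>lborel)"
  using assms unfolding gamma_law_def by (subst nn_integral_density) (simp_all add: mult.commute)

lemma prob_space_gamma_law:
  assumes "0 < s"
  shows "prob_space (gamma_law s)"
proof (rule prob_spaceI)
  have G: "0 < Gamma s" using assms by (rule Gamma_real_pos)
  have "emeasure (gamma_law s) UNIV = (\<integral>\<^sup>+x. ennreal (gamma_density s x) \<partial>lborel)"
    by (simp add: gamma_law_def emeasure_density)
  also have "\<dots> = (\<integral>\<^sup>+t. ennreal (indicator {0..} t * t powr (s - 1) / exp t) / ennreal (Gamma s) \<partial>lborel)"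
    using G by (intro nn_integral_cong)
      (auto simp: gamma_density_def divide_ennreal exp_minus field_simps split: split_indicator)
  also have "\<dots> = ennreal (Gamma s) / ennreal (Gamma s)"
    unfolding Gamma_conv_nn_integral_real[OF assms] by (rule nn_integral_divide) measurable
  also have "\<dots> = 1"
    using G by simp
  finally show "emeasure (gamma_law s) (space (gamma_law s)) = 1"
    by (simp add: gamma_law_def)
qed

lemma trans_density_nonneg:
  assumes "0 < \<alpha>" "0 < \<beta>" "0 < x"
  shows "0 \<le> trans_density \<alpha> \<beta> x y"
proof (cases "0 < y")
  case True
  have "0 < sqrt (x\<^sup>2 + y\<^sup>2)"
    using assms by (auto simp: add_pos_nonneg)
  then show ?thesis
    unfolding trans_density_def using True assms besselK_pos[of x] besselK_pos[of y] besselK_pos[of "sqrt (x\<^sup>2 + y\<^sup>2)"]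
    by (auto intro!: mult_nonneg_nonneg divide_nonneg_nonneg less_imp_le[OF Gamma_real_pos] less_imp_le)
qed (simp add: trans_density_def)

text \<open>Normalising the old weight of u divides by the Bessel function at 2 x, while restoring a
  normalised law for v multiplies by the one at 2 y. This is the ratio in
  \<open>trans_density\<close>.\<close>

lemma marginal_weight_eq:
  assumes "0 < x" "0 < y"
  shows "marginal_weight \<alpha> \<beta> x y / (2 * besselK (\<alpha> - \<beta>) (2 * x)) =
    trans_density \<alpha> \<beta> x y / (2 * besselK (\<alpha> - \<beta>) (2 * y))"
proof -
  have K: "0 < besselK (\<alpha> - \<beta>) (2 * x)" "0 < besselK (\<alpha> - \<beta>) (2 * y)"
    using assms by (auto intro: besselK_pos)
  have "sqrt (x\<^sup>2 + y\<^sup>2) powr (\<alpha> + \<beta>) = (x\<^sup>2 + y\<^sup>2) powr ((\<alpha> + \<beta>) / 2)"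
    by (simp add: powr_half_sqrt[symmetric] powr_powr)
  moreover have "(x * y) powr (\<alpha> + \<beta> - 1) = (x * y) powr (\<alpha> + \<beta>) / (x * y)"
    using assms by (simp add: powr_diff)
  ultimately show ?thesis
    using K assms unfolding marginal_weight_def trans_density_def
    by (simp add: mult_ac)
qed

text \<open>The parameter of the law varies with w. Written with its density, the integral is a
  Lebesgue integral depending on a parameter, and Fubini gives measurability. The next lemmas treat
  the other two laws in the same way.\<close>

lemma borel_measurable_nn_integral_gig_law [measurable]:
  assumes [measurable]: "case_prod g \<in> borel_measurable (M \<Otimes>\<^sub>M borel)" "f \<in> borel_measurable M"
  shows "(\<lambda>w. \<integral>\<^sup>+v. g w v \<partial>gig_law p (f w) (f w)) \<in> borel_measurable M"
proof -
  have "(\<integral>\<^sup>+v. g w v \<partial>gig_law p (f w) (f w)) =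
      (\<integral>\<^sup>+v. ennreal (gig_weight p (f w) (f w) v / (\<integral>y. gig_weight p (f w) (f w) y \<partial>lborel)) * g w v \<partial>lborel)"
    if "w \<in> space M" for w
    unfolding gig_law_def using that by (subst nn_integral_density) simp_all
  then show ?thesis
    by (simp cong: measurable_cong)
qed

lemma borel_measurable_nn_integral_gamma_law [measurable]:
  assumes [measurable]: "case_prod g \<in> borel_measurable (M \<Otimes>\<^sub>M borel)"
  shows "(\<lambda>w. \<integral>\<^sup>+v. g w v \<partial>gamma_law s) \<in> borel_measurable M"
proof -
  have "(\<integral>\<^sup>+v. g w v \<partial>gamma_law s) = (\<integral>\<^sup>+v. g w v * ennreal (gamma_density s v) \<partial>lborel)"
    if "w \<in> space M" for w
    using that by (intro nn_integral_gamma_law) simp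
  then show ?thesis
    by (simp cong: measurable_cong)
qed

lemma nn_integral_trans_kernel:
  assumes "f \<in> borel_measurable borel"
  shows "(\<integral>\<^sup>+y. f y \<partial>trans_kernel \<alpha> \<beta> x) = (\<integral>\<^sup>+y. ennreal (trans_density \<alpha> \<beta> x y) * f y \<partial>lborel)"
  using assms unfolding trans_kernel_def by (subst nn_integral_density) simp_all

lemma borel_measurable_nn_integral_trans_kernel [measurable]:
  assumes [measurable]: "case_prod g \<in> borel_measurable (M \<Otimes>\<^sub>M borel)" "f \<in> borel_measurable M"
  shows "(\<lambda>w. \<integral>\<^sup>+v. g w v \<partial>trans_kernel \<alpha> \<beta> (f w)) \<in> borel_measurable M"
proof -
  have "(\<integral>\<^sup>+v. g w v \<partial>trans_kernel \<alpha> \<beta> (f w)) = (\<integral>\<^sup>+v. ennreal (trans_density \<alpha> \<beta> (f w) v) * g w v \<partial>lborel)"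
    if "w \<in> space M" for w
    using that by (intro nn_integral_trans_kernel) simp
  then show ?thesis
    by (simp cong: measurable_cong)
qed

text \<open>In operator form \<Lambda> P = Q \<Lambda>, with P the kernel of the pair (\<Gamma>,
  e^S), Q = \<open>trans_kernel\<close> and \<Lambda> the passage from x to (x, u) with u
  generalized inverse Gaussian. On the right v is drawn from y alone: once y is known, x carries no
  further information on v.\<close>

lemma gig_gamma_intertwining:
  assumes x: "0 < x" and ab: "0 < \<alpha>" "0 < \<beta>"
    and \<phi> [measurable]: "\<phi> \<in> borel_measurable (borel \<Otimes>\<^sub>M borel)"
  shows "(\<integral>\<^sup>+u. \<integral>\<^sup>+a. \<integral>\<^sup>+b. \<phi> (x * sqrt (a * b) / (a + x / u), u * sqrt (a / b))
      \<partial>gamma_law \<beta> \<partial>gamma_law \<alpha> \<partial>gig_law (\<alpha> - \<beta>) (2 * x) (2 * x)) =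
    (\<integral>\<^sup>+y. \<integral>\<^sup>+v. \<phi> (y, v) \<partial>gig_law (\<alpha> - \<beta>) (2 * y) (2 * y) \<partial>trans_kernel \<alpha> \<beta> x)"
proof -
  let ?p = "\<alpha> - \<beta>"
  let ?F = "\<lambda>u a b. \<phi> (x * sqrt (a * b) / (a + x / u), u * sqrt (a / b))"
  let ?K = "\<lambda>x. ennreal (2 * besselK ?p (2 * x))"
  let ?G = "\<lambda>y. \<integral>\<^sup>+v. \<phi> (y, v) * ennreal (gig_weight ?p (2 * y) (2 * y) v) \<partial>lborel"
  have "(\<integral>\<^sup>+b. ?F u a b \<partial>gamma_law \<beta>) = (\<integral>\<^sup>+b. ?F u a b * ennreal (gamma_density \<beta> b) \<partial>lborel)" for u a
    by (rule nn_integral_gamma_law) measurable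
  then have "(\<integral>\<^sup>+a. \<integral>\<^sup>+b. ?F u a b \<partial>gamma_law \<beta> \<partial>gamma_law \<alpha>) =
      (\<integral>\<^sup>+a. (\<integral>\<^sup>+b. ?F u a b * ennreal (gamma_density \<beta> b) \<partial>lborel) * ennreal (gamma_density \<alpha> a) \<partial>lborel)" for u
    by (simp only:) (rule nn_integral_gamma_law, measurable)
  then have "(\<integral>\<^sup>+u. \<integral>\<^sup>+a. \<integral>\<^sup>+b. ?F u a b \<partial>gamma_law \<beta> \<partial>gamma_law \<alpha> \<partial>gig_law ?p (2 * x) (2 * x)) =
     (\<integral>\<^sup>+u. (\<integral>\<^sup>+a. (\<integral>\<^sup>+b. ?F u a b * ennreal (gamma_density \<beta> b) \<partial>lborel) * ennreal (gamma_density \<alpha> a) \<partial>lborel)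
        * ennreal (gig_weight ?p (2 * x) (2 * x) u) \<partial>lborel) / ?K x"
    by (simp only:) (rule nn_integral_gig_law[OF x], measurable)
  also have "(\<integral>\<^sup>+u. (\<integral>\<^sup>+a. (\<integral>\<^sup>+b. ?F u a b * ennreal (gamma_density \<beta> b) \<partial>lborel) * ennreal (gamma_density \<alpha> a) \<partial>lborel)
        * ennreal (gig_weight ?p (2 * x) (2 * x) u) \<partial>lborel) =
    (\<integral>\<^sup>+u. \<integral>\<^sup>+a. \<integral>\<^sup>+b. ?F u a b * ennreal (gamma_density \<beta> b * gamma_density \<alpha> a * gig_weight ?p (2 * x) (2 * x) u)
      \<partial>lborel \<partial>lborel \<partial>lborel)"
    by (simp add: nn_integral_multc[symmetric] ennreal_mult' ennreal_mult gamma_density_nonneg ab mult.assoc gig_weight_nonneg)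
  also have "\<dots> = (\<integral>\<^sup>+y. \<integral>\<^sup>+v. \<phi> (y, v) * ennreal (marginal_weight \<alpha> \<beta> x y * gig_weight ?p (2 * y) (2 * y) v) \<partial>lborel \<partial>lborel)"
    by (rule gig_gamma_unnormalised[OF x ab \<phi>])
  also have "\<dots> / ?K x = (\<integral>\<^sup>+y. (\<integral>\<^sup>+v. \<phi> (y, v) * ennreal (marginal_weight \<alpha> \<beta> x y * gig_weight ?p (2 * y) (2 * y) v) \<partial>lborel) / ?K x \<partial>lborel)"
    by (rule nn_integral_divide[symmetric]) (use x ab in measurable)
  also have "\<dots> = (\<integral>\<^sup>+y. ennreal (trans_density \<alpha> \<beta> x y) * (\<integral>\<^sup>+v. \<phi> (y, v) \<partial>gig_law ?p (2 * y) (2 * y)) \<partial>lborel)"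
  proof (intro nn_integral_cong)
    fix y :: real
    show "(\<integral>\<^sup>+v. \<phi> (y, v) * ennreal (marginal_weight \<alpha> \<beta> x y * gig_weight ?p (2 * y) (2 * y) v) \<partial>lborel) / ?K x =
        ennreal (trans_density \<alpha> \<beta> x y) * (\<integral>\<^sup>+v. \<phi> (y, v) \<partial>gig_law ?p (2 * y) (2 * y))"
    proof (cases "0 < y")
      case True
      have K: "0 < 2 * besselK ?p (2 * x)" "0 < 2 * besselK ?p (2 * y)"
        using x True by (auto intro: besselK_pos)
      have T: "0 \<le> trans_density \<alpha> \<beta> x y"
        using trans_density_nonneg x ab by simp
      have mw: "marginal_weight \<alpha> \<beta> x y = trans_density \<alpha> \<beta> x y / (2 * besselK ?p (2 * y)) * (2 * besselK ?p (2 * x))"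
        using marginal_weight_eq[OF x True, of \<alpha> \<beta>] K by (simp add: field_simps)
      have J0: "0 \<le> marginal_weight \<alpha> \<beta> x y"
        unfolding mw using T K by simp
      have "(\<integral>\<^sup>+v. \<phi> (y, v) * ennreal (marginal_weight \<alpha> \<beta> x y * gig_weight ?p (2 * y) (2 * y) v) \<partial>lborel) = ennreal (marginal_weight \<alpha> \<beta> x y) * ?G y"
        using J0 by (subst nn_integral_cmult[symmetric]) (auto simp: ennreal_mult' mult_ac)
      also have "\<dots> / ?K x = ennreal (marginal_weight \<alpha> \<beta> x y) / ?K x * ?G y"
        by (simp add: ennreal_divide_times ennreal_times_divide mult.commute)
      also have "ennreal (marginal_weight \<alpha> \<beta> x y) / ?K x = ennreal (trans_density \<alpha> \<beta> x y) / ?K y"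
        using marginal_weight_eq[OF x True, of \<alpha> \<beta>] K J0 T by (simp add: divide_ennreal)
      also have "ennreal (trans_density \<alpha> \<beta> x y) / ?K y * ?G y = ennreal (trans_density \<alpha> \<beta> x y) * (?G y / ?K y)"
        by (simp add: ennreal_divide_times ennreal_times_divide mult.commute)
      also have "?G y / ?K y = (\<integral>\<^sup>+v. \<phi> (y, v) \<partial>gig_law ?p (2 * y) (2 * y))"
        by (rule nn_integral_gig_law[OF True, symmetric]) measurable
      finally show ?thesis .
    qed (simp add: marginal_weight_def trans_density_def)
  qed
  also have "\<dots> = (\<integral>\<^sup>+y. \<integral>\<^sup>+v. \<phi> (y, v) \<partial>gig_law ?p (2 * y) (2 * y) \<partial>trans_kernel \<alpha> \<beta> x)"
    by (rule nn_integral_trans_kernel[symmetric]) measurable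
  finally show ?thesis .
qed

text \<open>The law of the pair at n = 1, where \<open>x = sqrt (a * b)\<close> and
  \<open>u = sqrt (a / b)\<close>, that is, a = x u and b = x / u. First b = a / u^2 replaces b by
  u, then a = u x replaces a by x.\<close>

lemma nn_integral_gamma_gamma:
  assumes ab: "0 < \<alpha>" "0 < \<beta>" and [measurable]: "\<phi> \<in> borel_measurable (borel \<Otimes>\<^sub>M borel)"
  shows "(\<integral>\<^sup>+a. \<integral>\<^sup>+b. \<phi> (sqrt (a * b), sqrt (a / b)) \<partial>gamma_law \<beta> \<partial>gamma_law \<alpha>) =
    (\<integral>\<^sup>+x. \<integral>\<^sup>+u. \<phi> (x, u) * ennreal (gig_weight (\<alpha> - \<beta>) (2 * x) (2 * x) u)
        * ennreal (indicator {0<..} x * (2 * x powr (\<alpha> + \<beta> - 1) / (Gamma \<alpha> * Gamma \<beta>))) \<partial>lborel \<partial>lborel)"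
proof -
  let ?E = "\<lambda>a u. gamma_density \<beta> (a / u\<^sup>2) * gamma_density \<alpha> a * (2 * a / u ^ 3)"
  have b: "(\<integral>\<^sup>+b. \<phi> (sqrt (a * b), sqrt (a / b)) * ennreal (gamma_density \<beta> b) \<partial>lborel) * ennreal (gamma_density \<alpha> a) =
      (\<integral>\<^sup>+u. \<phi> (a / u, u) * ennreal (?E a u) * indicator {0<..} u \<partial>lborel)" for a
  proof (cases "0 < a")
    case True
    let ?f = "\<lambda>b. \<phi> (sqrt (a * b), sqrt (a / b)) * ennreal (gamma_density \<beta> b)"
    have "(\<integral>\<^sup>+b. ?f b \<partial>lborel) = (\<integral>\<^sup>+b. ?f b * indicator {0<..} b \<partial>lborel)"
      by (intro nn_integral_cong) (auto simp: gamma_density_def split: split_indicator)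
    also have "\<dots> = (\<integral>\<^sup>+u. ennreal (2 * a / u ^ 3) * ?f (a / u\<^sup>2) * indicator {0<..} u \<partial>lborel)"
      by (rule nn_integral_substitution_inverse_square[OF True]) measurable
    finally have "(\<integral>\<^sup>+b. ?f b \<partial>lborel) * ennreal (gamma_density \<alpha> a) =
        (\<integral>\<^sup>+u. ennreal (2 * a / u ^ 3) * ?f (a / u\<^sup>2) * indicator {0<..} u \<partial>lborel) * ennreal (gamma_density \<alpha> a)"
      by (rule arg_cong)
    also have "\<dots> = (\<integral>\<^sup>+u. ennreal (2 * a / u ^ 3) * ?f (a / u\<^sup>2) * indicator {0<..} u * ennreal (gamma_density \<alpha> a) \<partial>lborel)"
      by (rule nn_integral_multc[symmetric]) measurable
    also have "\<dots> = (\<integral>\<^sup>+u. \<phi> (a / u, u) * ennreal (?E a u) * indicator {0<..} u \<partial>lborel)"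
    proof (intro nn_integral_cong)
      fix u :: real
      show "ennreal (2 * a / u ^ 3) * (\<phi> (sqrt (a * (a / u\<^sup>2)), sqrt (a / (a / u\<^sup>2))) *
          ennreal (gamma_density \<beta> (a / u\<^sup>2))) * indicator {0<..} u * ennreal (gamma_density \<alpha> a) =
        \<phi> (a / u, u) * ennreal (?E a u) * indicator {0<..} u"
      proof (cases "0 < u")
        case u: True
        have "a * (a / u\<^sup>2) = (a / u)\<^sup>2" "a / (a / u\<^sup>2) = u\<^sup>2"
          using True by (simp_all add: power2_eq_square)
        then have "sqrt (a * (a / u\<^sup>2)) = a / u" "sqrt (a / (a / u\<^sup>2)) = u"
          using True u by simp_all
        moreover have "ennreal (?E a u) = ennreal (2 * a / u ^ 3) * ennreal (gamma_density \<beta> (a / u\<^sup>2)) * ennreal (gamma_density \<alpha> a)"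
          using True u ab by (simp add: ennreal_mult'[symmetric] gamma_density_nonneg mult_ac)
        ultimately show ?thesis
          using u by (simp add: mult_ac)
      qed simp
    qed
    finally show ?thesis .
  next
    case False
    then have "gamma_density \<alpha> a = 0" by (simp add: gamma_density_def)
    then show ?thesis by simp
  qed
  have a: "(\<integral>\<^sup>+a. \<phi> (a / u, u) * ennreal (?E a u) * indicator {0<..} u \<partial>lborel) =
      (\<integral>\<^sup>+x. \<phi> (x, u) * ennreal (gig_weight (\<alpha> - \<beta>) (2 * x) (2 * x) u)
        * ennreal (indicator {0<..} x * (2 * x powr (\<alpha> + \<beta> - 1) / (Gamma \<alpha> * Gamma \<beta>))) \<partial>lborel)" for u
  proof (cases "0 < u")
    case u: True
    have "(\<integral>\<^sup>+a. \<phi> (a / u, u) * ennreal (?E a u) * indicator {0<..} u \<partial>lborel) =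
        ennreal u * (\<integral>\<^sup>+x. \<phi> ((0 + u * x) / u, u) * ennreal (?E (0 + u * x) u) * indicator {0<..} u \<partial>lborel)"
      using u by (subst nn_integral_real_affine[where c = u and t = 0]) auto
    also have "\<dots> = (\<integral>\<^sup>+x. ennreal u * (\<phi> ((0 + u * x) / u, u) * ennreal (?E (0 + u * x) u) * indicator {0<..} u) \<partial>lborel)"
      by (rule nn_integral_cmult[symmetric]) measurable
    also have "\<dots> = (\<integral>\<^sup>+x. \<phi> (x, u) * ennreal (gig_weight (\<alpha> - \<beta>) (2 * x) (2 * x) u)
        * ennreal (indicator {0<..} x * (2 * x powr (\<alpha> + \<beta> - 1) / (Gamma \<alpha> * Gamma \<beta>))) \<partial>lborel)"
    proof (intro nn_integral_cong)
      fix x :: real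
      have "u * ?E (u * x) u = gig_weight (\<alpha> - \<beta>) (2 * x) (2 * x) u *
          (indicator {0<..} x * (2 * x powr (\<alpha> + \<beta> - 1) / (Gamma \<alpha> * Gamma \<beta>)))"
      proof (cases "0 < x")
        case x: True
        define X U where "X = ln x" and "U = ln u"
        then have ln: "x = exp X" "u = exp U" using x u by simp_all
        have "u * x / u\<^sup>2 = x / u" "u * (2 * (u * x) / u ^ 3) = 2 * (x / u)"
          using u by (simp_all add: power2_eq_square power3_eq_cube)
        moreover have "(x / u) powr (\<beta> - 1) * (u * x) powr (\<alpha> - 1) * (x / u) = u powr (\<alpha> - \<beta> - 1) * x powr (\<alpha> + \<beta> - 1)"
          unfolding ln by (simp add: powr_def algebra_simps flip: exp_add exp_diff)
        moreover have "exp (- (x / u)) * exp (- (u * x)) = exp (- (x * (u + 1 / u)))"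
          by (simp add: exp_add[symmetric] algebra_simps)
        ultimately have *: "2 * ((x / u) powr (\<beta> - 1) * (u * x) powr (\<alpha> - 1) * (x / u)) * (exp (- (x / u)) * exp (- (u * x))) / (Gamma \<alpha> * Gamma \<beta>)
          = 2 * (u powr (\<alpha> - \<beta> - 1) * x powr (\<alpha> + \<beta> - 1)) * exp (- (x * (u + 1 / u))) / (Gamma \<alpha> * Gamma \<beta>)"
          by simp
        have "u * ?E (u * x) u = gamma_density \<beta> (u * x / u\<^sup>2) * gamma_density \<alpha> (u * x) * (u * (2 * (u * x) / u ^ 3))"
          by simp
        also have "\<dots> = 2 * ((x / u) powr (\<beta> - 1) * (u * x) powr (\<alpha> - 1) * (x / u)) * (exp (- (x / u)) * exp (- (u * x))) / (Gamma \<alpha> * Gamma \<beta>)"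
          unfolding \<open>u * x / u\<^sup>2 = x / u\<close> \<open>u * (2 * (u * x) / u ^ 3) = 2 * (x / u)\<close>
          using x u by (simp add: gamma_density_def mult_ac)
        finally show ?thesis
          unfolding * gig_weight_diag using x u by (simp add: mult_ac)
      next
        case False
        then have "gamma_density \<alpha> (u * x) = 0"
          using u by (simp add: gamma_density_def zero_less_mult_iff)
        then show ?thesis using False by simp
      qed
      then have "ennreal (u * ?E (u * x) u) = ennreal (gig_weight (\<alpha> - \<beta>) (2 * x) (2 * x) u *
          (indicator {0<..} x * (2 * x powr (\<alpha> + \<beta> - 1) / (Gamma \<alpha> * Gamma \<beta>))))"
        by (rule arg_cong)
      then have "ennreal u * ennreal (?E (u * x) u) = ennreal (gig_weight (\<alpha> - \<beta>) (2 * x) (2 * x) u) *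
          ennreal (indicator {0<..} x * (2 * x powr (\<alpha> + \<beta> - 1) / (Gamma \<alpha> * Gamma \<beta>)))"
        using u by (simp only: ennreal_mult' gig_weight_nonneg less_imp_le)
      note * = this
      have "ennreal u * (\<phi> (x, u) * ennreal (?E (u * x) u) * 1) = \<phi> (x, u) * (ennreal u * ennreal (?E (u * x) u))"
        by (simp only: mult_1_right mult.left_commute)
      also have "\<dots> = \<phi> (x, u) * (ennreal (gig_weight (\<alpha> - \<beta>) (2 * x) (2 * x) u) *
          ennreal (indicator {0<..} x * (2 * x powr (\<alpha> + \<beta> - 1) / (Gamma \<alpha> * Gamma \<beta>))))"
        unfolding * ..
      also have "\<dots> = \<phi> (x, u) * ennreal (gig_weight (\<alpha> - \<beta>) (2 * x) (2 * x) u) *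
          ennreal (indicator {0<..} x * (2 * x powr (\<alpha> + \<beta> - 1) / (Gamma \<alpha> * Gamma \<beta>)))"
        by (rule mult.assoc[symmetric])
      finally have "ennreal u * (\<phi> (x, u) * ennreal (?E (u * x) u) * 1) =
          \<phi> (x, u) * ennreal (gig_weight (\<alpha> - \<beta>) (2 * x) (2 * x) u) *
          ennreal (indicator {0<..} x * (2 * x powr (\<alpha> + \<beta> - 1) / (Gamma \<alpha> * Gamma \<beta>)))" .
      moreover have "(u * x) / u = x" "indicator {0<..} u = (1 :: ennreal)" using u by simp_all
      ultimately show "ennreal u * (\<phi> ((0 + u * x) / u, u) * ennreal (?E (0 + u * x) u) * indicator {0<..} u) =
          \<phi> (x, u) * ennreal (gig_weight (\<alpha> - \<beta>) (2 * x) (2 * x) u) *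
          ennreal (indicator {0<..} x * (2 * x powr (\<alpha> + \<beta> - 1) / (Gamma \<alpha> * Gamma \<beta>)))"
        by (simp only: add_0)
    qed
    finally show ?thesis .
  next
    case False
    then show ?thesis by (simp add: gig_weight_def)
  qed
  have "(\<integral>\<^sup>+a. \<integral>\<^sup>+b. \<phi> (sqrt (a * b), sqrt (a / b)) \<partial>gamma_law \<beta> \<partial>gamma_law \<alpha>) =
      (\<integral>\<^sup>+a. (\<integral>\<^sup>+b. \<phi> (sqrt (a * b), sqrt (a / b)) * ennreal (gamma_density \<beta> b) \<partial>lborel) * ennreal (gamma_density \<alpha> a) \<partial>lborel)"
    by (simp add: nn_integral_gamma_law)
  also have "\<dots> = (\<integral>\<^sup>+a. \<integral>\<^sup>+u. \<phi> (a / u, u) * ennreal (?E a u) * indicator {0<..} u \<partial>lborel \<partial>lborel)"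
    unfolding b ..
  also have "\<dots> = (\<integral>\<^sup>+u. \<integral>\<^sup>+a. \<phi> (a / u, u) * ennreal (?E a u) * indicator {0<..} u \<partial>lborel \<partial>lborel)"
    by (rule nn_integral_swap_lborel) measurable
  also have "\<dots> = (\<integral>\<^sup>+u. \<integral>\<^sup>+x. \<phi> (x, u) * ennreal (gig_weight (\<alpha> - \<beta>) (2 * x) (2 * x) u)
        * ennreal (indicator {0<..} x * (2 * x powr (\<alpha> + \<beta> - 1) / (Gamma \<alpha> * Gamma \<beta>))) \<partial>lborel \<partial>lborel)"
    unfolding a ..
  also have "\<dots> = (\<integral>\<^sup>+x. \<integral>\<^sup>+u. \<phi> (x, u) * ennreal (gig_weight (\<alpha> - \<beta>) (2 * x) (2 * x) u)
        * ennreal (indicator {0<..} x * (2 * x powr (\<alpha> + \<beta> - 1) / (Gamma \<alpha> * Gamma \<beta>))) \<partial>lborel \<partial>lborel)"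
    by (rule nn_integral_swap_lborel) measurable
  finally show ?thesis .
qed

lemma nn_integral_gig_weight_eq:
  assumes "0 < x" and [measurable]: "f \<in> borel_measurable borel"
  shows "(\<integral>\<^sup>+u. f u * ennreal (gig_weight p (2 * x) (2 * x) u) \<partial>lborel) =
    (\<integral>\<^sup>+u. f u \<partial>gig_law p (2 * x) (2 * x)) * ennreal (2 * besselK p (2 * x))"
  using besselK_pos[OF assms(1), of p] unfolding nn_integral_gig_law[OF assms]
  by (simp add: ennreal_divide_times ennreal_divide_self)

text \<open>By \<open>nn_integral_gamma_gamma\<close> the joint density is a function of x times the
  generalized inverse Gaussian weight of u, so averaging \<phi> over that law in u does not change
  the integral.\<close>

lemma gamma_gamma_conditional:
  assumes ab: "0 < \<alpha>" "0 < \<beta>" and [measurable]: "\<phi> \<in> borel_measurable (borel \<Otimes>\<^sub>M borel)"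
  shows "(\<integral>\<^sup>+a. \<integral>\<^sup>+b. \<phi> (sqrt (a * b), sqrt (a / b)) \<partial>gamma_law \<beta> \<partial>gamma_law \<alpha>) =
    (\<integral>\<^sup>+a. \<integral>\<^sup>+b. (\<integral>\<^sup>+v. \<phi> (sqrt (a * b), v) \<partial>gig_law (\<alpha> - \<beta>) (2 * sqrt (a * b)) (2 * sqrt (a * b)))
       \<partial>gamma_law \<beta> \<partial>gamma_law \<alpha>)" (is "?lhs = ?rhs")
proof -
  let ?p = "\<alpha> - \<beta>"
  let ?c = "\<lambda>x. ennreal (indicator {0<..} x * (2 * x powr (\<alpha> + \<beta> - 1) / (Gamma \<alpha> * Gamma \<beta>)))"
  let ?\<psi> = "\<lambda>x. \<integral>\<^sup>+v. \<phi> (x, v) \<partial>gig_law ?p (2 * x) (2 * x)"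
  have "?lhs = (\<integral>\<^sup>+x. \<integral>\<^sup>+u. \<phi> (x, u) * ennreal (gig_weight ?p (2 * x) (2 * x) u) * ?c x \<partial>lborel \<partial>lborel)"
    by (rule nn_integral_gamma_gamma) fact+
  also have "\<dots> = (\<integral>\<^sup>+x. \<integral>\<^sup>+u. ?\<psi> x * ennreal (gig_weight ?p (2 * x) (2 * x) u) * ?c x \<partial>lborel \<partial>lborel)"
  proof (rule nn_integral_cong)
    fix x :: real
    show "(\<integral>\<^sup>+u. \<phi> (x, u) * ennreal (gig_weight ?p (2 * x) (2 * x) u) * ?c x \<partial>lborel) =
        (\<integral>\<^sup>+u. ?\<psi> x * ennreal (gig_weight ?p (2 * x) (2 * x) u) * ?c x \<partial>lborel)"
    proof (cases "0 < x")
      case True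
      have "(\<integral>\<^sup>+u. \<phi> (x, u) * ennreal (gig_weight ?p (2 * x) (2 * x) u) * ?c x \<partial>lborel) =
          ?\<psi> x * ennreal (2 * besselK ?p (2 * x)) * ?c x"
        by (subst nn_integral_multc, measurable, subst nn_integral_gig_weight_eq[OF True]) simp_all
      also have "\<dots> = (\<integral>\<^sup>+u. ?\<psi> x * ennreal (gig_weight ?p (2 * x) (2 * x) u) * ?c x \<partial>lborel)"
        by (subst nn_integral_multc, measurable, subst nn_integral_cmult, measurable)
           (simp only: nn_integral_gig_weight[OF True])
      finally show ?thesis .
    qed simp
  qed
  also have "\<dots> = ?rhs"
  proof -
    \<comment> \<open>The average is again a function of the pair, constant in u, so the same
      formula leads back to a and b.\<close>
    have "(\<lambda>(x, u). ?\<psi> x) \<in> borel_measurable (borel \<Otimes>\<^sub>M borel)"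
      by measurable
    from nn_integral_gamma_gamma[OF ab this] show ?thesis
      by (simp only: prod.case)
  qed
  finally show ?thesis .
qed

lemma AE_trans_kernel_pos: "AE y in trans_kernel \<alpha> \<beta> x. 0 < y"
  unfolding trans_kernel_def by (subst AE_density) (auto simp: trans_density_def)

lemma sets_laws [simp, measurable_cong]:
  "sets (trans_kernel \<alpha> \<beta> x) = sets borel" "sets (gig_law p a b) = sets borel"
  "sets (gamma_law s) = sets borel"
  by (simp_all add: trans_kernel_def gig_law_def gamma_law_def)

lemma nn_integral_gig_law_const:
  "0 < y \<Longrightarrow> (\<integral>\<^sup>+v. c \<partial>gig_law p (2 * y) (2 * y)) = c"
  using prob_space.emeasure_space_1[OF prob_space_gig_law] by simp

text \<open>Total mass one is the intertwining relation tested on the constant 1, which avoids a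
  direct integration of the Bessel functions in y.\<close>

lemma prob_space_trans_kernel:
  assumes "0 < \<alpha>" "0 < \<beta>" "0 < x"
  shows "prob_space (trans_kernel \<alpha> \<beta> x)"
proof (rule prob_spaceI)
  have "emeasure (trans_kernel \<alpha> \<beta> x) (space (trans_kernel \<alpha> \<beta> x)) = (\<integral>\<^sup>+y. 1 \<partial>trans_kernel \<alpha> \<beta> x)"
    by simp
  also have "\<dots> = (\<integral>\<^sup>+y. \<integral>\<^sup>+v. 1 \<partial>gig_law (\<alpha> - \<beta>) (2 * y) (2 * y) \<partial>trans_kernel \<alpha> \<beta> x)"
  proof (rule nn_integral_cong_AE)
    show "AE y in trans_kernel \<alpha> \<beta> x. 1 = (\<integral>\<^sup>+v. 1 \<partial>gig_law (\<alpha> - \<beta>) (2 * y) (2 * y))"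
      using AE_trans_kernel_pos by eventually_elim (rule nn_integral_gig_law_const[symmetric])
  qed
  also have "\<dots> = (\<integral>\<^sup>+u. \<integral>\<^sup>+a. \<integral>\<^sup>+b. 1 \<partial>gamma_law \<beta> \<partial>gamma_law \<alpha> \<partial>gig_law (\<alpha> - \<beta>) (2 * x) (2 * x))"
    using assms gig_gamma_intertwining[of x \<alpha> \<beta> "\<lambda>_. 1"] by simp
  also have "\<dots> = 1"
    using prob_space.emeasure_space_1[OF prob_space_gamma_law] prob_space.emeasure_space_1[OF prob_space_gig_law] assms
    by simp
  finally show "emeasure (trans_kernel \<alpha> \<beta> x) (space (trans_kernel \<alpha> \<beta> x)) = 1" .
qed

lemma markov_kernel_on_trans_kernel:
  assumes "0 < \<alpha>" "0 < \<beta>"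
  shows "markov_kernel_on {0<..} (trans_kernel \<alpha> \<beta>)"
  unfolding markov_kernel_on_def
proof (intro conjI ballI)
  show "trans_kernel \<alpha> \<beta> \<in> restrict_space borel {0<..} \<rightarrow>\<^sub>M prob_algebra borel"
  proof (intro measurable_prob_algebraI measurable_subprob_algebra)
    fix A :: "real set" assume [measurable]: "A \<in> sets borel"
    have "emeasure (trans_kernel \<alpha> \<beta> x) A = (\<integral>\<^sup>+y. indicator A y \<partial>trans_kernel \<alpha> \<beta> x)" for x
      by simp
    moreover have "(\<lambda>x. \<integral>\<^sup>+y. indicator A y \<partial>trans_kernel \<alpha> \<beta> x) \<in> borel_measurable borel"
      by measurable
    ultimately show "(\<lambda>x. emeasure (trans_kernel \<alpha> \<beta> x) A) \<in> borel_measurable (restrict_space borel {0<..})"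
      by (intro measurable_restrict_space1) simp
  qed (use assms in \<open>auto simp: space_restrict_space prob_space_trans_kernel intro!: prob_space_imp_subprob_space\<close>)
  show "AE y in trans_kernel \<alpha> \<beta> x. y \<in> {0<..}" for x
    using AE_trans_kernel_pos by simp
qed

section \<open>The random environment\<close>

lemma edges_mono: "m \<le> n \<Longrightarrow> edges m \<subseteq> edges n"
  by (auto simp: edges_def)

text \<open>The space N is arbitrary and only edge weights are measurable functions on it, because
  the lemma serves both M and the product space indexed by \<open>edges n\<close>.\<close>

lemma measurable_Gam_expS:
  assumes "1 \<le> n" and w: "\<And>i j. (i, j) \<in> edges n \<Longrightarrow> (\<lambda>z. w z i j) \<in> borel_measurable N"
  shows "(\<lambda>z. Gam n (w z)) \<in> borel_measurable N" "(\<lambda>z. expS n (w z)) \<in> borel_measurable N"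
proof -
  have e: "(i, Suc i) \<in> edges n" "(Suc i, i) \<in> edges n" if "i < n" for i
    using that by (auto simp: edges_def)
  have rho: "(\<lambda>z. rho (w z) k) \<in> borel_measurable N" if "k < n" for k
    unfolding rho_def
  proof (intro borel_measurable_prod borel_measurable_divide w)
    fix i assume i: "i \<in> {1..k}"
    then show "(i, Suc i) \<in> edges n"
      using that by (intro e) simp
    show "(i, i - 1) \<in> edges n"
      using i that e(2)[of "i - 1"] by (cases i) auto
  qed
  have R: "(\<lambda>z. resist n (w z)) \<in> borel_measurable N"
    unfolding resist_def by (intro borel_measurable_sum rho) simp
  have r: "(\<lambda>z. rho (w z) (n - 1)) \<in> borel_measurable N"
    using assms(1) by (intro rho) simp
  have w0: "(\<lambda>z. w z 0 1) \<in> borel_measurable N"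
    using assms(1) e(1)[of 0] by (intro w) simp
  have wn: "(\<lambda>z. w z n (n - 1)) \<in> borel_measurable N"
    using assms(1) e(2)[of "n - 1"] by (intro w) simp
  have p: "Measurable.pred N (\<lambda>z. pos_env n (w z))"
  proof -
    have "Measurable.pred N (\<lambda>z. \<forall>i\<in>{..<n}. 0 < w z i (Suc i) \<and> 0 < w z (Suc i) i)"
    proof (intro pred_intros_finite pred_intros_logic)
      fix i assume "i \<in> {..<n}"
      then have [measurable]: "(\<lambda>z. w z i (Suc i)) \<in> borel_measurable N" "(\<lambda>z. w z (Suc i) i) \<in> borel_measurable N"
        by (auto intro!: w e)
      show "Measurable.pred N (\<lambda>z. 0 < w z i (Suc i))" "Measurable.pred N (\<lambda>z. 0 < w z (Suc i) i)"
        by measurable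
    qed simp
    then show ?thesis
      unfolding pos_env_def Ball_def lessThan_iff .
  qed
  have cL: "(\<lambda>z. condL n (w z)) \<in> borel_measurable N"
    unfolding condL_def by (rule borel_measurable_divide[OF w0 R])
  have cR: "(\<lambda>z. condR n (w z)) \<in> borel_measurable N"
    unfolding condR_def by (rule borel_measurable_divide[OF borel_measurable_times[OF wn r] R])
  show "(\<lambda>z. Gam n (w z)) \<in> borel_measurable N"
    unfolding Gam_eq[OF assms(1)]
    by (rule measurable_If[OF measurable_compose[OF borel_measurable_times[OF cL cR] borel_measurable_sqrt]
          borel_measurable_const p[unfolded pred_def]])
  show "(\<lambda>z. expS n (w z)) \<in> borel_measurable N"
    unfolding expS_eq[OF assms(1)]
    by (rule measurable_If[OF measurable_compose[OF borel_measurable_divide[OF cL cR] borel_measurable_sqrt]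
          borel_measurable_const p[unfolded pred_def]])
qed

text \<open>Allows \<Gamma> and e^S to be evaluated on the weights restricted to
  \<open>edges n\<close>, a block of the family independent of the next two weights.\<close>

lemma Gam_expS_cong:
  assumes "1 \<le> n" and w: "\<And>i j. (i, j) \<in> edges n \<Longrightarrow> w i j = w' i j"
  shows "Gam n w = Gam n w'" "expS n w = expS n w'"
proof -
  have e: "w i (Suc i) = w' i (Suc i)" "w (Suc i) i = w' (Suc i) i" if "i < n" for i
    using that by (auto simp: edges_def intro!: w)
  have rho: "rho w k = rho w' k" if "k < n" for k
    unfolding rho_def
  proof (intro prod.cong refl)
    fix i assume "i \<in> {1..k}"
    then show "w i (i - 1) / w i (Suc i) = w' i (i - 1) / w' i (Suc i)"
      using that e[of i] e[of "i - 1"] by (cases i) auto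
  qed
  have "resist n w = resist n w'"
    unfolding resist_def by (intro sum.cong rho) auto
  moreover have "pos_env n w = pos_env n w'"
    using e by (auto simp: pos_env_def)
  moreover have "w 0 1 = w' 0 1" "w n (n - 1) = w' n (n - 1)"
    using assms(1) e(1)[of 0] e(2)[of "n - 1"] by auto
  ultimately show "Gam n w = Gam n w'" "expS n w = expS n w'"
    using rho[of "n - 1"] assms(1) by (simp_all add: Gam_eq expS_eq condL_def condR_def)
qed

lemma Gam_expS_1:
  assumes "pos_env 1 w"
  shows "Gam 1 w = sqrt (w 0 1 * w 1 0)" "expS 1 w = sqrt (w 0 1 / w 1 0)"
  using assms by (simp_all add: Gam_eq expS_eq condL_def condR_def resist_def rho_def)

lemma Gam_pos:
  assumes "1 \<le> n" "pos_env n w"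
  shows "0 < Gam n w"
  using assms condL_pos[OF assms] condR_pos[OF assms] by (simp add: Gam_eq)

text \<open>In the recursion for A and B, the denominator a + B cancels from A' / B', so e^S merely
  picks up the factor sqrt(a / b). The product A' B' keeps it, and there B is recovered as \<Gamma>
  / e^S, which closes the recursion in the pair.\<close>

lemma Gam_expS_Suc:
  assumes "1 \<le> n" "pos_env (Suc n) w"
  defines "a \<equiv> w n (Suc n)" and "b \<equiv> w (Suc n) n"
  shows "Gam (Suc n) w = Gam n w * sqrt (a * b) / (a + Gam n w / expS n w)"
    and "expS (Suc n) w = expS n w * sqrt (a / b)"
proof -
  have pos: "pos_env n w" and a: "0 < a" and b: "0 < b"
    using assms(2) by (auto simp: pos_env_def a_def b_def)
  define A B where "A = condL n w" and "B = condR n w"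
  have A: "0 < A" and B: "0 < B"
    using condL_pos condR_pos assms(1) pos by (auto simp: A_def B_def)
  have G: "Gam n w = sqrt (A * B)" and S: "expS n w = sqrt (A / B)"
    using assms(1) pos by (simp_all add: Gam_eq expS_eq A_def B_def)
  have q: "Gam n w / expS n w = B"
    unfolding G S using A B by (simp add: real_sqrt_mult real_sqrt_divide)
  have aB: "0 < a + B" using a B by simp
  have A': "condL (Suc n) w = A * a / (a + B)" and B': "condR (Suc n) w = B * b / (a + B)"
    unfolding A_def B_def a_def b_def by (rule cond_Suc[OF assms(1,2)])+
  have "condL (Suc n) w * condR (Suc n) w = (A * B) * (a * b) / (a + B)\<^sup>2"
    unfolding A' B' by (simp add: power2_eq_square mult_ac)
  then show "Gam (Suc n) w = Gam n w * sqrt (a * b) / (a + Gam n w / expS n w)"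
    unfolding q unfolding G using assms(2) aB by (simp add: Gam_eq real_sqrt_mult real_sqrt_divide)
  have "condL (Suc n) w / condR (Suc n) w = (A / B) * (a / b)"
    unfolding A' B' using aB by simp
  moreover have "expS (Suc n) w = sqrt (condL (Suc n) w / condR (Suc n) w)"
    using assms(2) by (simp add: expS_eq)
  ultimately show "expS (Suc n) w = expS n w * sqrt (a / b)"
    unfolding S by (simp only: real_sqrt_mult)
qed

text \<open>\<open>indep_var\<close> forces \<open>X\<close> and \<open>Y\<close> to have values in the same type; \<open>f\<close> and \<open>g\<close> lift this restriction.\<close>

lemma (in prob_space) nn_integral_indep_var:
  assumes ind: "indep_var P X Q Y" and f [measurable]: "f \<in> P \<rightarrow>\<^sub>M S" and g [measurable]: "g \<in> Q \<rightarrow>\<^sub>M T"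
    and G [measurable]: "G \<in> borel_measurable (S \<Otimes>\<^sub>M T)"
  shows "(\<integral>\<^sup>+\<omega>. G (f (X \<omega>), g (Y \<omega>)) \<partial>M) = (\<integral>\<^sup>+\<omega>. \<integral>\<^sup>+\<omega>'. G (f (X \<omega>), g (Y \<omega>')) \<partial>M \<partial>M)"
proof -
  have X [measurable]: "X \<in> M \<rightarrow>\<^sub>M P" and Y [measurable]: "Y \<in> M \<rightarrow>\<^sub>M Q"
    and joint: "distr M P X \<Otimes>\<^sub>M distr M Q Y = distr M (P \<Otimes>\<^sub>M Q) (\<lambda>\<omega>. (X \<omega>, Y \<omega>))"
    using ind unfolding indep_var_distribution_eq by auto
  interpret Y: prob_space "distr M Q Y"
    by (rule prob_space_distr) (rule Y)
  define F where "F z = G (f (fst z), g (snd z))" for z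
  have F [measurable]: "F \<in> borel_measurable (P \<Otimes>\<^sub>M Q)"
    unfolding F_def by measurable
  have "(\<integral>\<^sup>+\<omega>. F (X \<omega>, Y \<omega>) \<partial>M) = (\<integral>\<^sup>+z. F z \<partial>distr M (P \<Otimes>\<^sub>M Q) (\<lambda>\<omega>. (X \<omega>, Y \<omega>)))"
    by (subst nn_integral_distr) simp_all
  also have "\<dots> = (\<integral>\<^sup>+x. \<integral>\<^sup>+y. F (x, y) \<partial>distr M Q Y \<partial>distr M P X)"
    unfolding joint[symmetric] by (subst Y.nn_integral_fst[symmetric]) simp_all
  also have "\<dots> = (\<integral>\<^sup>+\<omega>. \<integral>\<^sup>+y. F (X \<omega>, y) \<partial>distr M Q Y \<partial>M)"
    by (subst nn_integral_distr) simp_all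
  also have "\<dots> = (\<integral>\<^sup>+\<omega>. \<integral>\<^sup>+\<omega>'. F (X \<omega>, Y \<omega>') \<partial>M \<partial>M)"
    using measurable_space[OF X] by (intro nn_integral_cong nn_integral_distr) simp_all
  finally show ?thesis
    by (simp add: F_def)
qed

section \<open>Independence of the past and the new weights\<close>

locale random_environment = prob_space M for M :: "'a measure" +
  fixes W :: "nat \<Rightarrow> nat \<Rightarrow> 'a \<Rightarrow> real" and \<alpha> \<beta> :: real
  assumes \<alpha>: "0 < \<alpha>" and \<beta>: "0 < \<beta>"
    and indep: "indep_vars (\<lambda>_. borel) (\<lambda>(i, j). W i j) {(i, j). j = Suc i \<or> i = Suc j}"
    and forward: "\<And>i. distributed M lborel (W i (Suc i)) (\<lambda>x. ennreal (gamma_density \<alpha> x))"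
    and backward: "\<And>i. distributed M lborel (W (Suc i) i) (\<lambda>x. ennreal (gamma_density \<beta> x))"
begin

abbreviation "wt \<omega> \<equiv> (\<lambda>i j. W i j \<omega>)"
abbreviation "\<Gamma> n \<omega> \<equiv> Gam n (wt \<omega>)"
abbreviation "eS n \<omega> \<equiv> expS n (wt \<omega>)"
abbreviation "gig y \<equiv> gig_law (\<alpha> - \<beta>) (2 * y) (2 * y)"

text \<open>Sets of the filtration at time n are preimages under this vector
  (\<open>sets_F_hist\<close>), so conditioning becomes a matter of integrals of functions of
  \<open>hist n\<close>.\<close>

definition hist :: "nat \<Rightarrow> 'a \<Rightarrow> nat \<Rightarrow> real" where
  "hist n \<omega> = (\<lambda>k\<in>{1..n}. \<Gamma> k \<omega>)"

lemma W_measurable: "(i, j) \<in> edges n \<Longrightarrow> W i j \<in> borel_measurable M"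
  using forward backward by (auto simp: edges_def distributed_def)

lemma W_measurable' [measurable]: "W i (Suc i) \<in> borel_measurable M" "W (Suc i) i \<in> borel_measurable M"
  using forward backward by (auto simp: distributed_def)

lemma \<Gamma>_eS_measurable [measurable]:
  assumes "1 \<le> n"
  shows "\<Gamma> n \<in> borel_measurable M" "eS n \<in> borel_measurable M"
  using measurable_Gam_expS[OF assms, of wt M] W_measurable by auto

lemma hist_measurable [measurable]: "hist n \<in> M \<rightarrow>\<^sub>M (\<Pi>\<^sub>M k\<in>{1..n}. borel)"
  unfolding hist_def by (intro measurable_restrict \<Gamma>_eS_measurable) simp

lemma distr_W: "distr M borel (W i (Suc i)) = gamma_law \<alpha>" "distr M borel (W (Suc i) i) = gamma_law \<beta>"
  using forward[of i] backward[of i] by (auto simp: distributed_def gamma_law_def cong: distr_cong)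

lemma AE_pos_env: "AE \<omega> in M. pos_env n (wt \<omega>)"
proof -
  have *: "AE x in gamma_law s. 0 < x" for s
    unfolding gamma_law_def by (subst AE_density) (auto simp: gamma_density_def)
  have "AE \<omega> in M. 0 < W i (Suc i) \<omega>" "AE \<omega> in M. 0 < W (Suc i) i \<omega>" for i
    using *[of \<alpha>] *[of \<beta>] unfolding distr_W[of i, symmetric] by (auto dest!: AE_distrD[rotated])
  then have "AE \<omega> in M. \<forall>i. 0 < W i (Suc i) \<omega> \<and> 0 < W (Suc i) i \<omega>"
    by (simp add: AE_all_countable)
  then show ?thesis
    by eventually_elim (simp add: pos_env_def)
qed

lemma indep_new_weights: "indep_var borel (W n (Suc n)) borel (W (Suc n) n)"
proof -
  have "indep_var (PiM {(n, Suc n)} (\<lambda>_. borel)) (\<lambda>\<omega>. restrict (\<lambda>e. (case e of (i, j) \<Rightarrow> W i j) \<omega>) {(n, Suc n)})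
      (PiM {(Suc n, n)} (\<lambda>_. borel)) (\<lambda>\<omega>. restrict (\<lambda>e. (case e of (i, j) \<Rightarrow> W i j) \<omega>) {(Suc n, n)})"
    by (rule indep_var_restrict[OF indep]) auto
  from indep_var_compose[OF this, of "\<lambda>z. z (n, Suc n)" borel "\<lambda>z. z (Suc n, n)" borel]
  show ?thesis
    by (simp add: comp_def)
qed

lemma distr_new_weights:
  "distr M (borel \<Otimes>\<^sub>M borel) (\<lambda>\<omega>. (W n (Suc n) \<omega>, W (Suc n) n \<omega>)) = gamma_law \<alpha> \<Otimes>\<^sub>M gamma_law \<beta>"
  using indep_new_weights[of n] unfolding indep_var_distribution_eq by (simp add: distr_W)

lemma nn_integral_new_weights:
  assumes [measurable]: "f \<in> borel_measurable (borel \<Otimes>\<^sub>M borel)"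
  shows "(\<integral>\<^sup>+z. f z \<partial>(gamma_law \<alpha> \<Otimes>\<^sub>M gamma_law \<beta>)) = (\<integral>\<^sup>+a. \<integral>\<^sup>+b. f (a, b) \<partial>gamma_law \<beta> \<partial>gamma_law \<alpha>)"
proof -
  interpret b: prob_space "gamma_law \<beta>" by (rule prob_space_gamma_law[OF \<beta>])
  show ?thesis
    by (intro b.nn_integral_fst[symmetric]) measurable
qed

text \<open>The edges up to n and the two edges between n and n + 1 are disjoint blocks of the
  independent family, and the past is a function of the first block. Here \<open>curry\<close> reads
  a family indexed by edges as a matrix of weights.\<close>

lemma nn_integral_past_new_weights:
  assumes "1 \<le> n" and [measurable]: "G \<in> borel_measurable (((\<Pi>\<^sub>M k\<in>{1..n}. borel) \<Otimes>\<^sub>M borel) \<Otimes>\<^sub>M (borel \<Otimes>\<^sub>M borel))"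
  shows "(\<integral>\<^sup>+\<omega>. G ((hist n \<omega>, eS n \<omega>), (W n (Suc n) \<omega>, W (Suc n) n \<omega>)) \<partial>M) =
    (\<integral>\<^sup>+\<omega>. \<integral>\<^sup>+a. \<integral>\<^sup>+b. G ((hist n \<omega>, eS n \<omega>), (a, b)) \<partial>gamma_law \<beta> \<partial>gamma_law \<alpha> \<partial>M)"
proof -
  let ?B = "{(n, Suc n), (Suc n, n)}"
  let ?X = "\<lambda>E \<omega>. restrict (\<lambda>e. (case e of (i, j) \<Rightarrow> W i j) \<omega>) E"
  let ?Y = "\<lambda>z. (\<lambda>k\<in>{1..n}. Gam k (curry z), expS n (curry z))"
  let ?Z = "\<lambda>z. (z (n, Suc n), z (Suc n, n))"
  let ?P = "PiM (edges n) (\<lambda>_. borel :: real measure)" and ?Q = "PiM ?B (\<lambda>_. borel :: real measure)"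
  have ind: "indep_var ?P (?X (edges n)) ?Q (?X ?B)"
    by (rule indep_var_restrict[OF indep]) (auto simp: edges_def)
  have c: "(\<lambda>z. curry z i j) \<in> borel_measurable ?P" if "(i, j) \<in> edges k" "k \<le> n" for i j k
    using that edges_mono[of k n] by (auto simp: curry_def intro!: measurable_component_singleton)
  have Y [measurable]: "?Y \<in> ?P \<rightarrow>\<^sub>M (\<Pi>\<^sub>M k\<in>{1..n}. borel) \<Otimes>\<^sub>M (borel :: real measure)"
  proof (intro measurable_Pair measurable_restrict)
    show "(\<lambda>z. Gam k (curry z)) \<in> borel_measurable ?P" if "k \<in> {1..n}" for k
      using that by (intro measurable_Gam_expS(1) c[of _ _ k]) auto
    show "(\<lambda>z. expS n (curry z)) \<in> borel_measurable ?P"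
      using assms(1) by (intro measurable_Gam_expS(2) c[of _ _ n]) auto
  qed
  have Z [measurable]: "?Z \<in> ?Q \<rightarrow>\<^sub>M borel \<Otimes>\<^sub>M borel"
    by measurable
  have YX: "?Y (?X (edges n) \<omega>) = (hist n \<omega>, eS n \<omega>)" for \<omega>
  proof -
    have "curry (?X (edges n) \<omega>) i j = W i j \<omega>" if "(i, j) \<in> edges k" "k \<le> n" for i j k
      using that edges_mono[of k n] by auto
    then have "Gam k (curry (?X (edges n) \<omega>)) = \<Gamma> k \<omega>" "expS k (curry (?X (edges n) \<omega>)) = eS k \<omega>" if "1 \<le> k" "k \<le> n" for k
      using that by (intro Gam_expS_cong; blast)+
    then show ?thesis
      using assms(1) by (auto simp: hist_def intro!: restrict_ext)
  qed
  have ZX: "?Z (?X ?B \<omega>) = (W n (Suc n) \<omega>, W (Suc n) n \<omega>)" for \<omega>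
    by simp
  have "(\<integral>\<^sup>+\<omega>. G ((hist n \<omega>, eS n \<omega>), (W n (Suc n) \<omega>, W (Suc n) n \<omega>)) \<partial>M) =
     (\<integral>\<^sup>+\<omega>. \<integral>\<^sup>+\<omega>'. G ((hist n \<omega>, eS n \<omega>), (W n (Suc n) \<omega>', W (Suc n) n \<omega>')) \<partial>M \<partial>M)"
    using nn_integral_indep_var[OF ind Y Z assms(2)] unfolding YX ZX .
  also have "\<dots> = (\<integral>\<^sup>+\<omega>. \<integral>\<^sup>+a. \<integral>\<^sup>+b. G ((hist n \<omega>, eS n \<omega>), (a, b)) \<partial>gamma_law \<beta> \<partial>gamma_law \<alpha> \<partial>M)"
  proof (rule nn_integral_cong)
    fix \<omega> assume "\<omega> \<in> space M"
    then have "(hist n \<omega>, eS n \<omega>) \<in> space ((\<Pi>\<^sub>M k\<in>{1..n}. borel) \<Otimes>\<^sub>M borel)"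
      by (auto simp: space_pair_measure space_PiM hist_def)
    then have G [measurable]: "(\<lambda>z. G ((hist n \<omega>, eS n \<omega>), z)) \<in> borel_measurable (borel \<Otimes>\<^sub>M borel)"
      by simp
    have "(\<integral>\<^sup>+\<omega>'. G ((hist n \<omega>, eS n \<omega>), (W n (Suc n) \<omega>', W (Suc n) n \<omega>')) \<partial>M) =
        (\<integral>\<^sup>+z. G ((hist n \<omega>, eS n \<omega>), z) \<partial>distr M (borel \<Otimes>\<^sub>M borel) (\<lambda>\<omega>. (W n (Suc n) \<omega>, W (Suc n) n \<omega>)))"
      using G by (subst nn_integral_distr) simp_all
    also have "\<dots> = (\<integral>\<^sup>+a. \<integral>\<^sup>+b. G ((hist n \<omega>, eS n \<omega>), (a, b)) \<partial>gamma_law \<beta> \<partial>gamma_law \<alpha>)"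
      unfolding distr_new_weights by (rule nn_integral_new_weights[OF G])
    finally show "(\<integral>\<^sup>+\<omega>'. G ((hist n \<omega>, eS n \<omega>), (W n (Suc n) \<omega>', W (Suc n) n \<omega>')) \<partial>M) =
      (\<integral>\<^sup>+a. \<integral>\<^sup>+b. G ((hist n \<omega>, eS n \<omega>), (a, b)) \<partial>gamma_law \<beta> \<partial>gamma_law \<alpha>)" .
  qed
  finally show ?thesis .
qed

end

text \<open>Reduces a conditional law to an identity of nonnegative integrals. The kernel is a
  probability law only almost surely: where some weight up to n is not positive, \<Gamma>_n is 0 and
  the laws attached to it need not have mass one.\<close>

lemma has_cond_lawI:
  assumes "prob_space M" and sub: "subalgebra M G" and Y [measurable]: "Y \<in> borel_measurable M"
    and prob: "AE \<omega> in M. prob_space (\<kappa> \<omega>)"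
    and meas: "\<And>A. A \<in> sets borel \<Longrightarrow> (\<lambda>\<omega>. emeasure (\<kappa> \<omega>) A) \<in> borel_measurable G"
    and eq: "\<And>A B. A \<in> sets borel \<Longrightarrow> B \<in> sets G \<Longrightarrow>
      (\<integral>\<^sup>+\<omega>. indicator B \<omega> * indicator A (Y \<omega>) \<partial>M) = (\<integral>\<^sup>+\<omega>. indicator B \<omega> * emeasure (\<kappa> \<omega>) A \<partial>M)"
  shows "has_cond_law M G Y \<kappa>"
  unfolding has_cond_law_def
proof (intro conjI ballI sub Y)
  fix A :: "real set" assume A [measurable]: "A \<in> sets borel"
  interpret prob_space M by fact
  interpret finite_measure_subalgebra M G
    by unfold_locales (rule sub)
  have mG: "(\<lambda>\<omega>. measure (\<kappa> \<omega>) A) \<in> borel_measurable G"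
    unfolding measure_def using meas[OF A] by measurable
  then have mM [measurable]: "(\<lambda>\<omega>. measure (\<kappa> \<omega>) A) \<in> borel_measurable M"
    using measurable_from_subalg[OF sub] by blast
  have le: "AE \<omega> in M. measure (\<kappa> \<omega>) A \<le> 1"
    using prob by eventually_elim (rule prob_space.prob_le_1)
  show "AE \<omega> in M. real_cond_exp M G (\<lambda>\<omega>. indicator A (Y \<omega>)) \<omega> = measure (\<kappa> \<omega>) A"
  proof (rule real_cond_exp_charact)
    fix B assume B: "B \<in> sets G"
    then have [measurable]: "B \<in> sets M" using sub by (auto simp: subalgebra_def)
    have "(\<integral>\<omega>. indicator B \<omega> *\<^sub>R indicat_real A (Y \<omega>) \<partial>M) =
        enn2real (\<integral>\<^sup>+\<omega>. ennreal (indicator B \<omega> *\<^sub>R indicator A (Y \<omega>)) \<partial>M)"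
      by (rule integral_eq_nn_integral) auto
    also have "(\<integral>\<^sup>+\<omega>. ennreal (indicator B \<omega> *\<^sub>R indicator A (Y \<omega>)) \<partial>M) = (\<integral>\<^sup>+\<omega>. indicator B \<omega> * indicator A (Y \<omega>) \<partial>M)"
      by (intro nn_integral_cong) (auto split: split_indicator)
    also have "\<dots> = (\<integral>\<^sup>+\<omega>. indicator B \<omega> * emeasure (\<kappa> \<omega>) A \<partial>M)"
      by (rule eq[OF A B])
    also have "\<dots> = (\<integral>\<^sup>+\<omega>. ennreal (indicator B \<omega> *\<^sub>R measure (\<kappa> \<omega>) A) \<partial>M)"
      by (rule nn_integral_cong_AE, use prob in eventually_elim)
         (auto simp: finite_measure.emeasure_eq_measure[OF prob_space.finite_measure] split: split_indicator)
    also have "enn2real \<dots> = (\<integral>\<omega>. indicator B \<omega> *\<^sub>R measure (\<kappa> \<omega>) A \<partial>M)"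
      by (rule integral_eq_nn_integral[symmetric]) auto
    finally show "(LINT \<omega>:B|M. indicat_real A (Y \<omega>)) = (LINT \<omega>:B|M. measure (\<kappa> \<omega>) A)"
      by (simp add: set_lebesgue_integral_def)
  next
    show "integrable M (\<lambda>\<omega>. indicat_real A (Y \<omega>))"
      by (rule integrable_const_bound[where B = 1]) (auto split: split_indicator)
    show "integrable M (\<lambda>\<omega>. measure (\<kappa> \<omega>) A)"
      using le by (intro integrable_const_bound[where B = 1]) auto
  qed (rule mG)
qed

section \<open>Conditional laws\<close>

context random_environment
begin

abbreviation "F \<equiv> natural_filtration M \<Gamma>"

lemma AE_\<Gamma>_pos: "1 \<le> n \<Longrightarrow> AE \<omega> in M. 0 < \<Gamma> n \<omega>"
  using AE_pos_env[of n] by eventually_elim (rule Gam_pos)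

lemma space_F: "space (F n) = space M"
  by (simp add: natural_filtration_def space_measure_of_conv)

lemma sets_F: "sets (F n) = sigma_sets (space M) {\<Gamma> k -` A \<inter> space M |k A. k \<in> {1..n} \<and> A \<in> sets borel}"
  unfolding natural_filtration_def by (rule sets_measure_of) auto

lemma filtration_F: "filtration (space M) F"
proof
  show "sets (F i) \<subseteq> sets (F j)" if "i \<le> j" for i j
    unfolding sets_F using that by (intro sigma_sets_mono') fastforce
qed (rule space_F)

lemma subalgebra_F: "subalgebra M (F n)"
  unfolding subalgebra_def space_F sets_F
  by (auto intro!: sets.sigma_sets_subset measurable_sets[OF \<Gamma>_eS_measurable(1)])

lemma \<Gamma>_measurable_F: "k \<in> {1..n} \<Longrightarrow> \<Gamma> k \<in> borel_measurable (F n)"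
  by (rule measurableI) (auto simp: space_F sets_F intro!: sigma_sets.Basic)

text \<open>Each generator of \<open>F n\<close> concerns one coordinate of \<open>hist n\<close>,
  so \<open>F n\<close> is contained in the vimage algebra of \<open>hist n\<close>.\<close>

lemma sets_F_hist:
  assumes "B \<in> sets (F n)"
  obtains C where "C \<in> sets (\<Pi>\<^sub>M k\<in>{1..n}. borel)" "B = hist n -` C \<inter> space M"
proof -
  let ?V = "vimage_algebra (space M) (hist n) (\<Pi>\<^sub>M k\<in>{1..n}. borel)"
  have h: "hist n \<in> space M \<rightarrow> space (\<Pi>\<^sub>M k\<in>{1..n}. borel)"
    by (auto simp: hist_def space_PiM)
  have "\<Gamma> k -` A \<inter> space M \<in> sets ?V" if "k \<in> {1..n}" "A \<in> sets borel" for k A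
  proof -
    have "(\<lambda>\<omega>. hist n \<omega> k) \<in> borel_measurable ?V"
      using that by (intro measurable_compose[OF measurable_vimage_algebra1[OF h] measurable_component_singleton])
    then have "(\<lambda>\<omega>. hist n \<omega> k) -` A \<inter> space ?V \<in> sets ?V"
      using that by (intro measurable_sets)
    then show ?thesis
      using that by (simp add: hist_def)
  qed
  then have "{\<Gamma> k -` A \<inter> space M |k A. k \<in> {1..n} \<and> A \<in> sets borel} \<subseteq> sets ?V"
    by blast
  from sets.sigma_sets_subset[OF this] have "sets (F n) \<subseteq> sets ?V"
    by (simp only: sets_F space_vimage_algebra)
  with assms have "B \<in> {hist n -` C \<inter> space M |C. C \<in> sets (\<Pi>\<^sub>M k\<in>{1..n}. borel)}"
    unfolding sets_vimage_algebra2[OF h] by (rule rev_subsetD)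
  with that show thesis
    by blast
qed

text \<open>The induction hypothesis. Testing on the whole history, and not on \<Gamma>_n only, is
  what makes it a statement about conditioning on \<open>F n\<close>.\<close>

definition cond_gig :: "nat \<Rightarrow> bool" where
  "cond_gig n \<longleftrightarrow> (\<forall>G \<in> borel_measurable ((\<Pi>\<^sub>M k\<in>{1..n}. borel) \<Otimes>\<^sub>M borel).
    (\<integral>\<^sup>+\<omega>. G (hist n \<omega>, eS n \<omega>) \<partial>M) = (\<integral>\<^sup>+\<omega>. \<integral>\<^sup>+v. G (hist n \<omega>, v) \<partial>gig (\<Gamma> n \<omega>) \<partial>M))"

lemma cond_gig_1: "cond_gig 1"
  unfolding cond_gig_def
proof
  fix G :: "(nat \<Rightarrow> real) \<times> real \<Rightarrow> ennreal"
  assume G [measurable]: "G \<in> borel_measurable ((\<Pi>\<^sub>M k\<in>{1..1}. borel) \<Otimes>\<^sub>M borel)"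
  \<comment> \<open>At n = 1 the history has a single entry, so a test function of it is a function
    of \<Gamma>_1.\<close>
  let ?h = "\<lambda>x. \<lambda>k\<in>{1..1::nat}. x :: real"
  have h [measurable]: "?h \<in> borel \<rightarrow>\<^sub>M (\<Pi>\<^sub>M k\<in>{1..1}. borel)"
    by (intro measurable_restrict) simp
  define \<phi> where "\<phi> z = G (?h (fst z), snd z)" for z
  have \<phi> [measurable]: "\<phi> \<in> borel_measurable (borel \<Otimes>\<^sub>M borel)"
    unfolding \<phi>_def by measurable
  have weights: "(\<integral>\<^sup>+\<omega>. f (W 0 (Suc 0) \<omega>, W (Suc 0) 0 \<omega>) \<partial>M) = (\<integral>\<^sup>+a. \<integral>\<^sup>+b. f (a, b) \<partial>gamma_law \<beta> \<partial>gamma_law \<alpha>)"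
    if [measurable]: "f \<in> borel_measurable (borel \<Otimes>\<^sub>M borel)" for f
    unfolding nn_integral_new_weights[OF that, symmetric] distr_new_weights[of 0, symmetric]
    by (subst nn_integral_distr) simp_all
  have eq: "AE \<omega> in M. hist 1 \<omega> = ?h (sqrt (W 0 (Suc 0) \<omega> * W (Suc 0) 0 \<omega>)) \<and>
      \<Gamma> 1 \<omega> = sqrt (W 0 (Suc 0) \<omega> * W (Suc 0) 0 \<omega>) \<and> eS 1 \<omega> = sqrt (W 0 (Suc 0) \<omega> / W (Suc 0) 0 \<omega>)"
    using AE_pos_env[of 1] by eventually_elim (auto simp: hist_def Gam_expS_1[simplified] intro!: restrict_ext)
  have "(\<integral>\<^sup>+\<omega>. G (hist 1 \<omega>, eS 1 \<omega>) \<partial>M) =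
      (\<integral>\<^sup>+\<omega>. \<phi> (sqrt (W 0 (Suc 0) \<omega> * W (Suc 0) 0 \<omega>), sqrt (W 0 (Suc 0) \<omega> / W (Suc 0) 0 \<omega>)) \<partial>M)"
    by (rule nn_integral_cong_AE, use eq in eventually_elim) (simp only: \<phi>_def fst_conv snd_conv)
  also have "\<dots> = (\<integral>\<^sup>+a. \<integral>\<^sup>+b. \<phi> (sqrt (a * b), sqrt (a / b)) \<partial>gamma_law \<beta> \<partial>gamma_law \<alpha>)"
    using weights[of "\<lambda>z. \<phi> (sqrt (fst z * snd z), sqrt (fst z / snd z))"] by simp
  also have "\<dots> = (\<integral>\<^sup>+a. \<integral>\<^sup>+b. (\<integral>\<^sup>+v. \<phi> (sqrt (a * b), v) \<partial>gig (sqrt (a * b))) \<partial>gamma_law \<beta> \<partial>gamma_law \<alpha>)"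
    by (rule gamma_gamma_conditional[OF \<alpha> \<beta> \<phi>])
  also have "\<dots> = (\<integral>\<^sup>+\<omega>. \<integral>\<^sup>+v. \<phi> (sqrt (W 0 (Suc 0) \<omega> * W (Suc 0) 0 \<omega>), v)
      \<partial>gig (sqrt (W 0 (Suc 0) \<omega> * W (Suc 0) 0 \<omega>)) \<partial>M)"
    using weights[of "\<lambda>z. \<integral>\<^sup>+v. \<phi> (sqrt (fst z * snd z), v) \<partial>gig (sqrt (fst z * snd z))"] by simp
  also have "\<dots> = (\<integral>\<^sup>+\<omega>. \<integral>\<^sup>+v. G (hist 1 \<omega>, v) \<partial>gig (\<Gamma> 1 \<omega>) \<partial>M)"
    by (rule nn_integral_cong_AE, use eq in eventually_elim) (simp only: \<phi>_def fst_conv snd_conv)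
  finally show "(\<integral>\<^sup>+\<omega>. G (hist 1 \<omega>, eS 1 \<omega>) \<partial>M) = (\<integral>\<^sup>+\<omega>. \<integral>\<^sup>+v. G (hist 1 \<omega>, v) \<partial>gig (\<Gamma> 1 \<omega>) \<partial>M)" .
qed

text \<open>The new weights are integrated by independence, e^S by its conditional law, and the
  intertwining relation then applies with the history frozen. This one identity yields both the
  induction step and the Markov property.\<close>

lemma cond_step:
  assumes n: "1 \<le> n" and "cond_gig n"
    and H [measurable]: "H \<in> borel_measurable ((\<Pi>\<^sub>M k\<in>{1..n}. borel) \<Otimes>\<^sub>M (borel \<Otimes>\<^sub>M borel))"
  shows "(\<integral>\<^sup>+\<omega>. H (hist n \<omega>, (\<Gamma> (Suc n) \<omega>, eS (Suc n) \<omega>)) \<partial>M) =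
    (\<integral>\<^sup>+\<omega>. \<integral>\<^sup>+y. \<integral>\<^sup>+v. H (hist n \<omega>, (y, v)) \<partial>gig y \<partial>trans_kernel \<alpha> \<beta> (\<Gamma> n \<omega>) \<partial>M)"
proof -
  let ?S = "\<Pi>\<^sub>M k\<in>{1..n}. (borel :: real measure)"
  have last [measurable]: "(\<lambda>h. h n) \<in> borel_measurable ?S"
    using n by (intro measurable_component_singleton) simp
  \<comment> \<open>The update of \<open>Gam_expS_Suc\<close> as a function of ((h, u), (a, b)),
    where the last entry \<open>h n\<close> of the history stands for \<Gamma>_n and u for
    e^S.\<close>
  define Q where "Q z = H (fst (fst z), (fst (fst z) n * sqrt (fst (snd z) * snd (snd z)) / (fst (snd z) + fst (fst z) n / snd (fst z)),
      snd (fst z) * sqrt (fst (snd z) / snd (snd z))))" for z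
  have Q [measurable]: "Q \<in> borel_measurable ((?S \<Otimes>\<^sub>M borel) \<Otimes>\<^sub>M (borel \<Otimes>\<^sub>M borel))"
    unfolding Q_def by measurable
  define R where "R z = (\<integral>\<^sup>+a. \<integral>\<^sup>+b. Q (z, (a, b)) \<partial>gamma_law \<beta> \<partial>gamma_law \<alpha>)" for z
  have R: "R \<in> borel_measurable (?S \<Otimes>\<^sub>M borel)"
    unfolding R_def by measurable
  have hn: "hist n \<omega> n = \<Gamma> n \<omega>" for \<omega>
    using n by (simp add: hist_def)
  have "(\<integral>\<^sup>+\<omega>. H (hist n \<omega>, (\<Gamma> (Suc n) \<omega>, eS (Suc n) \<omega>)) \<partial>M) =
      (\<integral>\<^sup>+\<omega>. Q ((hist n \<omega>, eS n \<omega>), (W n (Suc n) \<omega>, W (Suc n) n \<omega>)) \<partial>M)"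
    by (rule nn_integral_cong_AE, use AE_pos_env[of "Suc n"] in eventually_elim)
       (simp add: Q_def Gam_expS_Suc[OF n] hn)
  also have "\<dots> = (\<integral>\<^sup>+\<omega>. R (hist n \<omega>, eS n \<omega>) \<partial>M)"
    unfolding R_def by (rule nn_integral_past_new_weights[OF n Q])
  also have "\<dots> = (\<integral>\<^sup>+\<omega>. \<integral>\<^sup>+u. R (hist n \<omega>, u) \<partial>gig (\<Gamma> n \<omega>) \<partial>M)"
    using assms(2) R unfolding cond_gig_def by blast
  also have "\<dots> = (\<integral>\<^sup>+\<omega>. \<integral>\<^sup>+y. \<integral>\<^sup>+v. H (hist n \<omega>, (y, v)) \<partial>gig y \<partial>trans_kernel \<alpha> \<beta> (\<Gamma> n \<omega>) \<partial>M)"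
  proof (rule nn_integral_cong_AE, use AE_\<Gamma>_pos[OF n] AE_space in eventually_elim)
    fix \<omega> assume pos: "0 < \<Gamma> n \<omega>" and "\<omega> \<in> space M"
    then have "hist n \<omega> \<in> space ?S"
      by (auto simp: space_PiM hist_def)
    then have "(\<lambda>z. H (hist n \<omega>, z)) \<in> borel_measurable (borel \<Otimes>\<^sub>M borel)"
      by simp
    from gig_gamma_intertwining[OF pos \<alpha> \<beta> this]
    show "(\<integral>\<^sup>+u. R (hist n \<omega>, u) \<partial>gig (\<Gamma> n \<omega>)) =
        (\<integral>\<^sup>+y. \<integral>\<^sup>+v. H (hist n \<omega>, (y, v)) \<partial>gig y \<partial>trans_kernel \<alpha> \<beta> (\<Gamma> n \<omega>))"
      by (simp add: R_def Q_def hn)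
  qed
  finally show ?thesis .
qed

text \<open>The identity \<open>cond_step\<close> is read forwards for the test function and
  backwards for its average over v; in between, both have the same integral against the law attached
  to y.\<close>

lemma cond_gig_Suc:
  assumes n: "1 \<le> n" and IH: "cond_gig n"
  shows "cond_gig (Suc n)"
  unfolding cond_gig_def
proof
  fix G :: "(nat \<Rightarrow> real) \<times> real \<Rightarrow> ennreal"
  assume G [measurable]: "G \<in> borel_measurable ((\<Pi>\<^sub>M k\<in>{1..Suc n}. borel) \<Otimes>\<^sub>M borel)"
  let ?S = "\<Pi>\<^sub>M k\<in>{1..n}. (borel :: real measure)" and ?S' = "\<Pi>\<^sub>M k\<in>{1..Suc n}. (borel :: real measure)"
  have upd [measurable]: "(\<lambda>z. (fst z)(Suc n := fst (snd z))) \<in> ?S \<Otimes>\<^sub>M (borel \<Otimes>\<^sub>M borel) \<rightarrow>\<^sub>M ?S'"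
    by (rule measurable_fun_upd[where J = "{1..n}"]) auto
  have hist_Suc: "hist (Suc n) \<omega> = (hist n \<omega>)(Suc n := \<Gamma> (Suc n) \<omega>)" for \<omega>
    by (auto simp: hist_def fun_eq_iff)
  define H where "H z = G ((fst z)(Suc n := fst (snd z)), snd (snd z))" for z
  have H: "H \<in> borel_measurable (?S \<Otimes>\<^sub>M (borel \<Otimes>\<^sub>M borel))"
    unfolding H_def by measurable
  define H' where "H' z = (\<integral>\<^sup>+v. G ((fst z)(Suc n := fst (snd z)), v) \<partial>gig (fst (snd z)))" for z :: "(nat \<Rightarrow> real) \<times> real \<times> real"
  have H': "H' \<in> borel_measurable (?S \<Otimes>\<^sub>M (borel \<Otimes>\<^sub>M borel))"
    unfolding H'_def by measurable
  have "(\<integral>\<^sup>+\<omega>. G (hist (Suc n) \<omega>, eS (Suc n) \<omega>) \<partial>M) = (\<integral>\<^sup>+\<omega>. H (hist n \<omega>, (\<Gamma> (Suc n) \<omega>, eS (Suc n) \<omega>)) \<partial>M)"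
    by (simp add: H_def hist_Suc)
  also have "\<dots> = (\<integral>\<^sup>+\<omega>. \<integral>\<^sup>+y. \<integral>\<^sup>+v. H (hist n \<omega>, (y, v)) \<partial>gig y \<partial>trans_kernel \<alpha> \<beta> (\<Gamma> n \<omega>) \<partial>M)"
    by (rule cond_step[OF n IH H])
  \<comment> \<open>\<open>H'\<close> averages \<open>H\<close> over \<open>v\<close> and no longer depends on it, so averaging once more changes nothing.\<close>
  also have "\<dots> = (\<integral>\<^sup>+\<omega>. \<integral>\<^sup>+y. \<integral>\<^sup>+v. H' (hist n \<omega>, (y, v)) \<partial>gig y \<partial>trans_kernel \<alpha> \<beta> (\<Gamma> n \<omega>) \<partial>M)"
  proof (rule nn_integral_cong, rule nn_integral_cong_AE)
    fix \<omega>
    show "AE y in trans_kernel \<alpha> \<beta> (\<Gamma> n \<omega>). (\<integral>\<^sup>+v. H (hist n \<omega>, (y, v)) \<partial>gig y) = (\<integral>\<^sup>+v. H' (hist n \<omega>, (y, v)) \<partial>gig y)"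
      using AE_trans_kernel_pos
      by eventually_elim (simp only: H_def H'_def fst_conv snd_conv nn_integral_gig_law_const)
  qed
  also have "\<dots> = (\<integral>\<^sup>+\<omega>. H' (hist n \<omega>, (\<Gamma> (Suc n) \<omega>, eS (Suc n) \<omega>)) \<partial>M)"
    by (rule cond_step[OF n IH H', symmetric])
  also have "\<dots> = (\<integral>\<^sup>+\<omega>. \<integral>\<^sup>+v. G (hist (Suc n) \<omega>, v) \<partial>gig (\<Gamma> (Suc n) \<omega>) \<partial>M)"
    by (simp add: H'_def hist_Suc)
  finally show "(\<integral>\<^sup>+\<omega>. G (hist (Suc n) \<omega>, eS (Suc n) \<omega>) \<partial>M) =
      (\<integral>\<^sup>+\<omega>. \<integral>\<^sup>+v. G (hist (Suc n) \<omega>, v) \<partial>gig (\<Gamma> (Suc n) \<omega>) \<partial>M)" .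
qed

lemma cond_gig: "1 \<le> n \<Longrightarrow> cond_gig n"
  by (induction n rule: dec_induct) (use cond_gig_1 cond_gig_Suc in auto)

lemma has_cond_law_eS:
  assumes n: "1 \<le> n"
  shows "has_cond_law M (F n) (eS n) (\<lambda>\<omega>. gig (\<Gamma> n \<omega>))"
proof (rule has_cond_lawI[OF prob_space_axioms subalgebra_F \<Gamma>_eS_measurable(2)[OF n]])
  show "AE \<omega> in M. prob_space (gig (\<Gamma> n \<omega>))"
    using AE_\<Gamma>_pos[OF n] by eventually_elim (rule prob_space_gig_law)
next
  fix A :: "real set" assume A [measurable]: "A \<in> sets borel"
  have [measurable]: "\<Gamma> n \<in> borel_measurable (F n)"
    using n by (intro \<Gamma>_measurable_F) simp
  \<comment> \<open>As an integral, the mass falls under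
    \<open>borel_measurable_nn_integral_gig_law\<close>.\<close>
  have ind: "emeasure (gig x) A = (\<integral>\<^sup>+v. indicator A v \<partial>gig x)" for x
    by simp
  show "(\<lambda>\<omega>. emeasure (gig (\<Gamma> n \<omega>)) A) \<in> borel_measurable (F n)"
    unfolding ind by measurable
  fix B assume "B \<in> sets (F n)"
  then obtain C where C [measurable]: "C \<in> sets (\<Pi>\<^sub>M k\<in>{1..n}. borel)" and B: "B = hist n -` C \<inter> space M"
    by (rule sets_F_hist)
  define G where "G z = (indicator C (fst z) * indicator A (snd z) :: ennreal)" for z :: "(nat \<Rightarrow> real) \<times> real"
  have "G \<in> borel_measurable ((\<Pi>\<^sub>M k\<in>{1..n}. borel) \<Otimes>\<^sub>M borel)"
    unfolding G_def by measurable
  then have "(\<integral>\<^sup>+\<omega>. G (hist n \<omega>, eS n \<omega>) \<partial>M) = (\<integral>\<^sup>+\<omega>. \<integral>\<^sup>+v. G (hist n \<omega>, v) \<partial>gig (\<Gamma> n \<omega>) \<partial>M)"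
    using cond_gig[OF n] unfolding cond_gig_def by blast
  moreover have "(\<integral>\<^sup>+v. G (hist n \<omega>, v) \<partial>gig (\<Gamma> n \<omega>)) = indicator C (hist n \<omega>) * emeasure (gig (\<Gamma> n \<omega>)) A" for \<omega>
    unfolding G_def by (simp add: nn_integral_cmult)
  moreover have "indicator B \<omega> = (indicator C (hist n \<omega>) :: ennreal)" if "\<omega> \<in> space M" for \<omega>
    using that by (auto simp: B split: split_indicator)
  ultimately show "(\<integral>\<^sup>+\<omega>. indicator B \<omega> * indicator A (eS n \<omega>) \<partial>M) = (\<integral>\<^sup>+\<omega>. indicator B \<omega> * emeasure (gig (\<Gamma> n \<omega>)) A \<partial>M)"
    by (simp add: G_def cong: nn_integral_cong)
qed

text \<open>With a test function that ignores the new e^S, the inner integral in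
  \<open>cond_step\<close> is that of a constant against a probability law, and only the kernel
  evaluated at \<Gamma>_n remains.\<close>

lemma has_cond_law_\<Gamma>:
  assumes n: "1 \<le> n"
  shows "has_cond_law M (F n) (\<Gamma> (Suc n)) (\<lambda>\<omega>. trans_kernel \<alpha> \<beta> (\<Gamma> n \<omega>))"
proof (rule has_cond_lawI[OF prob_space_axioms subalgebra_F \<Gamma>_eS_measurable(1)])
  show "AE \<omega> in M. prob_space (trans_kernel \<alpha> \<beta> (\<Gamma> n \<omega>))"
    using AE_\<Gamma>_pos[OF n] by eventually_elim (rule prob_space_trans_kernel[OF \<alpha> \<beta>])
next
  fix A :: "real set" assume A [measurable]: "A \<in> sets borel"
  have [measurable]: "\<Gamma> n \<in> borel_measurable (F n)"
    using n by (intro \<Gamma>_measurable_F) simp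
  have ind: "emeasure (trans_kernel \<alpha> \<beta> x) A = (\<integral>\<^sup>+v. indicator A v \<partial>trans_kernel \<alpha> \<beta> x)" for x
    by simp
  show "(\<lambda>\<omega>. emeasure (trans_kernel \<alpha> \<beta> (\<Gamma> n \<omega>)) A) \<in> borel_measurable (F n)"
    unfolding ind by measurable
  fix B assume "B \<in> sets (F n)"
  then obtain C where C [measurable]: "C \<in> sets (\<Pi>\<^sub>M k\<in>{1..n}. borel)" and B: "B = hist n -` C \<inter> space M"
    by (rule sets_F_hist)
  define H where "H z = (indicator C (fst z) * indicator A (fst (snd z)) :: ennreal)" for z :: "(nat \<Rightarrow> real) \<times> real \<times> real"
  have "H \<in> borel_measurable ((\<Pi>\<^sub>M k\<in>{1..n}. borel) \<Otimes>\<^sub>M (borel \<Otimes>\<^sub>M borel))"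
    unfolding H_def by measurable
  then have "(\<integral>\<^sup>+\<omega>. H (hist n \<omega>, (\<Gamma> (Suc n) \<omega>, eS (Suc n) \<omega>)) \<partial>M) =
      (\<integral>\<^sup>+\<omega>. \<integral>\<^sup>+y. \<integral>\<^sup>+v. H (hist n \<omega>, (y, v)) \<partial>gig y \<partial>trans_kernel \<alpha> \<beta> (\<Gamma> n \<omega>) \<partial>M)"
    by (rule cond_step[OF n cond_gig[OF n]])
  moreover have "(\<integral>\<^sup>+y. \<integral>\<^sup>+v. H (hist n \<omega>, (y, v)) \<partial>gig y \<partial>trans_kernel \<alpha> \<beta> (\<Gamma> n \<omega>)) =
      indicator C (hist n \<omega>) * emeasure (trans_kernel \<alpha> \<beta> (\<Gamma> n \<omega>)) A" for \<omega>
  proof -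
    have "(\<integral>\<^sup>+y. \<integral>\<^sup>+v. H (hist n \<omega>, (y, v)) \<partial>gig y \<partial>trans_kernel \<alpha> \<beta> (\<Gamma> n \<omega>)) =
        (\<integral>\<^sup>+y. indicator C (hist n \<omega>) * indicator A y \<partial>trans_kernel \<alpha> \<beta> (\<Gamma> n \<omega>))"
      by (rule nn_integral_cong_AE, use AE_trans_kernel_pos in eventually_elim)
         (simp only: H_def fst_conv snd_conv nn_integral_gig_law_const)
    also have "\<dots> = indicator C (hist n \<omega>) * emeasure (trans_kernel \<alpha> \<beta> (\<Gamma> n \<omega>)) A"
      by (simp add: nn_integral_cmult)
    finally show ?thesis .
  qed
  moreover have "indicator B \<omega> = (indicator C (hist n \<omega>) :: ennreal)" if "\<omega> \<in> space M" for \<omega>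
    using that by (auto simp: B split: split_indicator)
  ultimately show "(\<integral>\<^sup>+\<omega>. indicator B \<omega> * indicator A (\<Gamma> (Suc n) \<omega>) \<partial>M) =
      (\<integral>\<^sup>+\<omega>. indicator B \<omega> * emeasure (trans_kernel \<alpha> \<beta> (\<Gamma> n \<omega>)) A \<partial>M)"
    by (simp add: H_def cong: nn_integral_cong)
qed simp

lemma markov_process_\<Gamma>: "markov_process M F {0<..} (trans_kernel \<alpha> \<beta>) \<Gamma>"
  unfolding markov_process_def
  using filtration_F markov_kernel_on_trans_kernel[OF \<alpha> \<beta>] AE_\<Gamma>_pos has_cond_law_\<Gamma> \<Gamma>_measurable_F
  by auto

end

theorem theorem2p7:
  fixes M :: "'a measure" and W :: "nat \<Rightarrow> nat \<Rightarrow> 'a \<Rightarrow> real" and \<alpha> \<beta> :: real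
  defines "\<Gamma> \<equiv> \<lambda>n \<omega>. Gam n (\<lambda>i j. W i j \<omega>)"
    and "eS \<equiv> \<lambda>n \<omega>. expS n (\<lambda>i j. W i j \<omega>)"
  defines "F \<equiv> natural_filtration M \<Gamma>"
  assumes "prob_space M" and "0 < \<alpha>" and "0 < \<beta>"
    and "prob_space.indep_vars M (\<lambda>_. borel) (\<lambda>(i, j). W i j) {(i, j). j = Suc i \<or> i = Suc j}"
    and "\<And>i. distributed M lborel (W i (Suc i)) (\<lambda>x. ennreal (gamma_density \<alpha> x))"
    and "\<And>i. distributed M lborel (W (Suc i) i) (\<lambda>x. ennreal (gamma_density \<beta> x))"
  shows "markov_process M F {0<..} (trans_kernel \<alpha> \<beta>) \<Gamma> \<and>
    (\<forall>n\<ge>1. has_cond_law M (F n) (eS n) (\<lambda>\<omega>. gig_law (\<alpha> - \<beta>) (2 * \<Gamma> n \<omega>) (2 * \<Gamma> n \<omega>)))"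
proof -
  interpret random_environment M W \<alpha> \<beta>
    by (intro random_environment.intro random_environment_axioms.intro assms)
  show ?thesis
    unfolding F_def \<Gamma>_def eS_def using markov_process_\<Gamma> has_cond_law_eS by blast
qed

end
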